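(* Let $(X,H,\mu)$ be an abstract Wiener space. Let $S:H\to H$ be a bounded linear operator with $SS^*=I$, and write $S_N:=S^N$, where $S_N$ also denotes the $\mu$-a.e. defined measurable linear extension to $X$. (i) If $\langle S_N x,y\rangle_H\to 0$ as $N\to\infty$ for all $x,y\in H$, then for $\mu$-almost every $x\in X$ the set of limit points (in the norm topology of $X$) of the sequence $\left(\frac{S_Nx}{\sqrt{2\log N}}\right)_{N\ge 2}$ is equal to the closed unit ball of $H$. (ii) Conversely, if for $\mu$-almost every $x\in X$ the set of limit points of $\left(\frac{S_Nx}{\sqrt{2\log N}}\right)_{N\ge 2}$ is equal to the closed unit ball of $H$, then $\frac1N\sum_{k=1}^N|\langle S_kx,y\rangle_H|\to 0$ as $N\to\infty$ for all $x,y\in H$.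
   Context: An abstract Wiener space $(X,H,\mu)$ consists of a separable real Banach space $X$, a centered Gaussian measure $\mu$ on $X$, and its Cameron-Martin space $H\hookrightarrow X$ (compactly embedded). Every bounded linear $S:H\to H$ with $SS^*=I$ (adjoint with respect to the inner product of $H$) has an extension, unique up to $\mu$-a.e. equality, to a Borel-measurable linear map $\hat S:E\to X$ defined on a Borel-measurable linear subspace $E\subset X$ with $\mu(E)=1$; this extension preserves $\mu$. Its iterates $\hat S^N$, $N\ge 1$, are simultaneously defined on a Borel linear subspace of full measure. One writes $S$ for $\hat S$ and $S_N$ for $\hat S^N$. A limit point of a sequence is a limit of some subsequence (along indices tending to infinity). *)

theory Defs
  imports "HOL-Probability.Probability"
begin

text \<open>A real random variable is centered Gaussian if its law is \<open>N(0, \<sigma>\<^sup>2)\<close>; the degenerate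
  case \<open>\<sigma> = 0\<close> (the Dirac mass at \<open>0\<close>) is included.\<close>

definition centered_gaussian_rv :: "'a measure \<Rightarrow> ('a \<Rightarrow> real) \<Rightarrow> bool" where
  "centered_gaussian_rv M f \<longleftrightarrow>
     distr M borel f = return borel 0 \<or>
     (\<exists>\<sigma>>0. distr M borel f = density lborel (\<lambda>x. ennreal (normal_density 0 \<sigma> x)))"

definition centered_gaussian_measure :: "'a::real_normed_vector measure \<Rightarrow> bool" where
  "centered_gaussian_measure M \<longleftrightarrow>
     prob_space M \<and> sets M = sets borel \<and>
     (\<forall>f. bounded_linear f \<longrightarrow> centered_gaussian_rv M f)"

text \<open>The Cameron--Martin norm of \<open>h\<close> is the supremum of \<open>f h\<close> over the continuous linear
  functionals \<open>f\<close> with \<open>L\<^sup>2(M)\<close>-norm at most \<open>1\<close>, and the Cameron--Martin space consists of the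
  vectors for which this supremum is finite.\<close>

definition cm_functionals :: "'a::real_normed_vector measure \<Rightarrow> ('a \<Rightarrow> real) set" where
  "cm_functionals M = {f. bounded_linear f \<and> (\<integral>x. (f x)\<^sup>2 \<partial>M) \<le> 1}"

definition cm_space :: "'a::real_normed_vector measure \<Rightarrow> 'a set" where
  "cm_space M = {h. bdd_above ((\<lambda>f. f h) ` cm_functionals M)}"

definition cm_norm :: "'a::real_normed_vector measure \<Rightarrow> 'a \<Rightarrow> real" where
  "cm_norm M h = (SUP f\<in>cm_functionals M. f h)"

text \<open>The Cameron--Martin space is carried by a Hilbert space type \<open>'h\<close>, and \<open>\<iota>\<close> is its inclusion
  into \<open>'a\<close>. By polarization, matching the norms also matches the inner products. The embedding
  is automatically compact, and no density of its range (nondegeneracy of \<open>M\<close>) is assumed.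
  Separability of \<open>'a\<close> is expressed by second countability.\<close>

locale abstract_wiener_space =
  fixes M :: "'a::{banach, second_countable_topology} measure"
    and \<iota> :: "'h::{real_inner, complete_space} \<Rightarrow> 'a"
  assumes gaussian: "centered_gaussian_measure M"
    and linear_incl: "linear \<iota>"
    and bij_incl: "bij_betw \<iota> UNIV (cm_space M)"
    and norm_incl: "norm h = cm_norm M (\<iota> h)"

text \<open>\<open>T\<close> is a Borel linear map on the full-measure Borel subspace \<open>E\<close> extending \<open>S\<close>. It is total
  only as an object of the logic: its values outside \<open>E\<close> are unconstrained. Since such a \<open>T\<close>
  preserves \<open>M\<close>, almost every \<open>x\<close> satisfies \<open>(T ^^ k) x \<in> E\<close> for all \<open>k\<close>, so the iterates are
  unaffected by those values up to a null set.\<close>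

definition measurable_linear_extension ::
  "'a::real_normed_vector measure \<Rightarrow> ('h \<Rightarrow> 'a) \<Rightarrow> ('h \<Rightarrow> 'h) \<Rightarrow> 'a set \<Rightarrow> ('a \<Rightarrow> 'a) \<Rightarrow> bool" where
  "measurable_linear_extension M \<iota> S E T \<longleftrightarrow>
     subspace E \<and> E \<in> sets borel \<and> emeasure M E = 1 \<and>
     T \<in> restrict_space borel E \<rightarrow>\<^sub>M borel \<and>
     (\<forall>x\<in>E. \<forall>y\<in>E. T (x + y) = T x + T y) \<and>
     (\<forall>c. \<forall>x\<in>E. T (c *\<^sub>R x) = c *\<^sub>R T x) \<and>
     (\<forall>h. \<iota> h \<in> E \<and> T (\<iota> h) = \<iota> (S h))"

text \<open>Limits of subsequences; unlike \<open>islimpt\<close> on the range, this counts values that are attained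
  infinitely often.\<close>

definition seq_limit_points :: "(nat \<Rightarrow> 'a::topological_space) \<Rightarrow> 'a set" where
  "seq_limit_points u = {l. \<exists>r. strict_mono r \<and> (u \<circ> r) \<longlonglongrightarrow> l}"

text \<open>The terms with \<open>N < 2\<close> do not influence the limit points.\<close>

definition normalized_orbit :: "('a::real_vector \<Rightarrow> 'a) \<Rightarrow> 'a \<Rightarrow> nat \<Rightarrow> 'a" where
  "normalized_orbit T x N = (T ^^ N) x /\<^sub>R sqrt (2 * ln (real N))"

end

theory Submission
  imports Defs
begin

text \<open>The orbit of \<open>x\<close> under the measurable extension of \<open>S\<close> is a stationary Gaussian sequence in \<open>'a\<close>,
  and its covariances are the matrix coefficients of the powers of \<open>S\<close>. Let \<open>U\<close> be the adjoint of
  \<open>S\<close>; it is an isometry.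

  The dictionary between the two sides is built first. A Borel measure on a separable Banach space
  is determined by the laws of continuous functionals (\<open>measure_eqI_functionals\<close>), so a centered
  Gaussian measure has the property that independent pairs are invariant under rotations
  (\<open>rotation_invariant\<close>). This invariance yields three facts: measurable linear functionals, such as
  \<open>f \<circ> T\<^sup>N\<close>, are Gaussian; the tails of Fernique's theorem; and the concentration of maxima
  (\<open>max_concentration\<close>). The Cameron--Martin formula shows that a measurable linear functional has
  the variance given by its restriction to the Cameron--Martin space (\<open>represents_riesz\<close>). Since
  \<open>f \<circ> T\<^sup>N\<close> restricts to \<open>U\<^sup>N (riesz f)\<close>, where \<open>riesz f\<close> is the vector that represents \<open>f\<close>, the
  extension preserves the measure, and all joint laws can be computed.

  In part (i), Fernique's theorem for a compact convex set makes the normalized orbit relatively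
  compact, and the first Borel--Cantelli lemma puts its limit points into the unit ball. For the
  converse inclusion it suffices that \<open>f\<close> asymptotically attains its maximum over the ball along the
  orbit: the ball is strictly convex, so this determines the limit point
  (\<open>exposed_point_is_limit_point\<close>). This gives the unit sphere. The whole ball follows because
  \<open>U\<^sup>N u\<close> tends weakly to \<open>0\<close> and the embedding is compact. The growth of \<open>f (T\<^sup>N x)\<close> has to be
  derived from covariances that tend to \<open>0\<close> arbitrarily slowly (\<open>growth_lower\<close>): the second moment
  method for a sparse set of indices shows that the expected maximum is reached with a probability
  that is at worst a small negative power of the number of indices, and the concentration
  inequality improves it to a probability close to \<open>1\<close>.

  In part (ii), a failure of weak mixing produces, by averaging rank-one operators along the orbit,
  a nonzero operator that commutes with \<open>U\<close> and is almost of finite rank (\<open>averaged_operator\<close>). The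
  vectors \<open>v\<close> in its range have almost finite-dimensional orbits. Then \<open>f (T\<^sup>N x)\<close>, for \<open>riesz f\<close>
  close to \<open>v\<close>, is essentially bounded in \<open>N\<close>, and \<open>\<iota> (v / norm v)\<close> cannot be a limit point.\<close>

section \<open>Dominated extension and norming functionals\<close>

definition sublinear :: "('a::real_vector \<Rightarrow> real) \<Rightarrow> bool" where
  "sublinear q \<longleftrightarrow> (\<forall>x y. q (x + y) \<le> q x + q y) \<and> (\<forall>c\<ge>0. \<forall>x. q (c *\<^sub>R x) \<le> c * q x)"

lemma sublinear_add: "sublinear q \<Longrightarrow> q (x + y) \<le> q x + q y"
  by (simp add: sublinear_def)

lemma sublinear_zero: assumes "sublinear q" shows "q 0 = 0"
proof -
  have "q (0 *\<^sub>R 0) \<le> 0 * q 0" using assms unfolding sublinear_def by blast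
  moreover have "q (0 + 0) \<le> q 0 + q 0" using assms unfolding sublinear_def by blast
  ultimately show ?thesis by simp
qed

lemma sublinear_scaleR: assumes "sublinear q" "c \<ge> 0" shows "q (c *\<^sub>R x) = c * q x"
proof (cases "c = 0")
  case True then show ?thesis using sublinear_zero[OF assms(1)] by simp
next
  case False
  then have c: "c > 0" using assms by simp
  have *: "\<forall>c\<ge>0. \<forall>x. q (c *\<^sub>R x) \<le> c * q x" using assms(1) unfolding sublinear_def by blast
  have "q x \<le> (1/c) * q (c *\<^sub>R x)"
    using *[rule_format, of "1/c" "c *\<^sub>R x"] c by simp
  then have "c * q x \<le> q (c *\<^sub>R x)" using c by (simp add: field_simps)
  moreover have "q (c *\<^sub>R x) \<le> c * q x" using * assms(2) by blast
  ultimately show ?thesis by simp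
qed

lemma sublinear_lower: assumes "sublinear q" shows "- q (- x) \<le> q x"
  using sublinear_add[OF assms, of x "- x"] sublinear_zero[OF assms] by simp

text \<open>The largest sublinear \<open>r \<le> q\<close> with \<open>r (- z) \<le> - q z\<close>. If it equals \<open>q\<close> for every \<open>z\<close>, then \<open>q\<close> is
  odd and therefore linear.\<close>

definition flatten_along :: "('a::real_vector \<Rightarrow> real) \<Rightarrow> 'a \<Rightarrow> 'a \<Rightarrow> real" where
  "flatten_along q z x = (INF t\<in>{0..}. q (x + t *\<^sub>R z) - t * q z)"

lemma flatten_along_bdd:
  assumes "sublinear q"
  shows "bdd_below ((\<lambda>t. q (x + t *\<^sub>R z) - t * q z) ` {0..})"
proof (rule bdd_belowI2[where m = "- q (- x)"])
  fix t :: real assume "t \<in> {0..}"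
  then have "t * q z = q ((x + t *\<^sub>R z) + (- x))" using sublinear_scaleR[OF assms, of t z] by simp
  also have "\<dots> \<le> q (x + t *\<^sub>R z) + q (- x)" by (rule sublinear_add[OF assms])
  finally show "- q (- x) \<le> q (x + t *\<^sub>R z) - t * q z" by simp
qed

lemma flatten_along_le:
  assumes "sublinear q" "t \<ge> 0"
  shows "flatten_along q z x \<le> q (x + t *\<^sub>R z) - t * q z"
  unfolding flatten_along_def using assms by (intro cINF_lower flatten_along_bdd) auto

lemma flatten_along_greatest:
  assumes "\<And>t. t \<ge> 0 \<Longrightarrow> m \<le> q (x + t *\<^sub>R z) - t * q z"
  shows "m \<le> flatten_along q z x"
  unfolding flatten_along_def using assms by (intro cINF_greatest) auto

lemma sublinear_flatten_along:
  assumes "sublinear q" shows "sublinear (flatten_along q z)"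
  unfolding sublinear_def
proof (intro conjI allI impI)
  fix x y
  have "flatten_along q z (x + y) - (q (y + t *\<^sub>R z) - t * q z) \<le> q (x + s *\<^sub>R z) - s * q z"
    if "s \<ge> 0" "t \<ge> 0" for s t
  proof -
    have "flatten_along q z (x + y) \<le> q ((x + y) + (s + t) *\<^sub>R z) - (s + t) * q z"
      using that by (intro flatten_along_le[OF assms]) simp
    also have "(x + y) + (s + t) *\<^sub>R z = (x + s *\<^sub>R z) + (y + t *\<^sub>R z)" by (simp add: algebra_simps)
    also have "q \<dots> \<le> q (x + s *\<^sub>R z) + q (y + t *\<^sub>R z)" by (rule sublinear_add[OF assms])
    finally show ?thesis by (simp add: algebra_simps)
  qed
  then have *: "flatten_along q z (x + y) - (q (y + t *\<^sub>R z) - t * q z) \<le> flatten_along q z x"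
    if "t \<ge> 0" for t using that by (intro flatten_along_greatest)
  have "flatten_along q z (x + y) - flatten_along q z x \<le> q (y + t *\<^sub>R z) - t * q z"
    if "t \<ge> 0" for t using *[OF that] by linarith
  then have "flatten_along q z (x + y) - flatten_along q z x \<le> flatten_along q z y"
    by (rule flatten_along_greatest)
  then show "flatten_along q z (x + y) \<le> flatten_along q z x + flatten_along q z y" by simp
next
  fix c :: real and x assume c: "c \<ge> 0"
  show "flatten_along q z (c *\<^sub>R x) \<le> c * flatten_along q z x"
  proof (cases "c = 0")
    case True
    have "flatten_along q z 0 \<le> q (0 + 0 *\<^sub>R z) - 0 * q z" by (rule flatten_along_le[OF assms]) simp
    then show ?thesis using True sublinear_zero[OF assms] by simp
  next
    case False
    then have c: "c > 0" using c by simp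
    have "flatten_along q z (c *\<^sub>R x) / c \<le> flatten_along q z x"
    proof (rule flatten_along_greatest)
      fix t :: real assume t: "t \<ge> 0"
      have "flatten_along q z (c *\<^sub>R x) \<le> q (c *\<^sub>R x + (c * t) *\<^sub>R z) - (c * t) * q z"
        using c t by (intro flatten_along_le[OF assms]) simp
      also have "c *\<^sub>R x + (c * t) *\<^sub>R z = c *\<^sub>R (x + t *\<^sub>R z)" by (simp add: algebra_simps)
      also have "q \<dots> = c * q (x + t *\<^sub>R z)" using c by (intro sublinear_scaleR[OF assms]) simp
      finally show "flatten_along q z (c *\<^sub>R x) / c \<le> q (x + t *\<^sub>R z) - t * q z"
        using c by (simp add: field_simps)
    qed
    then show ?thesis using c by (simp add: field_simps)
  qed
qed

lemma flatten_along_le_self: "sublinear q \<Longrightarrow> flatten_along q z x \<le> q x"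
  using flatten_along_le[of q 0 z x] by simp

lemma flatten_along_minus: "sublinear q \<Longrightarrow> flatten_along q z (- z) \<le> - q z"
  using flatten_along_le[of q 1 z "- z"] sublinear_zero[of q] by simp

text \<open>A minimal sublinear functional equals each of its flattenings, hence is odd, hence linear;
  minimal functionals exist because the infimum of a chain is again sublinear.\<close>

lemma minimal_sublinear_below:
  assumes p: "sublinear (p :: 'a::real_vector \<Rightarrow> real)"
  shows "\<exists>q. sublinear q \<and> q \<le> p \<and> (\<forall>q'. sublinear q' \<and> q' \<le> q \<longrightarrow> q' = q)"
proof -
  define A where "A = {q. sublinear q \<and> q \<le> p}"
  have po: "partial_order_on A (relation_of (\<lambda>q r. r \<le> q) A)"
  proof (rule partial_order_on_relation_ofI)
    show "c \<le> a" if "b \<le> a" "c \<le> b" for a b c :: "'a \<Rightarrow> real" using that by (rule order_trans[rotated])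
    show "a = b" if "b \<le> a" "a \<le> b" for a b :: "'a \<Rightarrow> real" using that by (rule order_antisym[rotated])
  qed simp
  have "\<exists>m\<in>A. \<forall>a\<in>A. a \<le> m \<longrightarrow> a = m"
  proof (rule predicate_Zorn[OF po])
    fix C assume C: "C \<in> Chains (relation_of (\<lambda>q r. r \<le> q) A)"
    have CA: "C \<subseteq> A" using C by (auto simp: Chains_def relation_of_def)
    have tot: "q \<le> r \<or> r \<le> q" if "q \<in> C" "r \<in> C" for q r
      using C that by (auto simp: Chains_def relation_of_def)
    show "\<exists>u\<in>A. \<forall>a\<in>C. u \<le> a"
    proof (cases "C = {}")
      case True then show ?thesis using p by (auto simp: A_def)
    next
      case False
      define u where "u x = (INF q\<in>C. q x)" for x
      have sub: "sublinear q" "q \<le> p" if "q \<in> C" for q using that CA by (auto simp: A_def)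
      have bdd: "bdd_below ((\<lambda>q. q x) ` C)" for x
      proof (rule bdd_belowI2[where m = "- p (- x)"])
        fix q assume "q \<in> C"
        then show "- p (- x) \<le> q x"
          using sublinear_lower[OF sub(1), of q x] sub(2)[of q] by (meson le_funD neg_le_iff_le order_trans)
      qed
      have u_le: "u x \<le> q x" if "q \<in> C" for q x
        unfolding u_def using that by (intro cINF_lower bdd)
      have u_gr: "m \<le> u x" if "\<And>q. q \<in> C \<Longrightarrow> m \<le> q x" for m x
        unfolding u_def using that False by (intro cINF_greatest) auto
      have "sublinear u" unfolding sublinear_def
      proof (intro conjI allI impI)
        fix x y
        have *: "u (x + y) \<le> q x + r y" if qr: "q \<in> C" "r \<in> C" for q r
        proof -
          obtain s where s: "s \<in> C" "s \<le> q" "s \<le> r" using tot[OF qr] qr by blast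
          have "u (x + y) \<le> s (x + y)" using u_le s by blast
          also have "\<dots> \<le> s x + s y" by (rule sublinear_add[OF sub(1)[OF s(1)]])
          also have "\<dots> \<le> q x + r y" using s by (intro add_mono) (auto dest: le_funD)
          finally show ?thesis .
        qed
        have "u (x + y) - r y \<le> u x" if "r \<in> C" for r
          using *[OF _ that] by (intro u_gr) (simp add: algebra_simps)
        then have "u (x + y) - u x \<le> u y" by (intro u_gr) (simp add: algebra_simps)
        then show "u (x + y) \<le> u x + u y" by simp
      next
        fix c :: real and x assume c: "c \<ge> 0"
        show "u (c *\<^sub>R x) \<le> c * u x"
        proof (cases "c = 0")
          case True
          obtain q where "q \<in> C" using False by blast
          then have "u (c *\<^sub>R x) \<le> q 0" using u_le True by simp
          then show ?thesis using True sublinear_zero[OF sub(1)[OF \<open>q \<in> C\<close>]] by simp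
        next
          case False
          then have c: "c > 0" using c by simp
          have "u (c *\<^sub>R x) / c \<le> u x"
          proof (rule u_gr)
            fix q assume q: "q \<in> C"
            have "u (c *\<^sub>R x) \<le> c * q x"
              using u_le[OF q, of "c *\<^sub>R x"] sublinear_scaleR[OF sub(1)[OF q], of c x] c by simp
            then show "u (c *\<^sub>R x) / c \<le> q x" using c by (simp add: field_simps)
          qed
          then show ?thesis using c by (simp add: field_simps)
        qed
      qed
      moreover have "u \<le> p" 
      proof -
        obtain q where "q \<in> C" using False by blast
        then show ?thesis using u_le sub(2) by (meson le_funD le_funI order_trans)
      qed
      ultimately show ?thesis using u_le by (intro bexI[of _ u]) (auto simp: A_def le_fun_def)
    qed
  qed
  then obtain m where m: "m \<in> A" "\<And>a. a \<in> A \<Longrightarrow> a \<le> m \<Longrightarrow> a = m" by blast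
  show ?thesis
  proof (intro exI[of _ m] conjI allI impI)
    fix q' assume "sublinear q' \<and> q' \<le> m"
    then show "q' = m" using m by (intro m(2)) (auto simp: A_def)
  qed (use m in \<open>auto simp: A_def\<close>)
qed

text \<open>A minimal functional below the flattening of \<open>p\<close> along \<open>z\<close> keeps the value \<open>p z\<close>, because the
  flattening already forces its value at \<open>- z\<close> down to \<open>- p z\<close>.\<close>

theorem hahn_banach_sublinear:
  fixes p :: "'a::real_vector \<Rightarrow> real"
  assumes p: "sublinear p"
  obtains L where "linear L" "\<And>x. L x \<le> p x" "L z = p z"
proof -
  obtain L where L: "sublinear L" "L \<le> flatten_along p z"
      and min: "\<And>q. sublinear q \<Longrightarrow> q \<le> L \<Longrightarrow> q = L"
    using minimal_sublinear_below[OF sublinear_flatten_along[OF p]] by metis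
  have odd: "L (- y) = - L y" for y
  proof -
    have "flatten_along L y = L"
      by (intro min sublinear_flatten_along L) (simp add: le_fun_def flatten_along_le_self L)
    then have "L (- y) \<le> - L y" using flatten_along_minus[OF L(1), of y] by simp
    then show ?thesis using sublinear_lower[OF L(1), of y] by simp
  qed
  have "linear L"
  proof (rule linearI)
    fix x y
    have "L (x + y) \<le> L x + L y" by (rule sublinear_add[OF L(1)])
    moreover have "L (- x + - y) \<le> L (- x) + L (- y)" by (rule sublinear_add[OF L(1)])
    ultimately show "L (x + y) = L x + L y"
      using odd[of "x + y"] odd[of x] odd[of y] by simp
  next
    fix c :: real and x
    show "L (c *\<^sub>R x) = c *\<^sub>R L x"
    proof (cases "c \<ge> 0")
      case True then show ?thesis using sublinear_scaleR[OF L(1)] by simp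
    next
      case False
      then have "L (- c *\<^sub>R x) = - c * L x" using sublinear_scaleR[OF L(1), of "- c" x] by simp
      then show ?thesis using odd[of "c *\<^sub>R x"] by simp
    qed
  qed
  moreover have "L x \<le> p x" for x
    using le_funD[OF L(2), of x] flatten_along_le_self[OF p, of z x] by simp
  moreover have "p z \<le> L z"
    using le_funD[OF L(2), of "- z"] flatten_along_minus[OF p, of z] odd[of z] by simp
  ultimately show ?thesis using that by (metis order_antisym)
qed

corollary norming_functional:
  fixes z :: "'a::real_normed_vector"
  obtains f :: "'a \<Rightarrow> real" where "bounded_linear f" "\<forall>x. \<bar>f x\<bar> \<le> norm x" "f z = norm z"
proof -
  have "sublinear (norm :: 'a \<Rightarrow> real)" by (simp add: sublinear_def norm_triangle_ineq)
  then obtain f :: "'a \<Rightarrow> real" where f: "linear f" "\<And>x. f x \<le> norm x" "f z = norm z"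
    using hahn_banach_sublinear by blast
  have "\<bar>f x\<bar> \<le> norm x" for x
    using f(2)[of x] f(2)[of "- x"] linear_neg[OF f(1), of x] by simp
  moreover from this have "bounded_linear f"
    using f(1) by (intro bounded_linear_intro[where K = 1]) (simp_all add: linear_add linear_cmul)
  ultimately show ?thesis using that f(3) by blast
qed

corollary separating_functional:
  fixes z :: "'a::real_normed_vector"
  assumes "z \<noteq> 0"
  obtains f :: "'a \<Rightarrow> real" where "bounded_linear f" "f z \<noteq> 0"
proof -
  obtain f :: "'a \<Rightarrow> real" where f: "bounded_linear f" "f z = norm z"
    by (rule norming_functional[of z])
  then have "f z \<noteq> 0" using assms by simp
  then show ?thesis by (rule that[OF f(1)])
qed

section \<open>Laws on a separable Banach space are determined by one-dimensional projections\<close>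

inductive trig_poly :: "('a::real_normed_vector \<Rightarrow> real) \<Rightarrow> bool" where
  wave: "bounded_linear f \<Longrightarrow> trig_poly (\<lambda>x. a * cos (f x) + b * sin (f x))"
| sum: "trig_poly p \<Longrightarrow> trig_poly q \<Longrightarrow> trig_poly (\<lambda>x. p x + q x)"

lemma trig_poly_const: "trig_poly (\<lambda>x. c)"
  using trig_poly.wave[OF bounded_linear_zero, of c 0] by simp

text \<open>The product-to-sum formulas make the trigonometric polynomials an algebra, as the
  Stone--Weierstrass theorem requires.\<close>

lemma trig_poly_mult:
  assumes "trig_poly p" "trig_poly q" shows "trig_poly (\<lambda>x. p x * q x)"
  using assms(1)
proof induction
  case f: (wave f a b)
  show ?case using assms(2)
  proof induction
    case g: (wave g c d)
    have "trig_poly (\<lambda>x. ((a*c - b*d)/2) * cos (f x + g x) + ((a*d + b*c)/2) * sin (f x + g x))"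
      by (rule trig_poly.wave[OF bounded_linear_add[OF f g]])
    moreover have "trig_poly (\<lambda>x. ((a*c + b*d)/2) * cos (f x - g x) + ((b*c - a*d)/2) * sin (f x - g x))"
      by (rule trig_poly.wave[OF bounded_linear_sub[OF f g]])
    ultimately have "trig_poly (\<lambda>x. (((a*c - b*d)/2) * cos (f x + g x) + ((a*d + b*c)/2) * sin (f x + g x))
       + (((a*c + b*d)/2) * cos (f x - g x) + ((b*c - a*d)/2) * sin (f x - g x)))"
      by (rule trig_poly.sum)
    moreover have "(((a*c - b*d)/2) * cos (f x + g x) + ((a*d + b*c)/2) * sin (f x + g x))
       + (((a*c + b*d)/2) * cos (f x - g x) + ((b*c - a*d)/2) * sin (f x - g x))
       = (a * cos (f x) + b * sin (f x)) * (c * cos (g x) + d * sin (g x))" for x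
      by (simp add: cos_add sin_add cos_diff sin_diff field_simps)
    ultimately show ?case by simp
  next
    case (sum p q)
    from trig_poly.sum[OF sum(3,4)] show ?case by (simp add: algebra_simps)
  qed
next
  case (sum p q)
  from trig_poly.sum[OF sum(3,4)] show ?case by (simp add: algebra_simps)
qed

lemma trig_poly_polynomial:
  assumes "real_polynomial_function (P :: real \<Rightarrow> real)" "trig_poly p"
  shows "trig_poly (\<lambda>x. P (p x))"
  using assms(1)
proof induction
  case (linear h)
  have "h y = h 1 * y" for y
    using linear_cmul[OF bounded_linear.linear[OF linear], of y 1] by (simp add: mult.commute)
  then have "(\<lambda>x. h (p x)) = (\<lambda>x. h 1 * p x)" by blast
  then show ?case using trig_poly_mult[OF trig_poly_const assms(2)] by simp
qed (use trig_poly_const trig_poly_mult trig_poly.sum in auto)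

lemma trig_poly_continuous: "trig_poly p \<Longrightarrow> continuous_on UNIV p"
  by (induction rule: trig_poly.induct) (auto intro!: continuous_intros intro: linear_continuous_on)

lemma trig_poly_bounded: "trig_poly p \<Longrightarrow> \<exists>C. \<forall>x. \<bar>p x\<bar> \<le> C"
proof (induction rule: trig_poly.induct)
  case (wave f a b)
  have "\<bar>a * cos (f x) + b * sin (f x)\<bar> \<le> \<bar>a\<bar> + \<bar>b\<bar>" for x
  proof -
    have "\<bar>a * cos (f x)\<bar> \<le> \<bar>a\<bar>" "\<bar>b * sin (f x)\<bar> \<le> \<bar>b\<bar>"
      by (simp_all add: abs_mult mult_left_le)
    then show ?thesis by linarith
  qed
  then show ?case by blast
next
  case (sum p q)
  then obtain C D where "\<forall>x. \<bar>p x\<bar> \<le> C" "\<forall>x. \<bar>q x\<bar> \<le> D" by blast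
  then have "\<bar>p x + q x\<bar> \<le> C + D" for x by (meson abs_triangle_ineq add_mono order_trans)
  then show ?case by blast
qed

lemma trig_poly_integrable:
  assumes "finite_measure \<mu>" "sets \<mu> = sets borel" "trig_poly p"
  shows "integrable \<mu> p"
proof -
  interpret finite_measure \<mu> by fact
  obtain C where C: "\<And>x. \<bar>p x\<bar> \<le> C" using trig_poly_bounded[OF assms(3)] by blast
  have "p \<in> borel_measurable \<mu>"
    using borel_measurable_continuous_onI[OF trig_poly_continuous[OF assms(3)]]
      measurable_cong_sets[OF assms(2) refl] by blast
  then show ?thesis by (intro integrable_const_bound[where B = C]) (auto simp: C)
qed

lemma bounded_linear_borel: "bounded_linear f \<Longrightarrow> f \<in> borel_measurable borel"
  by (intro borel_measurable_continuous_onI linear_continuous_on)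

lemma trig_poly_integral_eq:
  fixes \<mu> \<nu> :: "'a::{banach, second_countable_topology} measure"
  assumes \<mu>: "prob_space \<mu>" "sets \<mu> = sets borel" and \<nu>: "prob_space \<nu>" "sets \<nu> = sets borel"
    and law: "\<And>f :: 'a \<Rightarrow> real. bounded_linear f \<Longrightarrow> distr \<mu> borel f = distr \<nu> borel f"
    and p: "trig_poly p"
  shows "(\<integral>x. p x \<partial>\<mu>) = (\<integral>x. p x \<partial>\<nu>)"
  using p
proof induction
  case (wave f a b)
  have m: "f \<in> borel_measurable \<mu>" "f \<in> borel_measurable \<nu>"
    using bounded_linear_borel[OF wave] measurable_cong_sets[OF \<mu>(2) refl] measurable_cong_sets[OF \<nu>(2) refl]
    by blast+
  have "(\<integral>x. a * cos (f x) + b * sin (f x) \<partial>\<mu>) = (\<integral>y. a * cos y + b * sin y \<partial>distr \<mu> borel f)"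
    by (rule integral_distr[symmetric]) (use m in measurable)
  also have "\<dots> = (\<integral>y. a * cos y + b * sin y \<partial>distr \<nu> borel f)" using law[OF wave] by simp
  also have "\<dots> = (\<integral>x. a * cos (f x) + b * sin (f x) \<partial>\<nu>)"
    by (rule integral_distr) (use m in measurable)
  finally show ?case .
next
  case (sum p q)
  then show ?case
    using trig_poly_integrable[OF prob_space.finite_measure[OF \<mu>(1)] \<mu>(2)]
      trig_poly_integrable[OF prob_space.finite_measure[OF \<nu>(1)] \<nu>(2)] by simp
qed

lemma tight_compact:
  fixes \<mu> :: "'a::{banach, second_countable_topology} measure"
  assumes "prob_space \<mu>" "sets \<mu> = sets borel" "e > 0"
  obtains K where "compact K" "measure \<mu> K > 1 - e"
proof -
  interpret prob_space \<mu> by fact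
  have sp: "space \<mu> = UNIV" using sets_eq_imp_space_eq[OF assms(2)] by simp
  have "(SUP K\<in>{K. K \<subseteq> UNIV \<and> compact K}. emeasure \<mu> K) = emeasure \<mu> UNIV"
    by (rule inner_regular[symmetric]) (use assms(2) in auto)
  also have "\<dots> = ennreal 1" using emeasure_space_1 sp by simp
  also have "ennreal (1 - e) < ennreal 1" using assms(3) by (intro ennreal_lessI) auto
  finally obtain K where K: "compact K" "ennreal (1 - e) < emeasure \<mu> K"
    unfolding less_SUP_iff by blast
  then have "1 - e < measure \<mu> K"
    by (metis emeasure_eq_measure ennreal_less_iff ennreal_leI linorder_not_le)
  then show ?thesis using that K by blast
qed

text \<open>On a compact set that carries almost all of both measures, \<open>g\<close> is uniformly close to a
  trigonometric polynomial \<open>p\<close>, but \<open>p\<close> may be large elsewhere. A polynomial \<open>P\<close> that approximates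
  the truncation to \<open>[0, 1]\<close> on the range of \<open>p\<close> repairs this: \<open>P \<circ> p\<close> is again a trigonometric
  polynomial, now almost bounded by \<open>1\<close> on the whole space.\<close>

lemma continuous_integral_eq:
  fixes \<mu> \<nu> :: "'a::{banach, second_countable_topology} measure"
  assumes \<mu>: "prob_space \<mu>" "sets \<mu> = sets borel" and \<nu>: "prob_space \<nu>" "sets \<nu> = sets borel"
    and law: "\<And>f :: 'a \<Rightarrow> real. bounded_linear f \<Longrightarrow> distr \<mu> borel f = distr \<nu> borel f"
    and g: "continuous_on UNIV g" "\<And>x. 0 \<le> g x" "\<And>x. g x \<le> (1::real)"
  shows "(\<integral>x. g x \<partial>\<mu>) = (\<integral>x. g x \<partial>\<nu>)"
proof -
  define clip :: "real \<Rightarrow> real" where "clip y = max 0 (min 1 y)" for y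
  have approx: "\<bar>(\<integral>x. g x \<partial>\<mu>) - (\<integral>x. g x \<partial>\<nu>)\<bar> \<le> 8 * e" if e: "0 < e" "e \<le> 1" for e
  proof -
    obtain K1 where K1: "compact K1" "measure \<mu> K1 > 1 - e" using tight_compact[OF \<mu> e(1)] .
    obtain K2 where K2: "compact K2" "measure \<nu> K2 > 1 - e" using tight_compact[OF \<nu> e(1)] .
    define K where "K = K1 \<union> K2"
    have K: "compact K" using K1 K2 by (simp add: K_def compact_Un)
    have "\<exists>p. trig_poly p \<and> (\<forall>x\<in>K. \<bar>g x - p x\<bar> < e)"
    proof (rule Stone_Weierstrass_HOL[OF K])
      fix x y :: 'a assume "x \<in> K \<and> y \<in> K \<and> x \<noteq> y"
      then have "x - y \<noteq> 0" by simp
      then obtain f0 :: "'a \<Rightarrow> real" where f0: "bounded_linear f0" "f0 (x - y) \<noteq> 0"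
        by (rule separating_functional)
      \<comment> \<open>Rescaled so that its values at the two points differ by one radian.\<close>
      define f where "f z = f0 z / f0 (x - y)" for z
      have f: "bounded_linear f" unfolding f_def using f0(1)
        by (simp add: bounded_linear_const_mult divide_inverse bounded_linear_mult_const)
      have fxy: "f x = f y + 1" using f0 by (simp add: f_def linear_diff[OF bounded_linear.linear[OF f0(1)]] field_simps)
      show "\<exists>f. trig_poly f \<and> f x \<noteq> f y"
      proof (rule ccontr)
        assume "\<not> ?thesis"
        then have "trig_poly f \<Longrightarrow> f x = f y" for f by blast
        from this[OF trig_poly.wave[OF f, of 1 0]] this[OF trig_poly.wave[OF f, of 0 1]]
        have "cos (f x) = cos (f y)" "sin (f x) = sin (f y)" by simp_all
        then have "cos (f x - f y) = 1"
          using sin_cos_squared_add[of "f y"] by (simp add: cos_diff power2_eq_square add.commute)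
        then have "cos (1::real) = 1" using fxy by simp
        then show False using cos_monotone_0_pi[of 0 "1::real"] pi_gt3 by simp
      qed
    qed (use trig_poly_const trig_poly_mult trig_poly.sum e
           continuous_on_subset[OF trig_poly_continuous subset_UNIV] continuous_on_subset[OF g(1) subset_UNIV]
         in auto)
    then obtain p where p: "trig_poly p" "\<And>x. x \<in> K \<Longrightarrow> \<bar>g x - p x\<bar> < e" by blast
    obtain C where C: "\<And>x. \<bar>p x\<bar> \<le> C" using trig_poly_bounded[OF p(1)] by blast
    obtain P where P: "real_polynomial_function P" "\<And>y. y \<in> {-C..C} \<Longrightarrow> \<bar>clip y - P y\<bar> < e"
    proof (rule Stone_Weierstrass_real_polynomial_function[of "{-C..C}" clip e])
      show "continuous_on {-C..C} clip" unfolding clip_def by (intro continuous_intros)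
    qed (use e in auto)
    define r where "r x = P (p x)" for x
    have r: "trig_poly r" unfolding r_def by (rule trig_poly_polynomial[OF P(1) p(1)])
    have rclip: "\<bar>clip (p x) - r x\<bar> < e" for x
      unfolding r_def using C[of x] by (intro P(2)) auto
    have rK: "\<bar>g x - r x\<bar> \<le> 2 * e" if "x \<in> K" for x
      using rclip[of x] p(2)[OF that] g(2)[of x] g(3)[of x] unfolding clip_def by (auto simp: abs_if max_def min_def split: if_splits)
    have rall: "\<bar>g x - r x\<bar> \<le> 1 + e" for x
      using rclip[of x] g(2)[of x] g(3)[of x] unfolding clip_def by (auto simp: abs_if max_def min_def split: if_splits)
    have close: "\<bar>(\<integral>x. g x \<partial>\<rho>) - (\<integral>x. r x \<partial>\<rho>)\<bar> \<le> 4 * e"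
      if \<rho>: "prob_space \<rho>" "sets \<rho> = sets borel" and big: "measure \<rho> K > 1 - e" for \<rho> :: "'a measure"
    proof -
      interpret \<rho>: prob_space \<rho> by fact
      have sp: "space \<rho> = UNIV" using sets_eq_imp_space_eq[OF \<rho>(2)] by simp
      have KS: "K \<in> sets \<rho>" using \<rho>(2) borel_compact[OF K] by simp
      have ri: "integrable \<rho> r" using trig_poly_integrable[OF _ \<rho>(2) r] \<rho>.finite_measure_axioms by blast
      have "g \<in> borel_measurable \<rho>"
        using borel_measurable_continuous_onI[OF g(1)] measurable_cong_sets[OF \<rho>(2) refl] by blast
      moreover have "AE x in \<rho>. norm (g x) \<le> 1"
      proof (rule AE_I2)
        show "norm (g x) \<le> 1" for x using g(2)[of x] g(3)[of x] by simp
      qed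
      ultimately have gi: "integrable \<rho> g" using \<rho>.integrable_const_bound by blast
      have bnd: "\<bar>g x - r x\<bar> \<le> 2 * e + 2 * indicator (UNIV - K) x" for x
      proof (cases "x \<in> K")
        case True then show ?thesis using rK[of x] e by simp
      next
        case False then show ?thesis using rall[of x] e by simp
      qed
      have "\<bar>(\<integral>x. g x \<partial>\<rho>) - (\<integral>x. r x \<partial>\<rho>)\<bar> = \<bar>\<integral>x. g x - r x \<partial>\<rho>\<bar>" using gi ri by simp
      also have "\<dots> \<le> (\<integral>x. \<bar>g x - r x\<bar> \<partial>\<rho>)" by (rule integral_abs_bound)
      also have "\<dots> \<le> (\<integral>x. 2 * e + 2 * indicator (UNIV - K) x \<partial>\<rho>)"
      proof (rule integral_mono)
        have "UNIV - K \<in> sets \<rho>" using sets.compl_sets[OF KS] sp by simp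
        then show "integrable \<rho> (\<lambda>x. 2 * e + 2 * indicator (UNIV - K) x)"
          by (intro Bochner_Integration.integrable_add integrable_mult_right integrable_real_indicator)
             (simp_all add: \<rho>.emeasure_eq_measure)
      qed (use gi ri bnd in simp_all)
      also have "\<dots> = 2 * e + 2 * measure \<rho> (UNIV - K)"
      proof -
        have "UNIV - K \<in> sets \<rho>" using sets.compl_sets[OF KS] sp by simp
        then have "integrable \<rho> (\<lambda>x. 2 * indicator (UNIV - K) x :: real)"
          by (intro integrable_mult_right integrable_real_indicator) (simp_all add: \<rho>.emeasure_eq_measure)
        then show ?thesis using \<rho>.prob_space sp by simp
      qed
      also have "measure \<rho> (UNIV - K) = 1 - measure \<rho> K" using \<rho>.prob_compl[OF KS] sp by simp
      finally show ?thesis using big by simp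
    qed
    have "measure \<mu> K1 \<le> measure \<mu> K" "measure \<nu> K2 \<le> measure \<nu> K"
      using borel_compact[OF K] \<mu> \<nu> unfolding K_def
      by (auto intro!: finite_measure.finite_measure_mono prob_space.finite_measure)
    then have "measure \<mu> K > 1 - e" "measure \<nu> K > 1 - e" using K1 K2 by linarith+
    then show ?thesis
      using close[OF \<mu>] close[OF \<nu>] trig_poly_integral_eq[OF \<mu> \<nu> law r] by linarith
  qed
  show ?thesis
  proof (rule ccontr)
    assume ne: "\<not> ?thesis"
    define d where "d = \<bar>(\<integral>x. g x \<partial>\<mu>) - (\<integral>x. g x \<partial>\<nu>)\<bar>"
    have d: "d > 0" using ne by (simp add: d_def)
    have "d \<le> 8 * min 1 (d / 16)"
      by (rule approx[of "min 1 (d / 16)", folded d_def]) (use d in simp_all)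
    with d show False by linarith
  qed
qed

text \<open>The Cramer--Wold theorem in a separable Banach space. All equalities of laws below are
  reduced to one-dimensional Gaussian laws by it.\<close>

theorem measure_eqI_functionals:
  fixes \<mu> \<nu> :: "'a::{banach, second_countable_topology} measure"
  assumes \<mu>: "prob_space \<mu>" "sets \<mu> = sets borel" and \<nu>: "prob_space \<nu>" "sets \<nu> = sets borel"
    and law: "\<And>f :: 'a \<Rightarrow> real. bounded_linear f \<Longrightarrow> distr \<mu> borel f = distr \<nu> borel f"
  shows "\<mu> = \<nu>"
proof -
  have lim: "(\<lambda>n. \<integral>x. max 0 (1 - real n * infdist x C) \<partial>\<rho>) \<longlonglongrightarrow> measure \<rho> C"
    if \<rho>: "prob_space \<rho>" "sets \<rho> = sets borel" and C: "closed C" "C \<noteq> {}" for \<rho> :: "'a measure" and C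
  proof -
    interpret \<rho>: prob_space \<rho> by fact
    have sp: "space \<rho> = UNIV" using sets_eq_imp_space_eq[OF \<rho>(2)] by simp
    have CS: "C \<in> sets \<rho>" using \<rho>(2) C by auto
    have "(\<lambda>n. \<integral>x. max 0 (1 - real n * infdist x C) \<partial>\<rho>) \<longlonglongrightarrow> (\<integral>x. indicator C x \<partial>\<rho>)"
    proof (rule integral_dominated_convergence[where w = "\<lambda>_. 1"])
      show "AE x in \<rho>. (\<lambda>n. max 0 (1 - real n * infdist x C)) \<longlonglongrightarrow> (indicator C x :: real)"
      proof (rule AE_I2)
        fix x
        show "(\<lambda>n. max 0 (1 - real n * infdist x C)) \<longlonglongrightarrow> (indicator C x :: real)"
        proof (cases "x \<in> C")
          case True then show ?thesis by simp
        next
          case False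
          then have d: "infdist x C > 0"
            using C by (metis in_closed_iff_infdist_zero infdist_nonneg order_le_less)
          obtain n0 :: nat where n0: "1 / infdist x C < n0" using reals_Archimedean2 by blast
          have "max 0 (1 - real n * infdist x C) = 0" if "n \<ge> n0" for n
          proof -
            have "1 < real n0 * infdist x C" using n0 d by (simp add: field_simps)
            also have "\<dots> \<le> real n * infdist x C" using that d by (intro mult_right_mono) auto
            finally show ?thesis by simp
          qed
          then have "(\<lambda>n. max 0 (1 - real n * infdist x C)) \<longlonglongrightarrow> 0"
            by (intro tendsto_eventually) (auto simp: eventually_sequentially)
          then show ?thesis using False by simp
        qed
      qed
      show "(\<lambda>x. max 0 (1 - real n * infdist x C)) \<in> borel_measurable \<rho>" for n
        unfolding measurable_cong_sets[OF \<rho>(2) refl]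
        by (intro borel_measurable_continuous_onI continuous_intros)
      show "AE x in \<rho>. norm (max 0 (1 - real n * infdist x C)) \<le> 1" for n
        by (intro AE_I2) (auto simp: infdist_nonneg)
      show "indicat_real C \<in> borel_measurable \<rho>" using CS by measurable
    qed auto
    then show ?thesis using CS sp by simp
  qed
  have eq: "emeasure \<mu> C = emeasure \<nu> C" if C: "closed C" for C
  proof (cases "C = {}")
    case False
    have "(\<integral>x. max 0 (1 - real n * infdist x C) \<partial>\<mu>) = (\<integral>x. max 0 (1 - real n * infdist x C) \<partial>\<nu>)" for n
      by (intro continuous_integral_eq[OF \<mu> \<nu> law] continuous_intros) (auto simp: infdist_nonneg)
    then have "measure \<mu> C = measure \<nu> C"
      using lim[OF \<mu> C False] lim[OF \<nu> C False] by (simp add: LIMSEQ_unique)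
    then show ?thesis using \<mu> \<nu> by (simp add: finite_measure.emeasure_eq_measure prob_space.finite_measure)
  qed simp
  show ?thesis
  proof (rule measure_eqI_generator_eq[where E = "Collect closed" and \<Omega> = UNIV and A = "\<lambda>_. UNIV"])
    show "Int_stable (Collect closed)" by (auto simp: Int_stable_def)
    show "sets \<mu> = sigma_sets UNIV (Collect closed)" "sets \<nu> = sigma_sets UNIV (Collect closed)"
      using \<mu>(2) \<nu>(2) by (simp_all add: borel_eq_closed)
    show "emeasure \<mu> UNIV \<noteq> \<infinity>" for i
      using \<mu> by (simp add: finite_measure.emeasure_eq_measure prob_space.finite_measure)
  qed (use eq in auto)
qed

section \<open>One-dimensional Gaussian laws\<close>

definition normal_law :: "real \<Rightarrow> real measure" where
  "normal_law v = distr std_normal_distribution borel (\<lambda>x. sqrt v * x)"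

lemma prob_space_std_normal: "prob_space std_normal_distribution"
  by (rule prob_space_normal_density) simp

lemma prob_space_normal_law: "prob_space (normal_law v)"
  unfolding normal_law_def by (intro prob_space.prob_space_distr prob_space_std_normal) simp

lemma real_distribution_normal_law: "real_distribution (normal_law v)"
  by (intro real_distribution.intro prob_space_normal_law real_distribution_axioms.intro)
     (simp_all add: normal_law_def)

lemma char_distr_eq:
  assumes "w \<in> borel_measurable M"
  shows "char (distr M borel w) t = (CLINT x|M. iexp (t * w x))"
  unfolding char_def by (rule integral_distr) (use assms in measurable)

lemma char_normal_law:
  assumes "v \<ge> 0"
  shows "char (normal_law v) t = of_real (exp (- v * t\<^sup>2 / 2))"
proof -
  have "char (normal_law v) t = (CLINT x|std_normal_distribution. iexp (t * (sqrt v * x)))"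
    unfolding normal_law_def by (rule char_distr_eq) simp
  also have "\<dots> = char std_normal_distribution (t * sqrt v)"
    unfolding char_def by (simp add: mult.assoc)
  also have "\<dots> = of_real (exp (- v * t\<^sup>2 / 2))"
    using assms by (simp add: char_std_normal_distribution power_mult_distrib mult.commute)
  finally show ?thesis .
qed

text \<open>Translating the standard normal law reweights it by an exponential.\<close>

lemma nn_integral_std_normal_shift:
  assumes [measurable]: "g \<in> borel_measurable borel"
  shows "(\<integral>\<^sup>+x. g (x + s) \<partial>std_normal_distribution)
       = (\<integral>\<^sup>+x. g x * ennreal (exp (s * x - s\<^sup>2 / 2)) \<partial>std_normal_distribution)"
proof -
  have eq: "ennreal (std_normal_density (x - s)) * g x
      = ennreal (std_normal_density x) * (g x * ennreal (exp (s * x - s\<^sup>2 / 2)))" for x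
  proof -
    have "std_normal_density (x - s) = std_normal_density x * exp (s * x - s\<^sup>2 / 2)"
      unfolding std_normal_density_def
      by (simp add: exp_add[symmetric] power2_eq_square field_simps)
    then show ?thesis by (simp add: ennreal_mult ac_simps)
  qed
  have "(\<integral>\<^sup>+x. g (x + s) \<partial>std_normal_distribution)
      = (\<integral>\<^sup>+x. ennreal (std_normal_density x) * g (x + s) \<partial>lborel)"
    by (rule nn_integral_density) simp_all
  also have "\<dots> = ennreal \<bar>1\<bar> * (\<integral>\<^sup>+x. ennreal (std_normal_density (- s + 1 * x)) * g ((- s + 1 * x) + s) \<partial>lborel)"
    by (rule nn_integral_real_affine) simp_all
  also have "\<dots> = (\<integral>\<^sup>+x. ennreal (std_normal_density (x - s)) * g x \<partial>lborel)" by simp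
  also have "\<dots> = (\<integral>\<^sup>+x. ennreal (std_normal_density x) * (g x * ennreal (exp (s * x - s\<^sup>2 / 2))) \<partial>lborel)"
    unfolding eq ..
  also have "\<dots> = (\<integral>\<^sup>+x. g x * ennreal (exp (s * x - s\<^sup>2 / 2)) \<partial>std_normal_distribution)"
    by (rule nn_integral_density[symmetric]) simp_all
  finally show ?thesis .
qed

lemma nn_integral_exp_std_normal:
  "(\<integral>\<^sup>+x. ennreal (exp (s * x)) \<partial>std_normal_distribution) = ennreal (exp (s\<^sup>2 / 2))"
proof -
  interpret prob_space std_normal_distribution by (rule prob_space_std_normal)
  have "(\<integral>\<^sup>+x. ennreal (exp (s * x)) \<partial>std_normal_distribution)
     = (\<integral>\<^sup>+x. ennreal (exp (s\<^sup>2 / 2)) * (1 * ennreal (exp (s * x - s\<^sup>2 / 2))) \<partial>std_normal_distribution)"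
    by (simp add: ennreal_mult[symmetric] exp_add[symmetric])
  also have "\<dots> = ennreal (exp (s\<^sup>2 / 2)) * (\<integral>\<^sup>+x. 1 * ennreal (exp (s * x - s\<^sup>2 / 2)) \<partial>std_normal_distribution)"
    by (rule nn_integral_cmult) simp
  also have "(\<integral>\<^sup>+x. 1 * ennreal (exp (s * x - s\<^sup>2 / 2)) \<partial>std_normal_distribution) = (\<integral>\<^sup>+x. 1 \<partial>std_normal_distribution)"
    by (rule nn_integral_std_normal_shift[symmetric]) simp
  also have "\<dots> = 1" using emeasure_space_1 by simp
  finally show ?thesis by simp
qed

text \<open>The crude bound by the density at the right end of \<open>[s, s + 1]\<close>: it loses only a factor
  \<open>exp (O(s))\<close>, which is negligible on the scale \<open>exp (s\<^sup>2)\<close>.\<close>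

lemma std_normal_tail_ge:
  assumes "s \<ge> 0"
  shows "measure std_normal_distribution {s..} \<ge> exp (- (s + 1)\<^sup>2 / 2) / sqrt (2 * pi)"
proof -
  interpret prob_space std_normal_distribution by (rule prob_space_std_normal)
  have "ennreal (exp (- (s + 1)\<^sup>2 / 2) / sqrt (2 * pi))
      = (\<integral>\<^sup>+x. ennreal (exp (- (s + 1)\<^sup>2 / 2) / sqrt (2 * pi)) * indicator {s..s+1} x \<partial>lborel)"
    by (subst nn_integral_cmult_indicator) simp_all
  also have "\<dots> \<le> (\<integral>\<^sup>+x. ennreal (std_normal_density x) * indicator {s..} x \<partial>lborel)"
  proof (rule nn_integral_mono)
    fix x :: real
    have "exp (- (s + 1)\<^sup>2 / 2) / sqrt (2 * pi) \<le> std_normal_density x" if "s \<le> x" "x \<le> s + 1"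
    proof -
      have "x\<^sup>2 \<le> (s + 1)\<^sup>2" using that assms by (intro power_mono) auto
      then show ?thesis unfolding std_normal_density_def by (simp add: divide_right_mono)
    qed
    then show "ennreal (exp (- (s + 1)\<^sup>2 / 2) / sqrt (2 * pi)) * indicator {s..s+1} x
        \<le> ennreal (std_normal_density x) * indicator {s..} x"
      by (auto simp: indicator_def intro!: ennreal_leI)
  qed
  also have "\<dots> = emeasure std_normal_distribution {s..}" by (rule emeasure_density[symmetric]) simp_all
  finally show ?thesis by (simp add: emeasure_eq_measure)
qed

text \<open>Centered, with variance \<open>v\<close>; the degenerate case \<open>v = 0\<close> is the Dirac mass at \<open>0\<close>.\<close>

definition gaussian_with :: "'a measure \<Rightarrow> ('a \<Rightarrow> real) \<Rightarrow> real \<Rightarrow> bool" where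
  "gaussian_with M w v \<longleftrightarrow> w \<in> borel_measurable M \<and> 0 \<le> v \<and> distr M borel w = normal_law v"

lemma gaussian_withD:
  assumes "gaussian_with M w v"
  shows "w \<in> borel_measurable M" "0 \<le> v" "distr M borel w = normal_law v"
  using assms by (auto simp: gaussian_with_def)

lemma gaussian_with_char:
  assumes "prob_space M" "w \<in> borel_measurable M" "0 \<le> v"
    and "\<And>t. char (distr M borel w) t = of_real (exp (- v * t\<^sup>2 / 2))"
  shows "gaussian_with M w v"
  unfolding gaussian_with_def
proof (intro conjI assms(2,3) Levy_uniqueness real_distribution_normal_law)
  show "real_distribution (distr M borel w)"
    using prob_space.real_distribution_distr[OF assms(1,2)] by simp
  show "char (distr M borel w) = char (normal_law v)"
    using assms(4) char_normal_law[OF assms(3)] by auto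
qed

lemma gaussian_with_char_eq:
  assumes "gaussian_with M w v"
  shows "char (distr M borel w) t = of_real (exp (- v * t\<^sup>2 / 2))"
  unfolding gaussian_withD(3)[OF assms] by (rule char_normal_law[OF gaussian_withD(2)[OF assms]])

lemma gaussian_with_nn_integral:
  assumes w: "gaussian_with M w v" and g: "g \<in> borel_measurable borel"
  shows "(\<integral>\<^sup>+x. g (w x) \<partial>M) = (\<integral>\<^sup>+x. g (sqrt v * x) \<partial>std_normal_distribution)"
proof -
  have "(\<integral>\<^sup>+x. g x \<partial>distr M borel w) = (\<integral>\<^sup>+x. g (w x) \<partial>M)"
    using g by (intro nn_integral_distr gaussian_withD(1)[OF w]) simp
  moreover have "(\<integral>\<^sup>+x. g x \<partial>normal_law v) = (\<integral>\<^sup>+x. g (sqrt v * x) \<partial>std_normal_distribution)"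
    unfolding normal_law_def using g by (intro nn_integral_distr) simp_all
  ultimately show ?thesis unfolding gaussian_withD(3)[OF w] by simp
qed

lemma gaussian_with_mgf:
  assumes "gaussian_with M w v"
  shows "(\<integral>\<^sup>+x. ennreal (exp (s * w x)) \<partial>M) = ennreal (exp (v * s\<^sup>2 / 2))"
proof -
  have "(\<integral>\<^sup>+x. ennreal (exp (s * w x)) \<partial>M) = (\<integral>\<^sup>+x. ennreal (exp (s * (sqrt v * x))) \<partial>std_normal_distribution)"
    using gaussian_with_nn_integral[OF assms, of "\<lambda>y. ennreal (exp (s * y))"] by simp
  also have "\<dots> = ennreal (exp ((s * sqrt v)\<^sup>2 / 2))"
    using nn_integral_exp_std_normal[of "s * sqrt v"] by (simp add: mult.assoc)
  finally show ?thesis using gaussian_withD(2)[OF assms] by (simp add: power_mult_distrib mult.commute)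
qed

lemma integral_square_std_normal:
  "integrable std_normal_distribution (\<lambda>x. x\<^sup>2)" "(\<integral>x. x\<^sup>2 \<partial>std_normal_distribution) = 1"
proof -
  have h: "has_bochner_integral lborel (\<lambda>x. std_normal_density x * x\<^sup>2) 1"
    using std_normal_moment_even[of 1] by simp
  then show "integrable std_normal_distribution (\<lambda>x. x\<^sup>2)"
    by (subst integrable_density) (auto simp: has_bochner_integral_iff)
  show "(\<integral>x. x\<^sup>2 \<partial>std_normal_distribution) = 1"
    using h by (subst integral_density) (auto simp: has_bochner_integral_iff)
qed

lemma gaussian_with_square:
  assumes "gaussian_with M w v"
  shows "integrable M (\<lambda>x. (w x)\<^sup>2)" "(\<integral>x. (w x)\<^sup>2 \<partial>M) = v"
proof -
  have i: "integrable (normal_law v) (\<lambda>x. x\<^sup>2)"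
    unfolding normal_law_def
    by (subst integrable_distr_eq) (use integral_square_std_normal in \<open>auto simp: power_mult_distrib\<close>)
  have "(\<integral>x. x\<^sup>2 \<partial>normal_law v) = (\<integral>x. (sqrt v * x)\<^sup>2 \<partial>std_normal_distribution)"
    unfolding normal_law_def by (rule integral_distr) simp_all
  also have "\<dots> = v"
    using gaussian_withD(2)[OF assms] integral_square_std_normal by (simp add: power_mult_distrib)
  finally have e: "(\<integral>x. x\<^sup>2 \<partial>normal_law v) = v" .
  show "integrable M (\<lambda>x. (w x)\<^sup>2)"
    by (rule integrable_distr[OF gaussian_withD(1)[OF assms]]) (use i gaussian_withD(3)[OF assms] in simp)
  have "(\<integral>x. x\<^sup>2 \<partial>distr M borel w) = (\<integral>x. (w x)\<^sup>2 \<partial>M)"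
    by (intro integral_distr gaussian_withD(1)[OF assms]) simp
  then show "(\<integral>x. (w x)\<^sup>2 \<partial>M) = v" using e gaussian_withD(3)[OF assms] by simp
qed

lemma gaussian_with_scale:
  assumes "prob_space M" "gaussian_with M w v" shows "gaussian_with M (\<lambda>x. c * w x) (c\<^sup>2 * v)"
proof (rule gaussian_with_char[OF assms(1)])
  note [measurable] = gaussian_withD(1)[OF assms(2)]
  show "(\<lambda>x. c * w x) \<in> borel_measurable M" by measurable
  show "0 \<le> c\<^sup>2 * v" using gaussian_withD(2)[OF assms(2)] by simp
  show "char (distr M borel (\<lambda>x. c * w x)) t = of_real (exp (- (c\<^sup>2 * v) * t\<^sup>2 / 2))" for t
    using gaussian_with_char_eq[OF assms(2), of "t * c"]
    by (simp add: char_distr_eq mult.assoc power_mult_distrib ac_simps)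
qed

lemma gaussian_with_upper_tail:
  assumes "prob_space M" "gaussian_with M w v" "v \<le> b" "b > 0" "u \<ge> 0"
  shows "measure M {x\<in>space M. u \<le> w x} \<le> exp (- u\<^sup>2 / (2 * b))"
proof -
  interpret prob_space M by fact
  note [measurable] = gaussian_withD(1)[OF assms(2)]
  have v: "v \<ge> 0" using gaussian_withD(2)[OF assms(2)] .
  define s where "s = u / b"
  have "emeasure M {x\<in>space M. u \<le> w x} \<le> emeasure M {x\<in>space M. 1 \<le> ennreal (exp (- s * u)) * ennreal (exp (s * w x))}"
  proof (rule emeasure_mono)
    show "{x\<in>space M. u \<le> w x} \<subseteq> {x\<in>space M. 1 \<le> ennreal (exp (- s * u)) * ennreal (exp (s * w x))}"
      using assms(4,5) by (auto simp: s_def ennreal_mult[symmetric] exp_add[symmetric] divide_right_mono mult_left_mono)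
  qed measurable
  also have "\<dots> \<le> ennreal (exp (- s * u)) * (\<integral>\<^sup>+x. ennreal (exp (s * w x)) * indicator (space M) x \<partial>M)"
    using nn_integral_Markov_inequality[of "\<lambda>x. ennreal (exp (s * w x))" "space M" M "ennreal (exp (- s * u))"]
    by (simp add: conj_commute)
  also have "(\<integral>\<^sup>+x. ennreal (exp (s * w x)) * indicator (space M) x \<partial>M) = (\<integral>\<^sup>+x. ennreal (exp (s * w x)) \<partial>M)"
    by (rule nn_integral_cong) simp
  also have "\<dots> = ennreal (exp (v * s\<^sup>2 / 2))" by (rule gaussian_with_mgf[OF assms(2)])
  also have "ennreal (exp (- s * u)) * ennreal (exp (v * s\<^sup>2 / 2)) = ennreal (exp (- s * u + v * s\<^sup>2 / 2))"
    by (simp add: ennreal_mult[symmetric] exp_add[symmetric])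
  also have "\<dots> \<le> ennreal (exp (- u\<^sup>2 / (2 * b)))"
  proof (rule ennreal_leI)
    have "v * s\<^sup>2 \<le> b * s\<^sup>2" using assms by (intro mult_right_mono) auto
    then have "- s * u + v * s\<^sup>2 / 2 \<le> - s * u + b * s\<^sup>2 / 2" by simp
    also have "\<dots> = - u\<^sup>2 / (2 * b)" using assms(4) by (simp add: s_def power2_eq_square field_simps)
    finally show "exp (- s * u + v * s\<^sup>2 / 2) \<le> exp (- u\<^sup>2 / (2 * b))" by simp
  qed
  finally show ?thesis by (simp add: emeasure_eq_measure)
qed

lemma gaussian_with_lower_tail:
  assumes "prob_space M" "gaussian_with M w 1" "s \<ge> 0"
  shows "measure M {x\<in>space M. s \<le> w x} \<ge> exp (- (s + 1)\<^sup>2 / 2) / sqrt (2 * pi)"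
proof -
  note [measurable] = gaussian_withD(1)[OF assms(2)]
  have "measure M {x\<in>space M. s \<le> w x} = measure (distr M borel w) {s..}"
    by (subst measure_distr) (auto intro!: arg_cong[where f = "measure M"])
  also have "\<dots> = measure (normal_law 1) {s..}" using gaussian_withD(3)[OF assms(2)] by simp
  also have "\<dots> = measure std_normal_distribution {s..}"
    unfolding normal_law_def by (subst measure_distr) (auto intro!: arg_cong[where f = "measure std_normal_distribution"])
  finally show ?thesis using std_normal_tail_ge[OF assms(3)] by simp
qed

lemma centered_gaussian_rv_imp:
  assumes M: "prob_space M" and w: "w \<in> borel_measurable M" and "centered_gaussian_rv M w"
  shows "\<exists>v. gaussian_with M w v"
proof -
  interpret std: prob_space std_normal_distribution by (rule prob_space_std_normal)
  consider "distr M borel w = return borel 0"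
    | \<sigma> where "\<sigma> > 0" "distr M borel w = density lborel (\<lambda>x. ennreal (normal_density 0 \<sigma> x))"
    using assms(3) unfolding centered_gaussian_rv_def by blast
  then show ?thesis
  proof cases
    case 1
    have "normal_law 0 = distr std_normal_distribution borel (\<lambda>_. 0)"
      unfolding normal_law_def by (rule distr_cong) simp_all
    also have "\<dots> = return borel 0" by (rule std.distr_const) simp
    finally have "normal_law 0 = return borel 0" .
    then show ?thesis using 1 w by (intro exI[of _ 0]) (simp add: gaussian_with_def)
  next
    case 2
    have "distributed std_normal_distribution lborel (\<lambda>x. x) (\<lambda>x. ennreal (std_normal_density x))"
      unfolding distributed_def by (auto simp: distr_id2)
    from std.normal_density_affine[OF this, of \<sigma> 0]
    have "distributed std_normal_distribution lborel (\<lambda>x. \<sigma> * x) (\<lambda>x. ennreal (normal_density 0 \<sigma> x))"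
      using 2 by simp
    then have "distr std_normal_distribution lborel (\<lambda>x. \<sigma> * x) = density lborel (\<lambda>x. ennreal (normal_density 0 \<sigma> x))"
      by (simp add: distributed_def)
    moreover have "distr std_normal_distribution lborel (\<lambda>x. \<sigma> * x) = normal_law (\<sigma>\<^sup>2)"
      using 2 unfolding normal_law_def by (intro distr_cong) auto
    ultimately show ?thesis using 2 w by (intro exI[of _ "\<sigma>\<^sup>2"]) (simp add: gaussian_with_def)
  qed
qed

section \<open>Independent sums\<close>

lemma char_pair_sum:
  assumes A: "prob_space A" and B: "prob_space B"
    and [measurable]: "u \<in> borel_measurable A" "w \<in> borel_measurable B"
  shows "char (distr (A \<Otimes>\<^sub>M B) borel (\<lambda>z. u (fst z) + w (snd z))) t
       = char (distr A borel u) t * char (distr B borel w) t"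
proof -
  interpret A: prob_space A by fact
  interpret B: prob_space B by fact
  interpret P: pair_prob_space A B ..
  have int: "integrable (A \<Otimes>\<^sub>M B) (\<lambda>z. iexp (t * u (fst z)) * iexp (t * w (snd z)))"
    by (rule P.integrable_const_bound[where B = 1]) (auto simp: norm_mult)
  have "char (distr (A \<Otimes>\<^sub>M B) borel (\<lambda>z. u (fst z) + w (snd z))) t
      = (CLINT z|A \<Otimes>\<^sub>M B. iexp (t * u (fst z)) * iexp (t * w (snd z)))"
    by (subst char_distr_eq) (simp_all add: exp_add[symmetric] distrib_left)
  also have "\<dots> = (CLINT x|A. CLINT y|B. iexp (t * u x) * iexp (t * w y))"
    using P.integral_fst'[OF int] by simp
  also have "\<dots> = char (distr A borel u) t * char (distr B borel w) t"
    by (simp add: char_distr_eq)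
  finally show ?thesis .
qed

lemma gaussian_with_pair_sum:
  assumes A: "prob_space A" and B: "prob_space B"
    and u: "gaussian_with A u a" and w: "gaussian_with B w b"
  shows "gaussian_with (A \<Otimes>\<^sub>M B) (\<lambda>z. u (fst z) + w (snd z)) (a + b)"
proof (rule gaussian_with_char)
  interpret A: prob_space A by fact
  interpret B: prob_space B by fact
  interpret P: pair_prob_space A B ..
  note [measurable] = gaussian_withD(1)[OF u] gaussian_withD(1)[OF w]
  show "prob_space (A \<Otimes>\<^sub>M B)" by (rule P.prob_space_axioms)
  show "(\<lambda>z. u (fst z) + w (snd z)) \<in> borel_measurable (A \<Otimes>\<^sub>M B)" by measurable
  show "0 \<le> a + b" using gaussian_withD(2)[OF u] gaussian_withD(2)[OF w] by simp
  show "char (distr (A \<Otimes>\<^sub>M B) borel (\<lambda>z. u (fst z) + w (snd z))) t = of_real (exp (- (a + b) * t\<^sup>2 / 2))" for t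
    using char_pair_sum[OF A B gaussian_withD(1)[OF u] gaussian_withD(1)[OF w]]
      gaussian_with_char_eq[OF u] gaussian_with_char_eq[OF w]
    by (simp add: exp_add[symmetric] of_real_mult[symmetric] field_simps del: of_real_mult of_real_exp)
qed

section \<open>Gaussian measures and their measurable linear functionals\<close>

lemma borel_prod_sets:
  fixes A :: "'a::second_countable_topology measure" and B :: "'b::second_countable_topology measure"
  assumes "sets A = sets borel" "sets B = sets borel"
  shows "sets (A \<Otimes>\<^sub>M B) = sets borel"
  using sets_pair_measure_cong[OF assms] unfolding borel_prod .

lemma bounded_linear_prod_split:
  assumes "bounded_linear (F :: 'a::real_normed_vector \<times> 'b::real_normed_vector \<Rightarrow> real)"
  shows "bounded_linear (\<lambda>x. F (x, 0))" "bounded_linear (\<lambda>y. F (0, y))"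
    and "F z = F (fst z, 0) + F (0, snd z)"
proof -
  show "bounded_linear (\<lambda>x. F (x, 0))"
    by (rule bounded_linear_compose[OF assms]) (intro bounded_linear_Pair bounded_linear_ident bounded_linear_zero)
  show "bounded_linear (\<lambda>y. F (0, y))"
    by (rule bounded_linear_compose[OF assms]) (intro bounded_linear_Pair bounded_linear_ident bounded_linear_zero)
  show "F z = F (fst z, 0) + F (0, snd z)"
    using linear_add[OF bounded_linear.linear[OF assms], of "(fst z, 0)" "(0, snd z)"] by simp
qed

definition rot :: "real \<Rightarrow> real \<Rightarrow> 'a::real_vector \<times> 'a \<Rightarrow> 'a \<times> 'a" where
  "rot c s z = (c *\<^sub>R fst z + s *\<^sub>R snd z, - s *\<^sub>R fst z + c *\<^sub>R snd z)"

text \<open>Functionals that are Borel, and linear on some Borel subspace of full measure, but not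
  necessarily continuous. The composition of a continuous functional with a measurable linear map
  is of this kind.\<close>

definition full_subspace :: "'a::real_normed_vector measure \<Rightarrow> 'a set \<Rightarrow> bool" where
  "full_subspace M F \<longleftrightarrow> subspace F \<and> F \<in> sets borel \<and> (AE x in M. x \<in> F)"

definition linear_on_subspace :: "'a::real_vector set \<Rightarrow> ('a \<Rightarrow> 'b::real_vector) \<Rightarrow> bool" where
  "linear_on_subspace F w \<longleftrightarrow>
     (\<forall>x\<in>F. \<forall>y\<in>F. w (x + y) = w x + w y) \<and> (\<forall>c. \<forall>x\<in>F. w (c *\<^sub>R x) = c *\<^sub>R w x)"

definition measurable_linear :: "'a::real_normed_vector measure \<Rightarrow> ('a \<Rightarrow> real) \<Rightarrow> bool" where
  "measurable_linear M w \<longleftrightarrow> w \<in> borel_measurable borel \<and> (\<exists>F. full_subspace M F \<and> linear_on_subspace F w)"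

lemma full_subspace_Int: "full_subspace M F \<Longrightarrow> full_subspace M G \<Longrightarrow> full_subspace M (F \<inter> G)"
  unfolding full_subspace_def by (auto intro: subspace_inter)

lemma linear_on_subspace_mono: "linear_on_subspace F w \<Longrightarrow> G \<subseteq> F \<Longrightarrow> linear_on_subspace G w"
  unfolding linear_on_subspace_def by blast

lemma linear_on_subspace_combine:
  fixes u w :: "'a::real_vector \<Rightarrow> real"
  shows "linear_on_subspace F u \<Longrightarrow> linear_on_subspace F w \<Longrightarrow> linear_on_subspace F (\<lambda>x. a * u x + b * w x)"
  unfolding linear_on_subspace_def by (simp add: algebra_simps)

lemma measurable_linear_combine:
  assumes "measurable_linear M u" "measurable_linear M w"
  shows "measurable_linear M (\<lambda>x. a * u x + b * w x)"
proof -
  obtain F where F: "full_subspace M F" "linear_on_subspace F u"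
    using assms(1) unfolding measurable_linear_def by blast
  obtain G where G: "full_subspace M G" "linear_on_subspace G w"
    using assms(2) unfolding measurable_linear_def by blast
  have [measurable]: "u \<in> borel_measurable borel" "w \<in> borel_measurable borel"
    using assms unfolding measurable_linear_def by auto
  have "linear_on_subspace (F \<inter> G) (\<lambda>x. a * u x + b * w x)"
    by (intro linear_on_subspace_combine linear_on_subspace_mono[OF F(2)] linear_on_subspace_mono[OF G(2)]) auto
  then show ?thesis
    unfolding measurable_linear_def using full_subspace_Int[OF F(1) G(1)] by (intro conjI) auto
qed

lemma measurable_linear_functional: "bounded_linear f \<Longrightarrow> measurable_linear M f"
  unfolding measurable_linear_def
  by (intro conjI exI[of _ UNIV] bounded_linear_borel)
     (auto simp: full_subspace_def linear_on_subspace_def linear_add linear_cmul bounded_linear.linear)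

lemma measurable_linear_scale: "measurable_linear M w \<Longrightarrow> measurable_linear M (\<lambda>x. c * w x)"
  using measurable_linear_combine[of M w w c 0] by simp

lemma measurable_linear_add:
  "measurable_linear M u \<Longrightarrow> measurable_linear M w \<Longrightarrow> measurable_linear M (\<lambda>x. u x + w x)"
  using measurable_linear_combine[of M u w 1 1] by simp

text \<open>The positive bounded solutions of Cauchy's multiplicative equation.\<close>

lemma multiplicative_bounded_imp_exp:
  fixes \<psi> :: "real \<Rightarrow> real"
  assumes mult: "\<And>a b. a \<ge> 0 \<Longrightarrow> b \<ge> 0 \<Longrightarrow> \<psi> (a + b) = \<psi> a * \<psi> b"
    and zero: "\<psi> 0 = 1" and le: "\<And>a. a \<ge> 0 \<Longrightarrow> \<bar>\<psi> a\<bar> \<le> 1"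
    and lim: "(\<lambda>n. \<psi> (1 / 2 ^ n)) \<longlonglongrightarrow> 1"
  obtains k where "k \<ge> 0" "\<And>a. a \<ge> 0 \<Longrightarrow> \<psi> a = exp (- k * a)"
proof -
  have pow: "\<psi> (real n * a) = \<psi> a ^ n" if "a \<ge> 0" for n a
    by (induction n) (use that zero mult in \<open>auto simp: distrib_right\<close>)
  have nonneg: "\<psi> a \<ge> 0" if "a \<ge> 0" for a
    using mult[of "a/2" "a/2"] that by simp
  have pos1: "\<psi> 1 > 0"
  proof (rule ccontr)
    assume "\<not> \<psi> 1 > 0"
    then have "\<psi> 1 = 0" using nonneg[of 1] by simp
    have "\<psi> (1 / 2 ^ n) = 0" for n
    proof -
      have "\<psi> (real (2 ^ n) * (1 / 2 ^ n)) = \<psi> (1 / 2 ^ n) ^ (2 ^ n)" by (rule pow) simp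
      then show ?thesis using \<open>\<psi> 1 = 0\<close> by simp
    qed
    then show False using lim LIMSEQ_unique[OF lim, of 0] by simp
  qed
  have pos: "\<psi> a > 0" if "a \<ge> 0" for a
  proof -
    obtain n :: nat where "a \<le> n" using real_arch_simple by blast
    then have "\<psi> (real n) = \<psi> a * \<psi> (real n - a)" using mult[of a "real n - a"] that by simp
    moreover have "\<psi> (real n) = \<psi> 1 ^ n" using pow[of 1 n] by simp
    ultimately have "\<psi> a * \<psi> (real n - a) = \<psi> 1 ^ n" by simp
    then have "\<psi> a * \<psi> (real n - a) > 0" using zero_less_power[OF pos1, of n] by linarith
    then show ?thesis using nonneg[OF that] by (metis mult_eq_0_iff less_le)
  qed
  define g where "g a = - ln (\<psi> a)" for a
  have gadd: "g (a + b) = g a + g b" if "a \<ge> 0" "b \<ge> 0" for a b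
    using mult[OF that] pos[OF that(1)] pos[OF that(2)] by (simp add: g_def ln_mult)
  have gnn: "g a \<ge> 0" if "a \<ge> 0" for a
    using pos[OF that] le[OF that] by (simp add: g_def)
  have gmono: "g a \<le> g b" if "0 \<le> a" "a \<le> b" for a b
    using gadd[of a "b - a"] gnn[of "b - a"] that by simp
  have gpow: "g (real n * a) = real n * g a" if "a \<ge> 0" for n a
    using pow[OF that] pos[OF that] by (simp add: g_def ln_realpow)
  have lin: "g a = a * g 1" if a: "a \<ge> 0" for a
  proof -
    have bound: "real n * \<bar>g a - a * g 1\<bar> \<le> g 1" for n
    proof -
      define m where "m = nat \<lfloor>real n * a\<rfloor>"
      have m: "real m \<le> real n * a" "real n * a \<le> real m + 1"
        using a by (simp_all add: m_def)
      have "real m * g 1 \<le> real n * g a"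
        using gmono[of "real m" "real n * a"] m gpow[of 1 m] gpow[OF a, of n] by simp
      moreover have "real n * g a \<le> (real m + 1) * g 1"
        using gmono[of "real n * a" "real (Suc m)"] m gpow[of 1 "Suc m"] gpow[OF a, of n] a by (simp add: add.commute)
      moreover have "real m * g 1 \<le> real n * a * g 1" "real n * a * g 1 \<le> (real m + 1) * g 1"
        using m gnn[of 1] by (auto intro: mult_right_mono)
      ultimately have "\<bar>real n * g a - real n * a * g 1\<bar> \<le> g 1" by (simp add: algebra_simps abs_le_iff)
      moreover have "real n * g a - real n * a * g 1 = real n * (g a - a * g 1)" by (simp add: algebra_simps)
      ultimately show ?thesis by (simp add: abs_mult)
    qed
    have "\<bar>g a - a * g 1\<bar> = 0"
    proof (rule ccontr)
      assume "\<bar>g a - a * g 1\<bar> \<noteq> 0"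
      then have d: "\<bar>g a - a * g 1\<bar> > 0" by simp
      obtain n :: nat where "g 1 / \<bar>g a - a * g 1\<bar> < real n" using reals_Archimedean2 by blast
      then show False using bound[of n] d by (simp add: divide_less_eq)
    qed
    then show ?thesis by simp
  qed
  show ?thesis
  proof (rule that[of "g 1"])
    show "g 1 \<ge> 0" by (rule gnn) simp
    show "\<psi> a = exp (- g 1 * a)" if "a \<ge> 0" for a
      using lin[OF that] pos[OF that] by (simp add: g_def mult.commute minus_equation_iff[of "ln (\<psi> a)"] exp_minus[symmetric])
        (metis exp_ln minus_minus)
  qed
qed

locale gaussian_space =
  fixes M :: "'a::{banach, second_countable_topology} measure"
  assumes gaussian_M: "centered_gaussian_measure M"
begin

sublocale prob_space M
  using gaussian_M by (simp add: centered_gaussian_measure_def)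

lemma sets_M [measurable_cong]: "sets M = sets borel"
  using gaussian_M by (simp add: centered_gaussian_measure_def)

lemma space_M [simp]: "space M = UNIV"
  using sets_eq_imp_space_eq[OF sets_M] by simp

lemma sets_MM: "sets (M \<Otimes>\<^sub>M M) = sets (borel :: ('a \<times> 'a) measure)"
  by (rule borel_prod_sets[OF sets_M sets_M])

lemma prob_space_MM: "prob_space (M \<Otimes>\<^sub>M M)"
proof -
  interpret P: pair_prob_space M M ..
  show ?thesis by (rule P.prob_space_axioms)
qed

lemma borel_measurable_M: "f \<in> borel \<rightarrow>\<^sub>M N \<Longrightarrow> f \<in> M \<rightarrow>\<^sub>M N"
  using measurable_cong_sets[OF sets_M refl] by blast

lemma functional_gaussian:
  assumes "bounded_linear f" shows "gaussian_with M f (\<integral>x. (f x)\<^sup>2 \<partial>M)"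
proof -
  have "centered_gaussian_rv M f" using gaussian_M assms by (simp add: centered_gaussian_measure_def)
  then obtain v where v: "gaussian_with M f v"
    using centered_gaussian_rv_imp[OF prob_space_axioms borel_measurable_M[OF bounded_linear_borel[OF assms]]] by blast
  then show ?thesis using gaussian_with_square(2)[OF v] by simp
qed

lemma rot_measurable [measurable]: "rot c s \<in> (M \<Otimes>\<^sub>M M) \<rightarrow>\<^sub>M (M \<Otimes>\<^sub>M M)"
  unfolding rot_def by measurable

text \<open>Two independent copies of a centered Gaussian vector are rotated into two independent copies:
  a functional of the rotated pair is again a sum of independent Gaussians, with the same total
  variance.\<close>

theorem rotation_invariant:
  assumes cs: "c\<^sup>2 + s\<^sup>2 = 1"
  shows "distr (M \<Otimes>\<^sub>M M) (M \<Otimes>\<^sub>M M) (rot c s) = M \<Otimes>\<^sub>M M"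
proof (rule measure_eqI_functionals)
  interpret MM: prob_space "M \<Otimes>\<^sub>M M" by (rule prob_space_MM)
  show "prob_space (distr (M \<Otimes>\<^sub>M M) (M \<Otimes>\<^sub>M M) (rot c s))" by (rule MM.prob_space_distr) simp
  show "prob_space (M \<Otimes>\<^sub>M M)" by (rule prob_space_MM)
  show "sets (M \<Otimes>\<^sub>M M) = sets borel" by (rule sets_MM)
  show "sets (distr (M \<Otimes>\<^sub>M M) (M \<Otimes>\<^sub>M M) (rot c s)) = sets borel" using sets_MM by simp
  fix F :: "'a \<times> 'a \<Rightarrow> real" assume F: "bounded_linear F"
  define f where "f = (\<lambda>x. F (x, 0))"
  define g where "g = (\<lambda>y. F (0, y))"
  note fg = bounded_linear_prod_split[OF F, folded f_def g_def]
  have fg3: "F z = f (fst z) + g (snd z)" for z using fg(3)[of z] by (simp add: f_def g_def)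
  define u where "u = (\<lambda>x. c * f x - s * g x)"
  define w where "w = (\<lambda>x. s * f x + c * g x)"
  have uw: "bounded_linear u" "bounded_linear w"
  proof -
    have *: "bounded_linear (\<lambda>x. r * h x)" if "bounded_linear h" for r :: real and h :: "'a \<Rightarrow> real"
      using bounded_linear_compose[OF bounded_linear_mult_right that] .
    show "bounded_linear u" unfolding u_def by (rule bounded_linear_sub[OF *[OF fg(1)] *[OF fg(2)]])
    show "bounded_linear w" unfolding w_def by (rule bounded_linear_add[OF *[OF fg(1)] *[OF fg(2)]])
  qed
  have Frot: "F (rot c s z) = u (fst z) + w (snd z)" for z
    using fg(1,2) by (simp add: fg3 rot_def u_def w_def linear_add linear_diff linear_cmul linear_neg bounded_linear.linear algebra_simps)
  have i: "integrable M (\<lambda>x. (f x)\<^sup>2)" "integrable M (\<lambda>x. (g x)\<^sup>2)" "integrable M (\<lambda>x. (u x)\<^sup>2)" "integrable M (\<lambda>x. (w x)\<^sup>2)"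
    using gaussian_with_square(1)[OF functional_gaussian] fg uw by blast+
  have "(\<integral>x. (u x)\<^sup>2 \<partial>M) + (\<integral>x. (w x)\<^sup>2 \<partial>M) = (\<integral>x. (u x)\<^sup>2 + (w x)\<^sup>2 \<partial>M)" using i by simp
  also have "(\<lambda>x. (u x)\<^sup>2 + (w x)\<^sup>2) = (\<lambda>x. (f x)\<^sup>2 + (g x)\<^sup>2)"
  proof
    fix x
    have "(u x)\<^sup>2 + (w x)\<^sup>2 = (c\<^sup>2 + s\<^sup>2) * ((f x)\<^sup>2 + (g x)\<^sup>2)"
      unfolding u_def w_def by (simp add: power2_eq_square algebra_simps)
    then show "(u x)\<^sup>2 + (w x)\<^sup>2 = (f x)\<^sup>2 + (g x)\<^sup>2" using cs by simp
  qed
  also have "(\<integral>x. (f x)\<^sup>2 + (g x)\<^sup>2 \<partial>M) = (\<integral>x. (f x)\<^sup>2 \<partial>M) + (\<integral>x. (g x)\<^sup>2 \<partial>M)" using i by simp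
  finally have var: "(\<integral>x. (u x)\<^sup>2 \<partial>M) + (\<integral>x. (w x)\<^sup>2 \<partial>M) = (\<integral>x. (f x)\<^sup>2 \<partial>M) + (\<integral>x. (g x)\<^sup>2 \<partial>M)" .
  have Fm: "F \<in> (M \<Otimes>\<^sub>M M) \<rightarrow>\<^sub>M borel"
    using bounded_linear_borel[OF F] measurable_cong_sets[OF sets_MM refl] by blast
  have "distr (distr (M \<Otimes>\<^sub>M M) (M \<Otimes>\<^sub>M M) (rot c s)) borel F = distr (M \<Otimes>\<^sub>M M) borel (F \<circ> rot c s)"
    by (rule distr_distr[OF Fm]) simp
  also have "F \<circ> rot c s = (\<lambda>z. u (fst z) + w (snd z))" using Frot by auto
  also have "distr (M \<Otimes>\<^sub>M M) borel \<dots> = normal_law ((\<integral>x. (u x)\<^sup>2 \<partial>M) + (\<integral>x. (w x)\<^sup>2 \<partial>M))"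
    by (rule gaussian_withD(3)[OF gaussian_with_pair_sum[OF prob_space_axioms prob_space_axioms
          functional_gaussian[OF uw(1)] functional_gaussian[OF uw(2)]]])
  also have "\<dots> = distr (M \<Otimes>\<^sub>M M) borel (\<lambda>z. f (fst z) + g (snd z))"
    unfolding var
    by (rule gaussian_withD(3)[OF gaussian_with_pair_sum[OF prob_space_axioms prob_space_axioms
          functional_gaussian[OF fg(1)] functional_gaussian[OF fg(2)]], symmetric])
  also have "(\<lambda>z. f (fst z) + g (snd z)) = F" using fg3 by auto
  finally show "distr (distr (M \<Otimes>\<^sub>M M) (M \<Otimes>\<^sub>M M) (rot c s)) borel F = distr (M \<Otimes>\<^sub>M M) borel F" .
qed

lemma AE_MM_both:
  assumes "A \<in> sets borel" "AE x in M. x \<in> A"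
  shows "AE z in M \<Otimes>\<^sub>M M. fst z \<in> A \<and> snd z \<in> A"
proof -
  interpret P: pair_prob_space M M ..
  have [measurable]: "A \<in> sets M" using assms(1) sets_M by simp
  have "AE z in M \<Otimes>\<^sub>M M. (case z of (x, y) \<Rightarrow> x \<in> A \<and> y \<in> A)"
  proof (rule P.AE_pair_measure)
    show "{z \<in> space (M \<Otimes>\<^sub>M M). case z of (x, y) \<Rightarrow> x \<in> A \<and> y \<in> A} \<in> sets (M \<Otimes>\<^sub>M M)" by measurable
    show "AE x in M. AE y in M. case (x, y) of (x, y) \<Rightarrow> x \<in> A \<and> y \<in> A" using assms(2) by auto
  qed
  then show ?thesis by (auto simp: case_prod_beta)
qed

lemma measurable_linear_measurable: "measurable_linear M w \<Longrightarrow> w \<in> borel_measurable M"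
  unfolding measurable_linear_def by (auto intro: borel_measurable_M)

text \<open>Rotation invariance turns linearity into the functional equation
  \<open>\<phi> t = \<phi> (c t) \<phi> (s t)\<close> for the characteristic function, and Gaussians are its only solutions.\<close>

lemma measurable_linear_char_mult:
  assumes w: "measurable_linear M w" and cs: "c\<^sup>2 + s\<^sup>2 = 1"
  shows "char (distr M borel w) t = char (distr M borel w) (c * t) * char (distr M borel w) (s * t)"
proof -
  interpret MM: prob_space "M \<Otimes>\<^sub>M M" by (rule prob_space_MM)
  obtain F where F: "full_subspace M F" "linear_on_subspace F w"
    using w unfolding measurable_linear_def by blast
  have [measurable]: "w \<in> borel_measurable M" by (rule measurable_linear_measurable[OF w])
  have z: "char (distr M borel (\<lambda>_. 0::real)) t = 1"
    by (subst char_distr_eq) (simp_all add: prob_space[simplified])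
  have "char (distr M borel w) t = char (distr (M \<Otimes>\<^sub>M M) borel (\<lambda>z. w (fst z) + 0)) t"
    using char_pair_sum[OF prob_space_axioms prob_space_axioms, of w "\<lambda>_. 0" t] z by simp
  also have "\<dots> = (CLINT z|M \<Otimes>\<^sub>M M. iexp (t * w (fst z)))"
    by (subst char_distr_eq) simp_all
  also have "\<dots> = (CLINT z|distr (M \<Otimes>\<^sub>M M) (M \<Otimes>\<^sub>M M) (rot c s). iexp (t * w (fst z)))"
    unfolding rotation_invariant[OF cs] ..
  also have "\<dots> = (CLINT z|M \<Otimes>\<^sub>M M. iexp (t * w (fst (rot c s z))))"
    by (rule integral_distr) simp_all
  also have "\<dots> = (CLINT z|M \<Otimes>\<^sub>M M. iexp (t * ((c * w (fst z)) + (s * w (snd z)))))"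
  proof (rule integral_cong_AE)
    have "AE z in M \<Otimes>\<^sub>M M. fst z \<in> F \<and> snd z \<in> F"
      using F(1) by (intro AE_MM_both) (auto simp: full_subspace_def)
    then show "AE z in M \<Otimes>\<^sub>M M. iexp (t * w (fst (rot c s z))) = iexp (t * ((c * w (fst z)) + (s * w (snd z))))"
    proof eventually_elim
      case (elim z)
      then have "c *\<^sub>R fst z \<in> F" "s *\<^sub>R snd z \<in> F"
        using F(1) by (auto simp: full_subspace_def subspace_scale)
      then have "w (c *\<^sub>R fst z + s *\<^sub>R snd z) = c * w (fst z) + s * w (snd z)"
        using F(2) elim unfolding linear_on_subspace_def by simp
      then show ?case by (simp add: rot_def)
    qed
  qed measurable
  also have "\<dots> = char (distr (M \<Otimes>\<^sub>M M) borel (\<lambda>z. c * w (fst z) + s * w (snd z))) t"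
    by (subst char_distr_eq) simp_all
  also have "\<dots> = char (distr M borel (\<lambda>x. c * w x)) t * char (distr M borel (\<lambda>x. s * w x)) t"
    by (rule char_pair_sum[OF prob_space_axioms prob_space_axioms]) simp_all
  also have "\<dots> = char (distr M borel w) (c * t) * char (distr M borel w) (s * t)"
    by (simp add: char_distr_eq ac_simps)
  finally show ?thesis .
qed

text \<open>In terms of \<open>a = t\<^sup>2\<close> the functional equation is Cauchy's multiplicative equation. The choice
  \<open>c = -1\<close>, \<open>s = 0\<close> shows that \<open>\<phi>\<close> is even, hence real.\<close>

theorem measurable_linear_gaussian:
  assumes w: "measurable_linear M w"
  shows "gaussian_with M w (\<integral>x. (w x)\<^sup>2 \<partial>M)"
proof -
  define \<phi> where "\<phi> = char (distr M borel w)"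
  have wm: "w \<in> borel_measurable M" by (rule measurable_linear_measurable[OF w])
  interpret D: real_distribution "distr M borel w" by (rule real_distribution_distr[OF wm])
  have mult: "\<phi> t = \<phi> (c * t) * \<phi> (s * t)" if "c\<^sup>2 + s\<^sup>2 = 1" for c s t
    unfolding \<phi>_def by (rule measurable_linear_char_mult[OF w that])
  have \<phi>0: "\<phi> 0 = 1" unfolding \<phi>_def by (rule D.char_zero)
  have even: "\<phi> (- t) = \<phi> t" for t using mult[of "-1" 0 t] \<phi>0 by simp
  have "\<phi> (- t) = cnj (\<phi> t)" for t
    unfolding \<phi>_def char_def by (subst Bochner_Integration.integral_cnj[symmetric]) (simp add: exp_cnj)
  then have real: "\<phi> t = of_real (Re (\<phi> t))" for t
    using even[of t] by (metis Reals_cnj_iff of_real_Re)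
  define \<psi> where "\<psi> a = Re (\<phi> (sqrt a))" for a
  have \<psi>m: "\<psi> (a + b) = \<psi> a * \<psi> b" if ab: "a \<ge> 0" "b \<ge> 0" for a b
  proof (cases "a + b = 0")
    case True
    then have "a = 0" "b = 0" using ab by auto
    then show ?thesis by (simp add: \<psi>_def \<phi>0)
  next
    case False
    then have pos: "a + b > 0" using ab by simp
    define c where "c = sqrt (a / (a + b))"
    define s where "s = sqrt (b / (a + b))"
    have "c\<^sup>2 + s\<^sup>2 = 1" using ab pos by (simp add: c_def s_def add_divide_distrib[symmetric])
    moreover have "c * sqrt (a + b) = sqrt a" "s * sqrt (a + b) = sqrt b"
      using pos ab by (simp_all add: c_def s_def real_sqrt_mult[symmetric])
    ultimately have "\<phi> (sqrt (a + b)) = \<phi> (sqrt a) * \<phi> (sqrt b)" using mult[of c s "sqrt (a + b)"] by simp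
    then have "\<phi> (sqrt (a + b)) = of_real (\<psi> a * \<psi> b)"
      unfolding \<psi>_def using real[of "sqrt a"] real[of "sqrt b"] by (metis of_real_mult)
    then show ?thesis by (simp add: \<psi>_def)
  qed
  have \<psi>le: "\<bar>\<psi> a\<bar> \<le> 1" for a
    using abs_Re_le_cmod[of "\<phi> (sqrt a)"] D.cmod_char_le_1[of "sqrt a"] by (simp add: \<psi>_def \<phi>_def)
  have \<psi>lim: "(\<lambda>n. \<psi> (1 / 2 ^ n)) \<longlonglongrightarrow> 1"
  proof -
    have "(\<lambda>n. (1/2::real) ^ n) \<longlonglongrightarrow> 0" by (rule LIMSEQ_power_zero) simp
    then have "(\<lambda>n. sqrt ((1/2::real) ^ n)) \<longlonglongrightarrow> sqrt 0" by (rule tendsto_real_sqrt)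
    then have "(\<lambda>n. \<phi> (sqrt ((1/2) ^ n))) \<longlonglongrightarrow> \<phi> 0"
      unfolding \<phi>_def using isCont_tendsto_compose[OF D.isCont_char[of 0]] by simp
    then have "(\<lambda>n. Re (\<phi> (sqrt ((1/2) ^ n)))) \<longlonglongrightarrow> Re (\<phi> 0)" by (rule tendsto_Re)
    then show ?thesis by (simp add: \<psi>_def \<phi>0 power_divide)
  qed
  obtain k where k: "k \<ge> 0" "\<And>a. a \<ge> 0 \<Longrightarrow> \<psi> a = exp (- k * a)"
    using multiplicative_bounded_imp_exp[of \<psi>, OF \<psi>m _ \<psi>le \<psi>lim] \<phi>0 by (auto simp: \<psi>_def)
  have "gaussian_with M w (2 * k)"
  proof (rule gaussian_with_char[OF prob_space_axioms wm])
    show "0 \<le> 2 * k" using k by simp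
    fix t
    have "\<phi> t = \<phi> \<bar>t\<bar>" using even[of t] by (simp add: abs_if)
    also have "\<dots> = of_real (\<psi> (t\<^sup>2))" using real[of "\<bar>t\<bar>"] by (simp add: \<psi>_def)
    also have "\<dots> = of_real (exp (- (2 * k) * t\<^sup>2 / 2))" using k(2)[of "t\<^sup>2"] by simp
    finally show "char (distr M borel w) t = of_real (exp (- (2 * k) * t\<^sup>2 / 2))" by (simp add: \<phi>_def)
  qed
  then show ?thesis using gaussian_with_square(2) by metis
qed

end

section \<open>Fernique's theorem\<close>

text \<open>The radii along which the tail probability is squared in each step of Fernique's argument.\<close>

fun fernique_radius :: "nat \<Rightarrow> real" where
  "fernique_radius 0 = 1"
| "fernique_radius (Suc n) = 1 + sqrt 2 * fernique_radius n"

lemma fernique_radius_closed: "fernique_radius n = (2 + sqrt 2) * sqrt 2 ^ n - (sqrt 2 + 1)"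
proof (induction n)
  case (Suc n)
  have *: "1 + t * ((2 + t) * s - (t + 1)) = (2 + t) * (t * s) - (t + 1) + (2 - t * t)" for s t :: real
    by (simp add: algebra_simps)
  show ?case using *[of "sqrt 2" "sqrt 2 ^ n"] by (simp add: Suc)
qed simp

lemma fernique_radius_ge: "fernique_radius n \<ge> 1"
  by (induction n) auto

lemma fernique_radius_le: "fernique_radius n \<le> 4 * sqrt (2 ^ n)"
proof -
  have s: "sqrt 2 \<le> 2" "sqrt 2 \<ge> 0" by (simp_all add: real_le_lsqrt)
  have "fernique_radius n \<le> (2 + sqrt 2) * sqrt 2 ^ n" unfolding fernique_radius_closed using s by linarith
  also have "\<dots> \<le> 4 * sqrt 2 ^ n" using s by (intro mult_right_mono) auto
  finally show ?thesis by (simp add: real_sqrt_power)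
qed

definition symmetric_set :: "'a::real_vector set \<Rightarrow> bool" where
  "symmetric_set K \<longleftrightarrow> (\<forall>x\<in>K. - x \<in> K)"

lemma convex_symmetric_zero:
  assumes "convex K" "symmetric_set K" "K \<noteq> {}" shows "0 \<in> K"
proof -
  obtain x where x: "x \<in> K" using assms by blast
  then have "(1/2) *\<^sub>R x + (1/2) *\<^sub>R (- x) \<in> K"
    using assms by (intro convexD) (auto simp: symmetric_set_def)
  then show ?thesis by simp
qed

lemma convex_symmetric_scale:
  assumes "convex K" "symmetric_set K" "x \<in> K" "\<bar>c\<bar> \<le> 1" shows "c *\<^sub>R x \<in> K"
proof -
  have "0 \<in> K" using convex_symmetric_zero[OF assms(1,2)] assms(3) by blast
  have "\<bar>c\<bar> *\<^sub>R y + (1 - \<bar>c\<bar>) *\<^sub>R 0 \<in> K" if "y \<in> K" for y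
    using assms(1,4) \<open>0 \<in> K\<close> that by (intro convexD) auto
  then have *: "\<bar>c\<bar> *\<^sub>R y \<in> K" if "y \<in> K" for y using that by simp
  show ?thesis
  proof (cases "c \<ge> 0")
    case True then show ?thesis using *[OF assms(3)] by simp
  next
    case False
    have "- x \<in> K" using assms by (simp add: symmetric_set_def)
    from *[OF this] False show ?thesis by simp
  qed
qed

lemma convex_symmetric_scale_mono:
  assumes "convex K" "symmetric_set K" "0 < t" "t \<le> t'" "x /\<^sub>R t \<in> K" shows "x /\<^sub>R t' \<in> K"
proof -
  have "(t / t') *\<^sub>R (x /\<^sub>R t) \<in> K"
    by (rule convex_symmetric_scale[OF assms(1,2,5)]) (use assms(3,4) in simp)
  moreover have "t / t' * inverse t = inverse t'" using assms(3) by (simp add: field_simps)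
  ultimately show ?thesis by (simp only: scaleR_scaleR)
qed

context gaussian_space begin

definition outside :: "'a set \<Rightarrow> real \<Rightarrow> real" where
  "outside K t = measure M {x. x /\<^sub>R t \<notin> K}"

lemma outside_sets: "closed K \<Longrightarrow> {x. x /\<^sub>R t \<notin> K} \<in> sets M"
proof -
  assume "closed K"
  then have [measurable]: "K \<in> sets borel" by simp
  have "{x \<in> space M. x /\<^sub>R t \<notin> K} \<in> sets M" by measurable
  then show ?thesis by simp
qed

lemma outside_antimono:
  assumes "closed K" "convex K" "symmetric_set K" "0 < t" "t \<le> t'"
  shows "outside K t' \<le> outside K t"
  unfolding outside_def
  using assms convex_symmetric_scale_mono[OF assms(2-5)] by (intro finite_measure_mono outside_sets) auto

text \<open>Rotating by \<open>\<pi>/4\<close>: if \<open>(y - x)/\<surd>2\<close> is in \<open>K\<close> and \<open>(x + y)/\<surd>2\<close> is outside \<open>(1 + \<surd>2 t) K\<close>, then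
  both \<open>x\<close> and \<open>y\<close> are outside \<open>t K\<close>.\<close>

lemma fernique_step:
  assumes K: "closed K" "convex K" "symmetric_set K" and t: "t \<ge> 1"
  shows "measure M K * outside K (1 + sqrt 2 * t) \<le> (outside K t)\<^sup>2"
proof -
  interpret P: pair_prob_space M M ..
  define r where "r = 1 + sqrt 2 * t"
  define A where "A = {x. x /\<^sub>R r \<notin> K}"
  define B where "B = {x. x /\<^sub>R t \<notin> K}"
  have [measurable]: "A \<in> sets M" "B \<in> sets M" "K \<in> sets M"
    unfolding A_def B_def using outside_sets K sets_M by auto
  define c where "c = 1 / sqrt 2"
  have c: "c\<^sup>2 + c\<^sup>2 = 1" "c * sqrt 2 = 1" "c > 0" by (simp_all add: c_def power2_eq_square)
  have r: "r > 0" using t by (simp add: r_def add_pos_nonneg)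
  have conv: "(c *\<^sub>R (x + y)) /\<^sub>R r \<in> K" if x: "x /\<^sub>R t \<in> K" and d: "c *\<^sub>R (y - x) \<in> K" for x y
  proof -
    have "(sqrt 2 * t / r) *\<^sub>R (x /\<^sub>R t) + (1 / r) *\<^sub>R (c *\<^sub>R (y - x)) \<in> K"
      using K(2) x d t r by (intro convexD) (auto simp: r_def add_divide_distrib[symmetric] add.commute)
    also have "(sqrt 2 * t / r) *\<^sub>R (x /\<^sub>R t) + (1 / r) *\<^sub>R (c *\<^sub>R (y - x)) = (1 / r) *\<^sub>R (sqrt 2 *\<^sub>R x + c *\<^sub>R (y - x))"
      using t by (simp add: scaleR_add_right)
    also have "sqrt 2 *\<^sub>R x + c *\<^sub>R (y - x) = c *\<^sub>R (x + y)"
    proof -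
      have "sqrt 2 = 2 * c" unfolding c_def by (simp add: real_div_sqrt)
      moreover have "(2 * c) *\<^sub>R x = c *\<^sub>R x + c *\<^sub>R x" by (metis mult_2 scaleR_left_distrib)
      ultimately show ?thesis by (simp add: algebra_simps)
    qed
    finally show ?thesis by (simp add: divide_inverse)
  qed
  have incl: "z \<in> B \<times> B" if z: "rot c c z \<in> A \<times> K" for z
  proof -
    obtain x y where xy: "z = (x, y)" by (cases z)
    have 1: "c *\<^sub>R (x + y) /\<^sub>R r \<notin> K" "c *\<^sub>R (y - x) \<in> K"
      using z xy by (auto simp: rot_def A_def algebra_simps)
    have "c *\<^sub>R (x - y) \<in> K" using 1(2) K(3) unfolding symmetric_set_def
      by (metis minus_diff_eq scaleR_minus_right)
    then have "x /\<^sub>R t \<notin> K" "y /\<^sub>R t \<notin> K"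
      using conv[of x y] conv[of y x] 1 by (auto simp: add.commute)
    then show ?thesis by (simp add: xy B_def)
  qed
  have "emeasure M A * emeasure M K = emeasure (M \<Otimes>\<^sub>M M) (A \<times> K)"
    by (rule emeasure_pair_measure_Times[symmetric]) simp_all
  also have "\<dots> = emeasure (distr (M \<Otimes>\<^sub>M M) (M \<Otimes>\<^sub>M M) (rot c c)) (A \<times> K)"
    unfolding rotation_invariant[OF c(1)] ..
  also have "\<dots> = emeasure (M \<Otimes>\<^sub>M M) (rot c c -` (A \<times> K) \<inter> space (M \<Otimes>\<^sub>M M))"
    by (rule emeasure_distr) simp_all
  also have "\<dots> \<le> emeasure (M \<Otimes>\<^sub>M M) (B \<times> B)"
  proof (rule emeasure_mono)
    show "rot c c -` (A \<times> K) \<inter> space (M \<Otimes>\<^sub>M M) \<subseteq> B \<times> B"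
    proof
      fix z assume "z \<in> rot c c -` (A \<times> K) \<inter> space (M \<Otimes>\<^sub>M M)"
      then have "rot c c z \<in> A \<times> K" by (simp only: Int_iff vimage_eq)
      then show "z \<in> B \<times> B" by (rule incl)
    qed
  qed simp
  also have "\<dots> = emeasure M B * emeasure M B"
    by (rule emeasure_pair_measure_Times) simp_all
  finally have "measure M A * measure M K \<le> measure M B * measure M B"
    by (simp add: emeasure_eq_measure ennreal_mult[symmetric])
  then show ?thesis by (simp add: outside_def A_def B_def r_def power2_eq_square mult.commute)
qed

text \<open>Relative to \<open>measure M K\<close>, the tail beyond \<open>fernique_radius n\<close> is at most \<open>(1/9)^(2^n)\<close>, while the radius
  is only of order \<open>2^(n/2)\<close>: a Gaussian tail. The constants are chosen so that, at \<open>u = ln n\<close>, the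
  bound is the summable \<open>1 / n\<^sup>2\<close>.\<close>

theorem fernique:
  assumes K: "closed K" "convex K" "symmetric_set K" and big: "measure M K \<ge> 9/10" and u: "u \<ge> 1"
  shows "outside K (4 * sqrt (2 * u)) \<le> exp (- 2 * u)"
proof -
  define p where "p = measure M K"
  have p: "p \<ge> 9/10" using big by (simp add: p_def)
  have o1: "outside K 1 = 1 - p"
  proof -
    have KS: "K \<in> events" using K sets_M by simp
    have "{x. x /\<^sub>R 1 \<notin> K} = space M - K" by auto
    then show ?thesis using prob_compl[OF KS] by (simp add: outside_def p_def)
  qed
  have iter: "outside K (fernique_radius n) / p \<le> (1/9) ^ (2 ^ n)" for n
  proof (induction n)
    case 0
    then show ?case using o1 p by (simp add: divide_le_eq)
  next
    case (Suc n)
    have "p * outside K (fernique_radius (Suc n)) \<le> (outside K (fernique_radius n))\<^sup>2"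
      using fernique_step[OF K fernique_radius_ge[of n]] by (simp add: p_def)
    then have "outside K (fernique_radius (Suc n)) / p \<le> (outside K (fernique_radius n) / p)\<^sup>2"
      using p by (simp add: field_simps power2_eq_square)
    also have "\<dots> \<le> ((1/9) ^ (2 ^ n))\<^sup>2"
      using Suc p by (intro power_mono) (auto simp: outside_def)
    also have "\<dots> = (1/9) ^ (2 ^ Suc n)" by (simp add: power_mult[symmetric] mult.commute)
    finally show ?case .
  qed
  obtain n where n: "u \<le> 2 ^ n" "2 ^ n \<le> 2 * u"
  proof -
    have "\<exists>m. u < 2 ^ m" by (rule real_arch_pow) simp
    then obtain m :: nat where m: "u < 2 ^ m" by (rule exE)
    define n where "n = (LEAST m. u \<le> 2 ^ m)"
    have n1: "u \<le> 2 ^ n" unfolding n_def by (rule LeastI[of _ m]) (use m in simp)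
    have "2 ^ n \<le> 2 * u"
    proof (cases n)
      case 0 then show ?thesis using u by simp
    next
      case (Suc k)
      then have "k < (LEAST m. u \<le> 2 ^ m)" by (simp add: n_def)
      from not_less_Least[OF this] have "2 ^ k < u" by simp
      then show ?thesis using Suc by simp
    qed
    then show ?thesis using that n1 by blast
  qed
  have "outside K (4 * sqrt (2 * u)) \<le> outside K (fernique_radius n)"
  proof (rule outside_antimono[OF K])
    show "0 < fernique_radius n" using fernique_radius_ge[of n] by simp
    show "fernique_radius n \<le> 4 * sqrt (2 * u)"
      using fernique_radius_le[of n] real_sqrt_le_mono[OF n(2)] by linarith
  qed
  also have "\<dots> \<le> p * (1/9) ^ (2 ^ n)" using iter[of n] p by (simp add: divide_le_eq mult.commute)
  also have "\<dots> \<le> 1 * (1/9) ^ (2 ^ n)" by (intro mult_right_mono) (auto simp: p_def)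
  also have "\<dots> \<le> 1 * exp (- 2) ^ (2 ^ n)"
  proof -
    have "exp (2::real) = exp 1 * exp 1" by (simp add: exp_add[symmetric])
    also have "\<dots> \<le> 3 * 3" using exp_le by (intro mult_mono) auto
    finally have "1/9 \<le> exp (- 2 :: real)" by (simp add: exp_minus field_simps)
    then show ?thesis by (simp add: power_mono)
  qed
  also have "\<dots> = exp (- 2 * 2 ^ n)"
    by (simp add: exp_of_nat_mult[symmetric] mult.commute)
  also have "\<dots> \<le> exp (- 2 * u)" using n by simp
  finally show ?thesis .
qed

lemma big_cball:
  obtains R where "R > 0" "measure M (cball 0 R) \<ge> 9/10"
proof -
  obtain K where K: "compact K" "measure M K > 1 - 1/10"
    using tight_compact[OF prob_space_axioms sets_M, of "1/10"] by auto
  obtain R where R: "R > 0" "\<And>x. x \<in> K \<Longrightarrow> norm x \<le> R"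
    using compact_imp_bounded[OF K(1)] unfolding bounded_pos by blast
  have "measure M K \<le> measure M (cball 0 R)"
    using R sets_M by (intro finite_measure_mono) auto
  then show ?thesis using that[OF R(1)] K by simp
qed

theorem integrable_norm_square: "integrable M (\<lambda>x. (norm x)\<^sup>2)"
proof -
  obtain R where R: "R > 0" "measure M (cball 0 R) \<ge> 9/10" by (rule big_cball)
  have symm: "symmetric_set (cball (0::'a) R)" by (simp add: symmetric_set_def)
  define Z :: "'a \<Rightarrow> real" where "Z x = (norm x)\<^sup>2 / (32 * R\<^sup>2)" for x
  have Zm [measurable]: "Z \<in> borel_measurable M" unfolding Z_def by measurable
  have tail: "emeasure M {x \<in> space M. real n < Z x} \<le> ennreal (exp (- 2) ^ n)" for n
  proof (cases "n = 0")
    case True then show ?thesis by (simp add: emeasure_eq_measure)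
  next
    case False
    have "{x \<in> space M. real n < Z x} \<subseteq> {x. x /\<^sub>R (4 * sqrt (2 * real n)) \<notin> cball 0 R}"
    proof
      fix x assume "x \<in> {x \<in> space M. real n < Z x}"
      then have "R\<^sup>2 * (32 * real n) < (norm x)\<^sup>2" using R by (simp add: Z_def field_simps)
      then have "(R * (4 * sqrt (2 * real n)))\<^sup>2 < (norm x)\<^sup>2" by (simp add: power_mult_distrib algebra_simps)
      then have "R * (4 * sqrt (2 * real n)) < norm x" by (rule power2_less_imp_less) simp
      then show "x \<in> {x. x /\<^sub>R (4 * sqrt (2 * real n)) \<notin> cball 0 R}"
        using False by (simp add: field_simps)
    qed
    then have "measure M {x \<in> space M. real n < Z x} \<le> outside (cball 0 R) (4 * sqrt (2 * real n))"
      unfolding outside_def by (intro finite_measure_mono outside_sets) auto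
    also have "\<dots> \<le> exp (- 2 * real n)"
      using False by (intro fernique symm R) auto
    also have "\<dots> = exp (- 2) ^ n" by (simp add: exp_of_nat_mult[symmetric] mult.commute)
    finally show ?thesis by (simp add: emeasure_eq_measure ennreal_leI)
  qed
  have pt: "ennreal (Z x) \<le> 1 + (\<Sum>n. indicator {x \<in> space M. real n < Z x} x)" for x
  proof -
    define m where "m = nat (\<lceil>Z x\<rceil> - 1)"
    have nn: "Z x \<ge> 0" by (simp add: Z_def)
    have "Z x \<le> 1 + real m" unfolding m_def using nn by linarith
    then have "ennreal (Z x) \<le> 1 + of_nat m"
      by (metis ennreal_leI ennreal_plus ennreal_1 ennreal_of_nat_eq_real_of_nat of_nat_0_le_iff zero_le_one)
    also have "(of_nat m :: ennreal) = (\<Sum>n<m. indicator {x \<in> space M. real n < Z x} x)"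
    proof -
      have "real n < Z x" if "n < m" for n using that unfolding m_def by linarith
      then show ?thesis by simp
    qed
    also have "\<dots> \<le> (\<Sum>n. indicator {x \<in> space M. real n < Z x} x)" by (rule sum_le_suminf) auto
    finally show ?thesis by (simp add: add_left_mono)
  qed
  have "(\<integral>\<^sup>+x. ennreal (Z x) \<partial>M) \<le> (\<integral>\<^sup>+x. 1 + (\<Sum>n. indicator {x \<in> space M. real n < Z x} x) \<partial>M)"
    by (rule nn_integral_mono) (rule pt)
  also have "\<dots> = 1 + (\<Sum>n. emeasure M {x \<in> space M. real n < Z x})"
    by (subst nn_integral_add) (simp_all add: nn_integral_suminf emeasure_space_1[simplified])
  also have "\<dots> \<le> 1 + (\<Sum>n. ennreal (exp (- 2) ^ n))"
    by (intro add_left_mono suminf_le tail) auto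
  also have "(\<Sum>n. ennreal (exp (- 2) ^ n)) = ennreal (\<Sum>n. exp (- 2) ^ n)"
    by (intro suminf_ennreal2 summable_geometric) auto
  also have "1 + \<dots> < \<infinity>" by simp
  finally have fin: "(\<integral>\<^sup>+x. ennreal (Z x) \<partial>M) < \<infinity>" .
  have "integrable M Z" by (rule integrableI_nonneg) (use fin in \<open>auto simp: Z_def\<close>)
  then have "integrable M (\<lambda>x. (32 * R\<^sup>2) * Z x)" by (rule integrable_mult_right)
  then show ?thesis using R by (simp add: Z_def)
qed

section \<open>The Cameron--Martin formula\<close>

abbreviation var :: "('a \<Rightarrow> real) \<Rightarrow> real" where
  "var w \<equiv> (\<integral>x. (w x)\<^sup>2 \<partial>M)"

text \<open>The covariance operator applied to \<open>w\<close>.\<close>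

definition cm_vec :: "('a \<Rightarrow> real) \<Rightarrow> 'a" where
  "cm_vec w = (\<integral>x. w x *\<^sub>R x \<partial>M)"

lemma measurable_linear_square_integrable: "measurable_linear M w \<Longrightarrow> integrable M (\<lambda>x. (w x)\<^sup>2)"
  using gaussian_with_square(1)[OF measurable_linear_gaussian] .

lemma measurable_linear_mult_integrable:
  assumes "measurable_linear M u" "measurable_linear M w"
  shows "integrable M (\<lambda>x. u x * w x)"
proof (rule Bochner_Integration.integrable_bound)
  show "integrable M (\<lambda>x. (u x)\<^sup>2 + (w x)\<^sup>2)"
    using assms by (simp add: measurable_linear_square_integrable)
  note [measurable] = assms[THEN measurable_linear_measurable]
  show "(\<lambda>x. u x * w x) \<in> borel_measurable M" by measurable
  show "AE x in M. norm (u x * w x) \<le> norm ((u x)\<^sup>2 + (w x)\<^sup>2)"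
  proof (rule AE_I2)
    fix x
    have "2 * (\<bar>u x\<bar> * \<bar>w x\<bar>) \<le> (u x)\<^sup>2 + (w x)\<^sup>2"
      using sum_squares_bound[of "\<bar>u x\<bar>" "\<bar>w x\<bar>"] by (simp add: mult.assoc)
    moreover have "0 \<le> \<bar>u x\<bar> * \<bar>w x\<bar>" by simp
    ultimately have "\<bar>u x\<bar> * \<bar>w x\<bar> \<le> (u x)\<^sup>2 + (w x)\<^sup>2" by linarith
    then show "norm (u x * w x) \<le> norm ((u x)\<^sup>2 + (w x)\<^sup>2)" by (simp add: abs_mult)
  qed
qed

lemma var_combine:
  assumes u: "measurable_linear M u" and w: "measurable_linear M w"
  shows "var (\<lambda>x. a * u x + b * w x) = a\<^sup>2 * var u + 2 * a * b * (\<integral>x. u x * w x \<partial>M) + b\<^sup>2 * var w"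
proof -
  have "(\<lambda>x. (a * u x + b * w x)\<^sup>2) = (\<lambda>x. (a\<^sup>2 * (u x)\<^sup>2 + 2 * a * b * (u x * w x)) + b\<^sup>2 * (w x)\<^sup>2)"
    by (auto simp: power2_eq_square algebra_simps)
  then show ?thesis
    using measurable_linear_square_integrable[OF u] measurable_linear_square_integrable[OF w]
      measurable_linear_mult_integrable[OF u w] by simp
qed

lemma cm_vec_integrable:
  assumes w: "measurable_linear M w" shows "integrable M (\<lambda>x. w x *\<^sub>R x)"
proof (rule Bochner_Integration.integrable_bound)
  show "integrable M (\<lambda>x. (w x)\<^sup>2 + (norm x)\<^sup>2)"
    using measurable_linear_square_integrable[OF w] integrable_norm_square by simp
  note [measurable] = measurable_linear_measurable[OF w]
  have [measurable]: "(\<lambda>x. x) \<in> M \<rightarrow>\<^sub>M borel" by (rule borel_measurable_M) simp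
  show "(\<lambda>x. w x *\<^sub>R x) \<in> borel_measurable M" by measurable
  show "AE x in M. norm (w x *\<^sub>R x) \<le> norm ((w x)\<^sup>2 + (norm x)\<^sup>2)"
  proof (rule AE_I2)
    fix x
    have "2 * (\<bar>w x\<bar> * norm x) \<le> (w x)\<^sup>2 + (norm x)\<^sup>2"
      using sum_squares_bound[of "\<bar>w x\<bar>" "norm x"] by (simp add: mult.assoc)
    moreover have "0 \<le> \<bar>w x\<bar> * norm x" by simp
    ultimately have "\<bar>w x\<bar> * norm x \<le> (w x)\<^sup>2 + (norm x)\<^sup>2" by linarith
    then show "norm (w x *\<^sub>R x) \<le> norm ((w x)\<^sup>2 + (norm x)\<^sup>2)" by simp
  qed
qed

lemma functional_cm_vec:
  assumes "measurable_linear M w" "bounded_linear f"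
  shows "f (cm_vec w) = (\<integral>x. f x * w x \<partial>M)"
proof -
  have "f (cm_vec w) = (\<integral>x. f (w x *\<^sub>R x) \<partial>M)"
    unfolding cm_vec_def by (rule integral_bounded_linear[OF assms(2) cm_vec_integrable[OF assms(1)], symmetric])
  then show ?thesis
    by (simp add: linear_cmul[OF bounded_linear.linear[OF assms(2)]] mult.commute)
qed

lemma cm_vec_scale: "cm_vec (\<lambda>x. c * w x) = c *\<^sub>R cm_vec w"
  unfolding cm_vec_def by (simp add: scaleR_scaleR[symmetric] del: scaleR_scaleR)

text \<open>The measure splits as the independent sum of \<open>x - w x h\<close> and the Gaussian multiple
  \<open>w x\<close> of \<open>h = E (w x) x\<close>, because the two are uncorrelated. Translation by \<open>h\<close> then only
  moves the one-dimensional factor.\<close>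

lemma cameron_martin_split:
  assumes w: "measurable_linear M w" and v: "var w = 1"
  shows "distr M (borel \<Otimes>\<^sub>M borel) (\<lambda>x. (x - w x *\<^sub>R cm_vec w, w x))
       = distr M borel (\<lambda>x. x - w x *\<^sub>R cm_vec w) \<Otimes>\<^sub>M std_normal_distribution"
    (is "?L = ?R")
proof (rule measure_eqI_functionals)
  define h where "h = cm_vec w"
  have [measurable]: "w \<in> borel_measurable M" by (rule measurable_linear_measurable[OF w])
  have idm [measurable]: "(\<lambda>x. x) \<in> M \<rightarrow>\<^sub>M borel" by (rule borel_measurable_M) simp
  have ps: "prob_space (distr M borel (\<lambda>x. x - w x *\<^sub>R cm_vec w))"
    by (rule prob_space_distr) measurable
  interpret A: prob_space "distr M borel (\<lambda>x. x - w x *\<^sub>R cm_vec w)" by (rule ps)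
  interpret B: prob_space std_normal_distribution by (rule prob_space_std_normal)
  interpret P: pair_prob_space "distr M borel (\<lambda>x. x - w x *\<^sub>R cm_vec w)" std_normal_distribution ..
  show "prob_space ?L" by (rule prob_space_distr) measurable
  show "prob_space ?R" by (rule P.prob_space_axioms)
  show "sets ?L = sets borel" by (simp add: borel_prod)
  show sR: "sets ?R = sets borel" by (rule borel_prod_sets) simp_all
  fix F :: "'a \<times> real \<Rightarrow> real" assume F: "bounded_linear F"
  define f where "f = (\<lambda>x. F (x, 0))"
  define g where "g = (\<lambda>y. F (0, y))"
  note fg = bounded_linear_prod_split[OF F, folded f_def g_def]
  have fg3: "F z = f (fst z) + g (snd z)" for z using fg(3)[of z] by (simp add: f_def g_def)
  define \<tau> where "\<tau> = g 1"
  have g: "g y = \<tau> * y" for y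
    using linear_cmul[OF bounded_linear.linear[OF fg(2)], of y 1] by (simp add: \<tau>_def)
  have fl: "measurable_linear M f" by (rule measurable_linear_functional[OF fg(1)])
  have fh: "(\<integral>x. f x * w x \<partial>M) = f h" using functional_cm_vec[OF w fg(1)] by (simp add: h_def)
  have fY: "f (x - w x *\<^sub>R h) = f x - f h * w x" for x
    using fg(1) by (simp add: linear_diff linear_cmul bounded_linear.linear)
  have [measurable]: "f \<in> borel_measurable borel" "F \<in> borel_measurable borel"
    by (rule bounded_linear_borel[OF fg(1)], rule bounded_linear_borel[OF F])
  have "distr ?L borel F = distr M borel (F \<circ> (\<lambda>x. (x - w x *\<^sub>R h, w x)))"
    unfolding h_def by (rule distr_distr) (simp_all add: borel_prod)
  also have "F \<circ> (\<lambda>x. (x - w x *\<^sub>R h, w x)) = (\<lambda>x. 1 * f x + (\<tau> - f h) * w x)"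
    by (rule ext) (simp add: fg3 fY g algebra_simps)
  also have "distr M borel \<dots> = normal_law (var (\<lambda>x. 1 * f x + (\<tau> - f h) * w x))"
    by (rule gaussian_withD(3)[OF measurable_linear_gaussian[OF measurable_linear_combine[OF fl w]]])
  also have "var (\<lambda>x. 1 * f x + (\<tau> - f h) * w x) = (var f - (f h)\<^sup>2) + \<tau>\<^sup>2"
    unfolding var_combine[OF fl w] fh v by (simp add: power2_eq_square algebra_simps)
  finally have L: "distr ?L borel F = normal_law ((var f - (f h)\<^sup>2) + \<tau>\<^sup>2)" .
  have G1: "gaussian_with (distr M borel (\<lambda>x. x - w x *\<^sub>R h)) f (var f - (f h)\<^sup>2)"
  proof -
    have "distr (distr M borel (\<lambda>x. x - w x *\<^sub>R h)) borel f = distr M borel (f \<circ> (\<lambda>x. x - w x *\<^sub>R h))"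
      by (rule distr_distr) simp_all
    also have "f \<circ> (\<lambda>x. x - w x *\<^sub>R h) = (\<lambda>x. 1 * f x + (- f h) * w x)" by (rule ext) (simp add: fY)
    finally have d: "distr (distr M borel (\<lambda>x. x - w x *\<^sub>R h)) borel f = distr M borel (\<lambda>x. 1 * f x + (- f h) * w x)" .
    have vv: "var (\<lambda>x. 1 * f x + (- f h) * w x) = var f - (f h)\<^sup>2"
      unfolding var_combine[OF fl w] fh v by (simp add: power2_eq_square)
    show ?thesis
      using gaussian_withD[OF measurable_linear_gaussian[OF measurable_linear_combine[OF fl w, of 1 "- f h"]]] d
      unfolding vv by (simp add: gaussian_with_def)
  qed
  have "distr std_normal_distribution borel (\<lambda>x. x) = normal_law 1"
    unfolding normal_law_def by (rule distr_cong) simp_all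
  then have "gaussian_with std_normal_distribution (\<lambda>x. x) 1" by (simp add: gaussian_with_def)
  from gaussian_with_scale[OF prob_space_std_normal this, of \<tau>]
  have "gaussian_with std_normal_distribution (\<lambda>y. \<tau> * y) (\<tau>\<^sup>2)" by simp
  moreover have "g = (\<lambda>y. \<tau> * y)" using g by blast
  ultimately have G2: "gaussian_with std_normal_distribution g (\<tau>\<^sup>2)" by simp
  have "F = (\<lambda>z. f (fst z) + g (snd z))" using fg3 by blast
  then have "distr ?R borel F = normal_law ((var f - (f h)\<^sup>2) + \<tau>\<^sup>2)"
    using gaussian_withD(3)[OF gaussian_with_pair_sum[OF ps[folded h_def] prob_space_std_normal G1 G2]] by (simp add: h_def)
  then show "distr ?L borel F = distr ?R borel F" using L by simp
qed

theorem cameron_martin: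
  assumes w: "measurable_linear M w" and v: "var w = 1"
    and g [measurable]: "g \<in> borel_measurable borel"
  shows "(\<integral>\<^sup>+x. g (x + cm_vec w) \<partial>M) = (\<integral>\<^sup>+x. g x * ennreal (exp (w x - 1/2)) \<partial>M)"
proof -
  define h where "h = cm_vec w"
  define A where "A = distr M borel (\<lambda>x. x - w x *\<^sub>R h)"
  have [measurable]: "w \<in> borel_measurable M" by (rule measurable_linear_measurable[OF w])
  have idm [measurable]: "(\<lambda>x. x) \<in> M \<rightarrow>\<^sub>M borel" by (rule borel_measurable_M) simp
  have sA [measurable_cong]: "sets A = sets borel" by (simp add: A_def)
  interpret A: prob_space A unfolding A_def by (rule prob_space_distr) measurable
  interpret B: prob_space std_normal_distribution by (rule prob_space_std_normal)
  interpret P: pair_prob_space A std_normal_distribution ..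
  have split: "(\<integral>\<^sup>+x. G (x - w x *\<^sub>R h, w x) \<partial>M) = (\<integral>\<^sup>+y. \<integral>\<^sup>+z. G (y, z) \<partial>std_normal_distribution \<partial>A)"
    if [measurable]: "G \<in> borel_measurable (borel \<Otimes>\<^sub>M borel)" for G :: "'a \<times> real \<Rightarrow> ennreal"
  proof -
    have "(\<integral>\<^sup>+x. G (x - w x *\<^sub>R h, w x) \<partial>M)
        = (\<integral>\<^sup>+p. G p \<partial>distr M (borel \<Otimes>\<^sub>M borel) (\<lambda>x. (x - w x *\<^sub>R h, w x)))"
      by (subst nn_integral_distr) simp_all
    also have "\<dots> = (\<integral>\<^sup>+p. G p \<partial>(A \<Otimes>\<^sub>M std_normal_distribution))"
      using cameron_martin_split[OF w v] by (simp add: h_def A_def)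
    also have "\<dots> = (\<integral>\<^sup>+y. \<integral>\<^sup>+z. G (y, z) \<partial>std_normal_distribution \<partial>A)"
      by (rule B.nn_integral_fst[symmetric]) simp
    finally show ?thesis .
  qed
  have "(\<integral>\<^sup>+x. g (x + h) \<partial>M) = (\<integral>\<^sup>+x. (\<lambda>(y, z). g (y + (z + 1) *\<^sub>R h)) (x - w x *\<^sub>R h, w x) \<partial>M)"
    by (simp add: algebra_simps)
  also have "\<dots> = (\<integral>\<^sup>+y. \<integral>\<^sup>+z. g (y + (z + 1) *\<^sub>R h) \<partial>std_normal_distribution \<partial>A)"
    by (subst split) simp_all
  also have "\<dots> = (\<integral>\<^sup>+y. \<integral>\<^sup>+z. g (y + z *\<^sub>R h) * ennreal (exp (z - 1/2)) \<partial>std_normal_distribution \<partial>A)"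
  proof (rule nn_integral_cong)
    fix y
    show "(\<integral>\<^sup>+z. g (y + (z + 1) *\<^sub>R h) \<partial>std_normal_distribution)
        = (\<integral>\<^sup>+z. g (y + z *\<^sub>R h) * ennreal (exp (z - 1/2)) \<partial>std_normal_distribution)"
      using nn_integral_std_normal_shift[of "\<lambda>z. g (y + z *\<^sub>R h)" 1] by simp
  qed
  also have "\<dots> = (\<integral>\<^sup>+x. (\<lambda>(y, z). g (y + z *\<^sub>R h) * ennreal (exp (z - 1/2))) (x - w x *\<^sub>R h, w x) \<partial>M)"
    by (subst split) simp_all
  also have "\<dots> = (\<integral>\<^sup>+x. g x * ennreal (exp (w x - 1/2)) \<partial>M)" by simp
  finally show ?thesis by (simp add: h_def)
qed

text \<open>By the Cameron--Martin formula \<open>x + cm_vec w\<close> lies in \<open>F\<close> for almost every \<open>x\<close>, and so does \<open>x\<close>.\<close>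

lemma full_subspace_cm_vec_unit:
  assumes w: "measurable_linear M w" and v: "var w = 1" and F: "full_subspace M F"
  shows "cm_vec w \<in> F"
proof -
  have [measurable]: "F \<in> sets borel" and AF: "AE x in M. x \<in> F" using F by (auto simp: full_subspace_def)
  have [measurable]: "w \<in> borel_measurable M" by (rule measurable_linear_measurable[OF w])
  have idm [measurable]: "(\<lambda>x. x) \<in> M \<rightarrow>\<^sub>M borel" by (rule borel_measurable_M) simp
  have "(\<integral>\<^sup>+x. indicator (- F) (x + cm_vec w) \<partial>M) = (\<integral>\<^sup>+x. indicator (- F) x * ennreal (exp (w x - 1/2)) \<partial>M)"
    by (rule cameron_martin[OF w v]) measurable
  also have "\<dots> = (\<integral>\<^sup>+x. 0 \<partial>M)" by (rule nn_integral_cong_AE) (use AF in auto)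
  finally have "(\<integral>\<^sup>+x. indicator (- F) (x + cm_vec w) \<partial>M) = 0" by simp
  then have "AE x in M. indicator (- F) (x + cm_vec w) = (0::ennreal)"
    by (subst (asm) nn_integral_0_iff_AE) measurable
  then have 1: "AE x in M. x + cm_vec w \<in> F" by eventually_elim (auto simp: indicator_def split: if_splits)
  have "\<exists>x. x \<in> F \<and> x + cm_vec w \<in> F"
  proof (rule ccontr)
    assume "\<not> ?thesis"
    then have none: "\<not> (x \<in> F \<and> x + cm_vec w \<in> F)" for x by blast
    from AF 1 have "AE x in M. False" by eventually_elim (use none in blast)
    then show False by simp
  qed
  then obtain x where "x \<in> F" "x + cm_vec w \<in> F" by blast
  then have "(x + cm_vec w) - x \<in> F" using F unfolding full_subspace_def by (intro subspace_diff) auto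
  then show "cm_vec w \<in> F" by simp
qed

lemma var_zero_cm_vec:
  assumes w: "measurable_linear M w" and v: "var w = 0"
  shows "AE x in M. w x = 0" "cm_vec w = 0"
proof -
  have [measurable]: "w \<in> borel_measurable M" by (rule measurable_linear_measurable[OF w])
  have idm [measurable]: "(\<lambda>x. x) \<in> M \<rightarrow>\<^sub>M borel" by (rule borel_measurable_M) simp
  show 1: "AE x in M. w x = 0"
    using integral_nonneg_eq_0_iff_AE[OF measurable_linear_square_integrable[OF w]] v by simp
  have "cm_vec w = (\<integral>x. 0 \<partial>M)" unfolding cm_vec_def
    by (rule integral_cong_AE) (use 1 in auto)
  then show "cm_vec w = 0" by simp
qed

lemma var_scale: "var (\<lambda>x. c * w x) = c\<^sup>2 * var w"
  by (simp add: power_mult_distrib)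

lemma measurable_linear_normalize:
  assumes w: "measurable_linear M w" and v: "var w \<noteq> 0"
  obtains u where "measurable_linear M u" "var u = 1" "w = (\<lambda>x. sqrt (var w) * u x)"
    "cm_vec w = sqrt (var w) *\<^sub>R cm_vec u"
proof
  have "var w > 0" using v by (simp add: less_le)
  define u where "u = (\<lambda>x. (1 / sqrt (var w)) * w x)"
  show "measurable_linear M (\<lambda>x. (1 / sqrt (var w)) * w x)" by (rule measurable_linear_scale[OF w])
  show "var (\<lambda>x. (1 / sqrt (var w)) * w x) = 1"
    unfolding var_scale using \<open>var w > 0\<close> by (simp add: power_divide)
  show "w = (\<lambda>x. sqrt (var w) * ((1 / sqrt (var w)) * w x))" using \<open>var w > 0\<close> by auto
  show "cm_vec w = sqrt (var w) *\<^sub>R cm_vec (\<lambda>x. (1 / sqrt (var w)) * w x)"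
    unfolding cm_vec_scale using \<open>var w > 0\<close> by simp
qed

lemma full_subspace_cm_vec:
  assumes w: "measurable_linear M w" and F: "full_subspace M F"
  shows "cm_vec w \<in> F"
proof (cases "var w = 0")
  case True
  then show ?thesis using var_zero_cm_vec[OF w] F by (simp add: full_subspace_def subspace_0)
next
  case False
  obtain u where u: "measurable_linear M u" "var u = 1" "cm_vec w = sqrt (var w) *\<^sub>R cm_vec u"
    using measurable_linear_normalize[OF w False] by blast
  show ?thesis using full_subspace_cm_vec_unit[OF u(1,2) F] u(3) F
    by (simp add: full_subspace_def subspace_scale)
qed

text \<open>Both sides are read off from the exponential moment of \<open>g\<close> under the measure translated by
  \<open>cm_vec w\<close>: from the linearity of \<open>g\<close>, and from the Cameron--Martin density.\<close>

theorem measurable_linear_cm_vec: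
  assumes g: "measurable_linear M g" and w: "measurable_linear M w"
  shows "g (cm_vec w) = (\<integral>x. g x * w x \<partial>M)"
proof -
  obtain F where F: "full_subspace M F" "linear_on_subspace F g"
    using g unfolding measurable_linear_def by blast
  have [measurable]: "g \<in> borel_measurable borel" using g by (simp add: measurable_linear_def)
  have gM [measurable]: "g \<in> borel_measurable M" by (rule borel_measurable_M) simp
  have AF: "AE x in M. x \<in> F" using F by (simp add: full_subspace_def)
  have unit: "g (cm_vec u) = (\<integral>x. g x * u x \<partial>M)" if u: "measurable_linear M u" "var u = 1" for u
  proof -
    have hF: "cm_vec u \<in> F" by (rule full_subspace_cm_vec[OF u(1) F(1)])
    have [measurable]: "u \<in> borel_measurable M" by (rule measurable_linear_measurable[OF u(1)])
    have "ennreal (exp (g (cm_vec u)) * exp (var g / 2)) = ennreal (exp (g (cm_vec u))) * (\<integral>\<^sup>+x. ennreal (exp (1 * g x)) \<partial>M)"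
      using gaussian_with_mgf[OF measurable_linear_gaussian[OF g], of 1] by (simp add: ennreal_mult)
    also have "\<dots> = (\<integral>\<^sup>+x. ennreal (exp (g (cm_vec u))) * ennreal (exp (1 * g x)) \<partial>M)"
      by (rule nn_integral_cmult[symmetric]) measurable
    also have "\<dots> = (\<integral>\<^sup>+x. ennreal (exp (g (x + cm_vec u))) \<partial>M)"
    proof (rule nn_integral_cong_AE)
      show "AE x in M. ennreal (exp (g (cm_vec u))) * ennreal (exp (1 * g x)) = ennreal (exp (g (x + cm_vec u)))"
        using AF
      proof eventually_elim
        case (elim x)
        then have "g (x + cm_vec u) = g x + g (cm_vec u)" using F(2) hF by (simp add: linear_on_subspace_def)
        then show ?case by (simp add: ennreal_mult[symmetric] exp_add[symmetric] add.commute)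
      qed
    qed
    also have "\<dots> = (\<integral>\<^sup>+x. ennreal (exp (g x)) * ennreal (exp (u x - 1/2)) \<partial>M)"
      by (rule cameron_martin[OF u]) measurable
    also have "\<dots> = (\<integral>\<^sup>+x. ennreal (exp (- 1/2)) * ennreal (exp (1 * (1 * g x + 1 * u x))) \<partial>M)"
      by (rule nn_integral_cong) (simp add: ennreal_mult[symmetric] exp_add[symmetric] algebra_simps)
    also have "\<dots> = ennreal (exp (- 1/2)) * (\<integral>\<^sup>+x. ennreal (exp (1 * (1 * g x + 1 * u x))) \<partial>M)"
      by (rule nn_integral_cmult) measurable
    also have "(\<integral>\<^sup>+x. ennreal (exp (1 * (1 * g x + 1 * u x))) \<partial>M) = ennreal (exp (var (\<lambda>x. 1 * g x + 1 * u x) * 1\<^sup>2 / 2))"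
      by (rule gaussian_with_mgf[OF measurable_linear_gaussian[OF measurable_linear_combine[OF g u(1)]]])
    also have "var (\<lambda>x. 1 * g x + 1 * u x) = var g + 2 * (\<integral>x. g x * u x \<partial>M) + 1"
      unfolding var_combine[OF g u(1)] u(2) by simp
    finally have "exp (g (cm_vec u)) * exp (var g / 2) = exp (- 1/2) * exp ((var g + 2 * (\<integral>x. g x * u x \<partial>M) + 1) * 1\<^sup>2 / 2)"
      by (simp add: ennreal_mult[symmetric])
    then have "g (cm_vec u) + var g / 2 = - 1/2 + (var g + 2 * (\<integral>x. g x * u x \<partial>M) + 1) * 1\<^sup>2 / 2"
      unfolding exp_add[symmetric] by simp
    then show ?thesis by (simp add: field_simps)
  qed
  show ?thesis
  proof (cases "var w = 0")
    case True
    note wz = var_zero_cm_vec[OF w True]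
    have [measurable]: "w \<in> borel_measurable M" by (rule measurable_linear_measurable[OF w])
    have "0 \<in> F" using F by (simp add: full_subspace_def subspace_0)
    then have "g (0 *\<^sub>R 0) = 0 *\<^sub>R g 0" using F(2) unfolding linear_on_subspace_def by blast
    moreover have "(\<integral>x. g x * w x \<partial>M) = (\<integral>x. 0 \<partial>M)"
      by (rule integral_cong_AE) (use wz in auto)
    ultimately show ?thesis using wz by simp
  next
    case False
    obtain u where u: "measurable_linear M u" "var u = 1" "w = (\<lambda>x. sqrt (var w) * u x)" "cm_vec w = sqrt (var w) *\<^sub>R cm_vec u"
      using measurable_linear_normalize[OF w False] by blast
    have "g (cm_vec w) = sqrt (var w) * g (cm_vec u)"
      using F(2) full_subspace_cm_vec[OF u(1) F(1)] u(4) by (simp add: linear_on_subspace_def)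
    also have "\<dots> = sqrt (var w) * (\<integral>x. g x * u x \<partial>M)" using unit[OF u(1,2)] by simp
    also have "\<dots> = (\<integral>x. sqrt (var w) * (g x * u x) \<partial>M)" by simp
    also have "\<dots> = (\<integral>x. g x * (sqrt (var w) * u x) \<partial>M)" by (simp add: ac_simps)
    also have "\<dots> = (\<integral>x. g x * w x \<partial>M)" using u(3) by metis
    finally show ?thesis .
  qed
qed

text \<open>For \<open>var w = 1\<close>, the Cameron--Martin density shows that \<open>x\<close> and \<open>x + cm_vec w\<close> both lie in \<open>K\<close> for some \<open>x\<close>;
  half of their difference is in \<open>K\<close> by convexity and symmetry. Thus the unit ball of the
  Cameron--Martin space is contained in \<open>2 K\<close>, which for compact \<open>K\<close> is the compactness of the
  embedding.\<close>

lemma cm_vec_in_double: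
  assumes K: "closed K" "convex K" "symmetric_set K" and big: "measure M K \<ge> 9/10"
    and w: "measurable_linear M w" and v: "var w \<le> 1"
  shows "cm_vec w /\<^sub>R 2 \<in> K"
proof (cases "var w = 0")
  case True
  have "K \<noteq> {}" using big by auto
  then show ?thesis using var_zero_cm_vec[OF w True] convex_symmetric_zero[OF K(2,3)] by simp
next
  case False
  obtain u where u: "measurable_linear M u" "var u = 1" "cm_vec w = sqrt (var w) *\<^sub>R cm_vec u"
    using measurable_linear_normalize[OF w False] by blast
  have [measurable]: "K \<in> sets borel" using K by simp
  have [measurable]: "u \<in> borel_measurable M" by (rule measurable_linear_measurable[OF u(1)])
  have idm [measurable]: "(\<lambda>x. x) \<in> M \<rightarrow>\<^sub>M borel" by (rule borel_measurable_M) simp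
  define h where "h = cm_vec u"
  have e3: "exp 1 \<le> (3::real)" by (rule exp_le)
  have "emeasure M {x. x + h \<notin> K} = (\<integral>\<^sup>+x. indicator (- K) (x + h) \<partial>M)"
  proof -
    have "{x \<in> space M. x + h \<notin> K} \<in> sets M" by measurable
    then have "emeasure M {x. x + h \<notin> K} = (\<integral>\<^sup>+x. indicator {x. x + h \<notin> K} x \<partial>M)" by simp
    also have "\<dots> = (\<integral>\<^sup>+x. indicator (- K) (x + h) \<partial>M)" by (rule nn_integral_cong) (simp add: indicator_def)
    finally show ?thesis .
  qed
  also have "\<dots> = (\<integral>\<^sup>+x. indicator (- K) x * ennreal (exp (u x - 1/2)) \<partial>M)"
    unfolding h_def by (rule cameron_martin[OF u(1,2)]) measurable
  also have "\<dots> \<le> (\<integral>\<^sup>+x. ennreal (exp (- 1) / 10) * ennreal (exp (2 * u x)) + ennreal (5/2) * indicator (- K) x \<partial>M)"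
  proof (rule nn_integral_mono)
    fix x
    \<comment> \<open>The weighted inequality \<open>2 a b \<le> a\<^sup>2/5 + 5 b\<^sup>2\<close>, where \<open>a\<close> is the density and \<open>b\<close> the indicator.\<close>
    have "0 \<le> (exp (u x - 1/2) - 5)\<^sup>2" by simp
    also have "\<dots> = exp (u x - 1/2) * exp (u x - 1/2) - 10 * exp (u x - 1/2) + 25" by (simp add: power2_eq_square algebra_simps)
    also have "exp (u x - 1/2) * exp (u x - 1/2) = exp (- 1) * exp (2 * u x)" by (simp add: exp_add[symmetric])
    finally have "exp (u x - 1/2) \<le> exp (- 1) / 10 * exp (2 * u x) + 5/2" by (simp add: field_simps)
    then have "ennreal (exp (u x - 1/2)) \<le> ennreal (exp (- 1) / 10) * ennreal (exp (2 * u x)) + ennreal (5/2)"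
      by (subst ennreal_mult[symmetric]) (simp_all add: ennreal_plus[symmetric] ennreal_leI del: ennreal_plus)
    then show "indicator (- K) x * ennreal (exp (u x - 1/2)) \<le> ennreal (exp (- 1) / 10) * ennreal (exp (2 * u x)) + ennreal (5/2) * indicator (- K) x"
      by (auto simp: indicator_def)
  qed
  also have "\<dots> = ennreal (exp (- 1) / 10) * (\<integral>\<^sup>+x. ennreal (exp (2 * u x)) \<partial>M) + ennreal (5/2) * emeasure M (- K)"
    by (subst nn_integral_add) (auto simp: nn_integral_cmult)
  also have "(\<integral>\<^sup>+x. ennreal (exp (2 * u x)) \<partial>M) = ennreal (exp (1 * 2\<^sup>2 / 2))"
    using gaussian_with_mgf[OF measurable_linear_gaussian[OF u(1)], of 2] u(2) by simp
  also have "emeasure M (- K) = ennreal (1 - measure M K)"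
  proof -
    have KS: "K \<in> events" using K sets_M by simp
    have "- K = space M - K" by auto
    then show ?thesis using prob_compl[OF KS] by (simp add: emeasure_eq_measure)
  qed
  also have "ennreal (exp (- 1) / 10) * ennreal (exp (1 * 2\<^sup>2 / 2)) + ennreal (5/2) * ennreal (1 - measure M K)
      = ennreal (exp 1 / 10 + 5/2 * (1 - measure M K))"
    by (simp add: ennreal_mult[symmetric] ennreal_plus[symmetric] exp_add[symmetric] del: ennreal_plus)
  finally have "ennreal (measure M {x. x + h \<notin> K}) \<le> ennreal (exp 1 / 10 + 5/2 * (1 - measure M K))"
    by (simp only: emeasure_eq_measure)
  moreover have "0 \<le> exp 1 / 10 + 5/2 * (1 - measure M K)" by (simp add: add_nonneg_nonneg)
  ultimately have m1: "measure M {x. x + h \<notin> K} \<le> exp 1 / 10 + 5/2 * (1 - measure M K)"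
    by (simp only: ennreal_le_iff)
  have "\<exists>x. x \<in> K \<and> x + h \<in> K"
  proof (rule ccontr)
    assume "\<not> ?thesis"
    then have sub: "K \<subseteq> {x. x + h \<notin> K}" by auto
    have "{x \<in> space M. x + h \<notin> K} \<in> sets M" by measurable
    then have "measure M K \<le> measure M {x. x + h \<notin> K}" using sub by (intro finite_measure_mono) auto
    then have "measure M K \<le> exp 1 / 10 + 5/2 * (1 - measure M K)" using m1 by (rule order_trans)
    moreover have "exp 1 / 10 \<le> (3/10 :: real)" using e3 by simp
    moreover have "5/2 * (1 - measure M K) \<le> 1/4" using big by simp
    ultimately have "measure M K \<le> 3/10 + 1/4" by linarith
    then show False using big by simp
  qed
  then obtain x where x: "x \<in> K" "x + h \<in> K" by blast
  have "- x \<in> K" using x K by (simp add: symmetric_set_def)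
  then have "(1/2) *\<^sub>R (x + h) + (1/2) *\<^sub>R (- x) \<in> K" using x K(2) by (intro convexD) auto
  then have "(1/2) *\<^sub>R h \<in> K" by (simp add: algebra_simps)
  then have "sqrt (var w) *\<^sub>R ((1/2) *\<^sub>R h) \<in> K"
    by (rule convex_symmetric_scale[OF K(2,3)]) (use v in simp)
  moreover have "cm_vec w /\<^sub>R 2 = sqrt (var w) *\<^sub>R ((1/2) *\<^sub>R h)" by (subst u(3)) (simp add: h_def)
  ultimately show ?thesis by simp
qed

end

section \<open>Hilbert space preliminaries\<close>

lemma linear_le_quadratic_imp_zero:
  fixes a b :: real
  assumes "\<And>t. t * a \<le> t\<^sup>2 * b"
  shows "a = 0"
proof (rule ccontr)
  assume a: "a \<noteq> 0"
  define t where "t = a / (\<bar>b\<bar> + 1)"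
  have pos: "\<bar>b\<bar> + 1 > 0" by simp
  have "t\<^sup>2 * b \<le> t\<^sup>2 * \<bar>b\<bar>" by (rule mult_left_mono) simp_all
  then have "t * a \<le> t\<^sup>2 * \<bar>b\<bar>" using assms[of t] by linarith
  moreover have "t * a = t\<^sup>2 * (\<bar>b\<bar> + 1)" using pos by (simp add: t_def power2_eq_square)
  ultimately have "t\<^sup>2 \<le> 0" by (simp add: algebra_simps)
  then show False using a pos by (simp add: t_def)
qed

lemma norm_add_scaleR_square:
  fixes h y :: "'h::real_inner"
  shows "(norm (h + t *\<^sub>R y))\<^sup>2 = (norm h)\<^sup>2 + 2 * t * inner h y + t\<^sup>2 * (norm y)\<^sup>2"
  unfolding power2_norm_eq_inner
  by (simp add: inner_add_left inner_add_right inner_commute power2_eq_square algebra_simps)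

lemma min_norm_orthogonal:
  fixes p y :: "'h::real_inner"
  assumes "\<And>t. norm p \<le> norm (p + t *\<^sub>R y)"
  shows "inner p y = 0"
proof -
  have "t * (- 2 * inner p y) \<le> t\<^sup>2 * (norm y)\<^sup>2" for t
  proof -
    have "(norm p)\<^sup>2 \<le> (norm (p + t *\<^sub>R y))\<^sup>2" using assms[of t] by (intro power_mono) auto
    then show ?thesis unfolding norm_add_scaleR_square by simp
  qed
  then have "- 2 * inner p y = 0" by (rule linear_le_quadratic_imp_zero)
  then show ?thesis by simp
qed

text \<open>A minimizing sequence is Cauchy by the parallelogram law.\<close>

lemma min_norm_exists:
  fixes C :: "'h::{real_inner, complete_space} set"
  assumes C: "convex C" "C \<noteq> {}"
  obtains p where "p \<in> closure C" "\<And>c. c \<in> closure C \<Longrightarrow> norm p \<le> norm c"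
proof -
  define d where "d = (INF c\<in>C. norm c)"
  have bdd: "bdd_below (norm ` C)" by (rule bdd_belowI[of _ 0]) auto
  have d: "d \<le> norm c" if "c \<in> C" for c unfolding d_def by (rule cINF_lower[OF bdd that])
  have d0: "0 \<le> d" unfolding d_def using C(2) by (intro cINF_greatest) auto
  have "\<exists>c\<in>C. norm c < d + 1 / real (Suc n)" for n
  proof -
    have "(INF c\<in>C. norm c) < d + 1 / real (Suc n)" by (simp add: d_def)
    then show ?thesis using cINF_less_iff[OF C(2) bdd] by blast
  qed
  then obtain c where c: "\<And>n. c n \<in> C" "\<And>n. norm (c n) < d + 1 / real (Suc n)" by metis
  have near: "(norm (c m - c n))\<^sup>2 \<le> (8 * d + 4) / real (Suc N)" if "m \<ge> N" "n \<ge> N" for m n N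
  proof -
    define e where "e = 1 / real (Suc N)"
    have e: "0 \<le> e" "e \<le> 1" by (simp_all add: e_def)
    have le: "norm (c k) \<le> d + e" if "k \<ge> N" for k
    proof -
      have "1 / real (Suc k) \<le> e" unfolding e_def using that by (intro divide_left_mono) auto
      then show ?thesis using c(2)[of k] by simp
    qed
    have "(1/2) *\<^sub>R c m + (1/2) *\<^sub>R c n \<in> C" using C(1) c(1) by (intro convexD) auto
    from d[OF this] have "d\<^sup>2 \<le> (norm ((1/2) *\<^sub>R c m + (1/2) *\<^sub>R c n))\<^sup>2" using d0 by (intro power_mono)
    moreover have "(norm (c m - c n))\<^sup>2 = 2 * (norm (c m))\<^sup>2 + 2 * (norm (c n))\<^sup>2 - 4 * (norm ((1/2) *\<^sub>R c m + (1/2) *\<^sub>R c n))\<^sup>2"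
      by (simp add: power2_norm_eq_inner inner_diff_left inner_diff_right inner_add_left inner_add_right inner_commute algebra_simps)
    moreover have "(norm (c m))\<^sup>2 \<le> (d + e)\<^sup>2" "(norm (c n))\<^sup>2 \<le> (d + e)\<^sup>2"
      using le that by (auto intro!: power_mono)
    ultimately have "(norm (c m - c n))\<^sup>2 \<le> 4 * (d + e)\<^sup>2 - 4 * d\<^sup>2" by linarith
    also have "\<dots> = 8 * d * e + 4 * (e * e)" by (simp add: power2_eq_square algebra_simps)
    also have "\<dots> \<le> 8 * d * e + 4 * (e * 1)" using e by (intro add_left_mono mult_left_mono) auto
    finally show ?thesis by (simp add: e_def add_divide_distrib)
  qed
  have "Cauchy c"
  proof (rule CauchyI)
    fix r :: real assume r: "r > 0"
    obtain N :: nat where N: "(8 * d + 4) / r\<^sup>2 < real N" using reals_Archimedean2 by blast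
    have "norm (c m - c n) < r" if "m \<ge> N" "n \<ge> N" for m n
    proof -
      have "(8 * d + 4) / r\<^sup>2 < real (Suc N)" using N by simp
      then have "(8 * d + 4) / real (Suc N) < r\<^sup>2" using r by (simp add: field_simps)
      then have "(norm (c m - c n))\<^sup>2 < r\<^sup>2" using near[OF that] by simp
      then show ?thesis by (rule power2_less_imp_less) (use r in simp)
    qed
    then show "\<exists>M. \<forall>m\<ge>M. \<forall>n\<ge>M. norm (c m - c n) < r" by blast
  qed
  then obtain p where p: "c \<longlonglongrightarrow> p" using Cauchy_convergent_iff convergent_def by blast
  have "p \<in> closure C" using c(1) p closure_sequential by blast
  moreover have "norm p \<le> norm x" if x: "x \<in> closure C" for x
  proof -
    have "(\<lambda>n. norm (c n)) \<longlonglongrightarrow> norm p" using p by (rule tendsto_norm)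
    moreover have "(\<lambda>n. d + 1 / real (Suc n)) \<longlonglongrightarrow> d + 0"
      by (intro tendsto_add tendsto_const LIMSEQ_Suc lim_1_over_n)
    ultimately have "norm p \<le> d + 0"
      by (rule LIMSEQ_le) (use c(2) less_imp_le in blast)
    moreover have "d \<le> norm x"
    proof -
      obtain y where y: "\<And>n. y n \<in> C" "y \<longlonglongrightarrow> x" using x unfolding closure_sequential by blast
      show ?thesis by (rule LIMSEQ_le_const[OF tendsto_norm[OF y(2)]]) (use d y(1) in blast)
    qed
    ultimately show ?thesis by simp
  qed
  ultimately show ?thesis using that by blast
qed

theorem riesz_representation:
  fixes \<phi> :: "'h::{real_inner, complete_space} \<Rightarrow> real"
  assumes "bounded_linear \<phi>"
  obtains k where "\<And>x. \<phi> x = inner k x"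
proof (cases "\<forall>x. \<phi> x = 0")
  case True then show ?thesis using that[of 0] by simp
next
  case False
  interpret bounded_linear \<phi> by fact
  from False obtain x0 where x0: "\<phi> x0 \<noteq> 0" by blast
  define C where "C = {x. \<phi> x = 1}"
  have cl: "closed C"
    unfolding C_def by (intro closed_Collect_eq continuous_on_const linear_continuous_on assms)
  have "convex C" unfolding C_def convex_def by (auto simp: add scaleR)
  moreover have "C \<noteq> {}" unfolding C_def using x0 by (auto intro!: exI[of _ "x0 /\<^sub>R \<phi> x0"] simp: scaleR)
  ultimately obtain p where p: "p \<in> closure C" "\<And>c. c \<in> closure C \<Longrightarrow> norm p \<le> norm c"
    by (rule min_norm_exists) blast
  have p1: "\<phi> p = 1" using p(1) cl by (simp add: C_def)
  have orth: "inner p y = 0" if "\<phi> y = 0" for y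
  proof (rule min_norm_orthogonal)
    fix t
    have "p + t *\<^sub>R y \<in> closure C" using cl that p1 by (simp add: C_def add scaleR)
    then show "norm p \<le> norm (p + t *\<^sub>R y)" by (rule p(2))
  qed
  have "p \<noteq> 0" using p1 zero by auto
  show ?thesis
  proof (rule that[of "p /\<^sub>R (norm p)\<^sup>2"])
    fix x
    have "inner p (x - \<phi> x *\<^sub>R p) = 0" by (rule orth) (simp add: diff scaleR p1)
    then have "inner p x = \<phi> x * (norm p)\<^sup>2" by (simp add: inner_diff_right power2_norm_eq_inner)
    then show "\<phi> x = inner (p /\<^sub>R (norm p)\<^sup>2) x" using \<open>p \<noteq> 0\<close> by simp
  qed
qed

lemma dense_subspace:
  fixes L :: "'h::{real_inner, complete_space} set"
  assumes L: "subspace L" and orth: "\<And>p. (\<And>l. l \<in> L \<Longrightarrow> inner p l = 0) \<Longrightarrow> p = 0"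
  shows "closure L = UNIV"
proof -
  have "u \<in> closure L" for u
  proof -
    define C where "C = (+) u ` L"
    have "convex C" unfolding C_def by (intro convex_translation subspace_imp_convex L)
    moreover have "C \<noteq> {}" using L by (auto simp: C_def subspace_def)
    ultimately obtain p where p: "p \<in> closure C" "\<And>c. c \<in> closure C \<Longrightarrow> norm p \<le> norm c"
      by (rule min_norm_exists) blast
    obtain y where y: "\<And>n. y n \<in> C" "y \<longlonglongrightarrow> p" using p(1) closure_sequential by blast
    have "\<forall>n. \<exists>l. l \<in> L \<and> y n = u + l" using y(1) by (auto simp: C_def)
    then obtain l where l: "\<And>n. l n \<in> L" "\<And>n. y n = u + l n" by metis
    have "inner p z = 0" if z: "z \<in> L" for z
    proof (rule min_norm_orthogonal)
      fix t
      have "y n + t *\<^sub>R z \<in> C" for n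
      proof -
        have "l n + t *\<^sub>R z \<in> L" using l(1) z L by (intro subspace_add subspace_scale)
        moreover have "y n + t *\<^sub>R z = u + (l n + t *\<^sub>R z)" using l(2) by (simp add: add.assoc)
        ultimately show ?thesis unfolding C_def by blast
      qed
      moreover have "(\<lambda>n. y n + t *\<^sub>R z) \<longlonglongrightarrow> p + t *\<^sub>R z" using y(2) by (intro tendsto_intros)
      ultimately have "p + t *\<^sub>R z \<in> closure C"
        unfolding closure_sequential by (intro exI[of _ "\<lambda>n. y n + t *\<^sub>R z"] conjI allI)
      then show "norm p \<le> norm (p + t *\<^sub>R z)" by (rule p(2))
    qed
    then have "p = 0" by (rule orth)
    have "(\<lambda>n. u - y n) \<longlonglongrightarrow> u - p" using y(2) by (intro tendsto_intros)
    then have "(\<lambda>n. - l n) \<longlonglongrightarrow> u" using l(2) \<open>p = 0\<close> by simp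
    moreover have "- l n \<in> L" for n using l(1) L by (rule subspace_neg[rotated])
    ultimately show ?thesis
      unfolding closure_sequential by (intro exI[of _ "\<lambda>n. - l n"] conjI allI)
  qed
  then show ?thesis by blast
qed

text \<open>Uniqueness of the representing vector from norms alone: it recovers the inner product from
  \<open>norm_incl\<close> by perturbing \<open>h\<close> to first order in the direction \<open>y\<close>.\<close>

lemma extremal_functional_eq_inner:
  fixes h :: "'h::real_inner" and \<phi> :: "'h \<Rightarrow> real"
  assumes "linear \<phi>" "\<And>k. \<bar>\<phi> k\<bar> \<le> norm h * norm k" "\<phi> h = (norm h)\<^sup>2"
  shows "\<phi> y = inner h y"
proof (cases "h = 0")
  case True then show ?thesis using assms(2)[of y] by simp
next
  case False
  have "t * (2 * (norm h)\<^sup>2 * (\<phi> y - inner h y)) \<le> t\<^sup>2 * ((norm h)\<^sup>2 * (norm y)\<^sup>2)" for t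
  proof -
    have "(\<phi> (h + t *\<^sub>R y))\<^sup>2 \<le> (norm h * norm (h + t *\<^sub>R y))\<^sup>2"
      using assms(2)[of "h + t *\<^sub>R y"] by (metis abs_ge_zero power2_abs power_mono)
    also have "\<dots> = (norm h)\<^sup>2 * ((norm h)\<^sup>2 + 2 * t * inner h y + t\<^sup>2 * (norm y)\<^sup>2)"
      unfolding power_mult_distrib norm_add_scaleR_square ..
    finally have "((norm h)\<^sup>2 + t * \<phi> y)\<^sup>2 \<le> (norm h)\<^sup>2 * ((norm h)\<^sup>2 + 2 * t * inner h y + t\<^sup>2 * (norm y)\<^sup>2)"
      using assms(1,3) by (simp add: linear_add linear_cmul)
    moreover have "((norm h)\<^sup>2 + t * \<phi> y)\<^sup>2 = (norm h)\<^sup>2 * (norm h)\<^sup>2 + 2 * t * (norm h)\<^sup>2 * \<phi> y + (t * \<phi> y)\<^sup>2"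
      by (simp add: power2_sum power2_eq_square algebra_simps)
    moreover have "(norm h)\<^sup>2 * ((norm h)\<^sup>2 + 2 * t * inner h y + t\<^sup>2 * (norm y)\<^sup>2)
        = (norm h)\<^sup>2 * (norm h)\<^sup>2 + 2 * t * (norm h)\<^sup>2 * inner h y + t\<^sup>2 * ((norm h)\<^sup>2 * (norm y)\<^sup>2)"
      by (simp add: algebra_simps)
    moreover have "t * (2 * (norm h)\<^sup>2 * (\<phi> y - inner h y)) = 2 * t * (norm h)\<^sup>2 * \<phi> y - 2 * t * (norm h)\<^sup>2 * inner h y"
      by (simp add: algebra_simps)
    moreover have "(t * \<phi> y)\<^sup>2 \<ge> 0" by simp
    ultimately show ?thesis by linarith
  qed
  then have "2 * (norm h)\<^sup>2 * (\<phi> y - inner h y) = 0" by (rule linear_le_quadratic_imp_zero)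
  then show ?thesis using False by simp
qed

lemma adjoint_exists:
  fixes S :: "'h::{real_inner, complete_space} \<Rightarrow> 'h"
  assumes "bounded_linear S"
  shows "inner (S x) y = inner x (adjoint S y)"
proof -
  have "\<exists>k. \<forall>x. inner (S x) y = inner x k" for y
  proof -
    have "bounded_linear (\<lambda>x. inner (S x) y)"
      by (rule bounded_linear_compose[OF bounded_linear_inner_left assms])
    then obtain k where "\<And>x. inner (S x) y = inner k x" by (rule riesz_representation) blast
    then show ?thesis by (metis inner_commute)
  qed
  then obtain U where "\<forall>x y. inner (S x) y = inner x (U y)" by metis
  then have "\<forall>x y. inner (S x) y = inner x (adjoint S y)"
    unfolding adjoint_def by (rule someI[of "\<lambda>f'. \<forall>x y. inner (S x) y = inner x (f' y)"])
  then show ?thesis by blast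
qed

section \<open>The Cameron--Martin space and its functionals\<close>

lemma (in gaussian_space) covariance_le:
  assumes u: "measurable_linear M u" and w: "measurable_linear M w"
  shows "\<bar>\<integral>x. u x * w x \<partial>M\<bar> \<le> sqrt (var u) * sqrt (var w)"
proof -
  define c where "c = (\<integral>x. u x * w x \<partial>M)"
  have q: "0 \<le> a\<^sup>2 * var u + 2 * a * b * c + b\<^sup>2 * var w" for a b
    unfolding c_def var_combine[OF u w, of a b, symmetric] by simp
  have "c\<^sup>2 \<le> var u * var w"
  proof (cases "var w = 0")
    case True
    have "t * (- 2 * c) \<le> t\<^sup>2 * var u" for t using q[of t 1] True by (simp add: algebra_simps)
    then have "- 2 * c = 0" by (rule linear_le_quadratic_imp_zero)
    then show ?thesis by simp
  next
    case False
    then have pos: "var w > 0" by (simp add: less_le)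
    have "0 \<le> var w * (var u * var w - c\<^sup>2)"
      using q[of "var w" "- c"] by (simp add: power2_eq_square algebra_simps)
    then show ?thesis using pos by (simp add: zero_le_mult_iff)
  qed
  then show ?thesis unfolding c_def[symmetric] real_sqrt_mult[symmetric]
    by (intro real_le_rsqrt) simp
qed

context abstract_wiener_space begin

sublocale gaussian_space M
  using gaussian by unfold_locales

lemma incl_inject: "\<iota> h = \<iota> k \<longleftrightarrow> h = k"
  using bij_incl by (auto simp: bij_betw_def inj_on_def)

lemma incl_cm_space: "\<iota> h \<in> cm_space M"
  using bij_incl by (auto simp: bij_betw_def)

lemma cm_functionals_iff: "f \<in> cm_functionals M \<longleftrightarrow> bounded_linear f \<and> var f \<le> 1"
  by (simp add: cm_functionals_def)

lemma zero_in_cm_functionals: "(\<lambda>_. 0) \<in> cm_functionals M"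
  by (simp add: cm_functionals_iff)

lemma functional_le_norm:
  assumes "f \<in> cm_functionals M" shows "f (\<iota> k) \<le> norm k"
proof -
  have "bdd_above ((\<lambda>f. f (\<iota> k)) ` cm_functionals M)" using incl_cm_space[of k] by (simp add: cm_space_def)
  then show ?thesis unfolding norm_incl cm_norm_def using assms by (rule cSUP_upper[rotated])
qed

lemma norm_le_functionals:
  assumes "\<And>f. f \<in> cm_functionals M \<Longrightarrow> f (\<iota> k) \<le> c" shows "norm k \<le> c"
  unfolding norm_incl cm_norm_def using assms zero_in_cm_functionals by (intro cSUP_least) auto

lemma functional_incl_le:
  assumes f: "bounded_linear f" shows "\<bar>f (\<iota> k)\<bar> \<le> sqrt (var f) * norm k"
proof -
  have le: "f (\<iota> k) \<le> sqrt (var f) * norm k" if f: "bounded_linear f" for f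
  proof (rule field_le_epsilon)
    fix e :: real assume e: "e > 0"
    \<comment> \<open>The offset \<open>\<delta>\<close> covers functionals of variance \<open>0\<close>.\<close>
    define \<delta> where "\<delta> = e / (norm k + 1)"
    define c where "c = sqrt (var f) + \<delta>"
    have nk: "norm k + 1 > 0" by (simp add: add_nonneg_pos)
    have \<delta>: "\<delta> > 0" using e nk by (simp add: \<delta>_def)
    have c: "c > 0" using \<delta> by (simp add: c_def add_nonneg_pos)
    have "var f \<le> c\<^sup>2"
    proof -
      have "(sqrt (var f))\<^sup>2 \<le> c\<^sup>2" using \<delta> by (intro power_mono) (auto simp: c_def)
      then show ?thesis by simp
    qed
    then have "var (\<lambda>x. (1 / c) * f x) \<le> 1" unfolding var_scale using c by (simp add: power_divide divide_le_eq)
    moreover have "bounded_linear (\<lambda>x. (1 / c) * f x)"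
      using bounded_linear_compose[OF bounded_linear_mult_right f] .
    ultimately have "(1 / c) * f (\<iota> k) \<le> norm k"
      using functional_le_norm[of "\<lambda>x. (1 / c) * f x" k] by (simp add: cm_functionals_iff)
    then have "f (\<iota> k) \<le> c * norm k" using c by (simp add: field_simps)
    also have "\<dots> \<le> sqrt (var f) * norm k + e"
    proof -
      have "\<delta> * norm k \<le> \<delta> * (norm k + 1)" using \<delta> by (intro mult_left_mono) auto
      also have "\<dots> = e" using nk by (simp add: \<delta>_def)
      finally show ?thesis by (simp add: c_def algebra_simps)
    qed
    finally show "f (\<iota> k) \<le> sqrt (var f) * norm k + e" .
  qed
  have "- f (\<iota> k) \<le> sqrt (var (\<lambda>x. - f x)) * norm k"
    by (rule le[of "\<lambda>x. - f x"]) (rule bounded_linear_minus[OF f])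
  then show ?thesis using le[OF f] by simp
qed

lemma incl_bounded: "norm (\<iota> k) \<le> sqrt (\<integral>x. (norm x)\<^sup>2 \<partial>M) * norm k"
proof -
  obtain f :: "'a \<Rightarrow> real" where f: "bounded_linear f" "\<forall>x. \<bar>f x\<bar> \<le> norm x" "f (\<iota> k) = norm (\<iota> k)"
    by (rule norming_functional)
  have "var f \<le> (\<integral>x. (norm x)\<^sup>2 \<partial>M)"
  proof (rule integral_mono)
    show "integrable M (\<lambda>x. (f x)\<^sup>2)"
      by (rule measurable_linear_square_integrable[OF measurable_linear_functional[OF f(1)]])
    show "integrable M (\<lambda>x. (norm x)\<^sup>2)" by (rule integrable_norm_square)
    show "(f x)\<^sup>2 \<le> (norm x)\<^sup>2" for x using f(2) by (metis abs_ge_zero power2_abs power_mono)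
  qed
  then have "sqrt (var f) * norm k \<le> sqrt (\<integral>x. (norm x)\<^sup>2 \<partial>M) * norm k" by (intro mult_right_mono) auto
  then show ?thesis using functional_incl_le[OF f(1), of k] f(3) by simp
qed

lemma bounded_linear_incl: "bounded_linear \<iota>"
  using incl_bounded linear_incl
  by (intro bounded_linear_intro[where K = "sqrt (\<integral>x. (norm x)\<^sup>2 \<partial>M)"])
     (simp_all add: linear_add linear_cmul mult.commute)

lemma functionals_separate:
  assumes "\<And>f :: 'a \<Rightarrow> real. bounded_linear f \<Longrightarrow> f (\<iota> k) = 0" shows "k = 0"
proof (rule ccontr)
  assume "k \<noteq> 0"
  then have "\<iota> k \<noteq> 0" using incl_inject[of k 0] linear_0[OF linear_incl] by simp
  then obtain f :: "'a \<Rightarrow> real" where "bounded_linear f" "f (\<iota> k) \<noteq> 0" by (rule separating_functional)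
  then show False using assms by blast
qed

text \<open>The Cameron--Martin vector of a functional, as an element of the Hilbert space.\<close>

definition riesz :: "('a \<Rightarrow> real) \<Rightarrow> 'h" where
  "riesz w = inv \<iota> (cm_vec w)"

lemma incl_riesz:
  assumes w: "measurable_linear M w" shows "\<iota> (riesz w) = cm_vec w"
proof -
  have "f (cm_vec w) \<le> sqrt (var w)" if "f \<in> cm_functionals M" for f
  proof -
    have f: "bounded_linear f" "var f \<le> 1" using that by (auto simp: cm_functionals_iff)
    have "f (cm_vec w) \<le> sqrt (var f) * sqrt (var w)"
      using functional_cm_vec[OF w f(1)] covariance_le[OF measurable_linear_functional[OF f(1)] w] by simp
    also have "\<dots> \<le> 1 * sqrt (var w)" using f(2) by (intro mult_right_mono) auto
    finally show ?thesis by simp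
  qed
  then have "cm_vec w \<in> cm_space M" unfolding cm_space_def by (auto intro!: bdd_aboveI2[where M = "sqrt (var w)"])
  then have "cm_vec w \<in> range \<iota>" using bij_incl by (simp add: bij_betw_def)
  then show ?thesis unfolding riesz_def by (rule f_inv_into_f)
qed

lemma norm_riesz:
  assumes f: "bounded_linear f" shows "norm (riesz f) = sqrt (var f)"
proof (rule antisym)
  note fl = measurable_linear_functional[OF f]
  show "norm (riesz f) \<le> sqrt (var f)"
  proof (rule norm_le_functionals)
    fix g assume g: "g \<in> cm_functionals M"
    then have "g (\<iota> (riesz f)) \<le> sqrt (var g) * sqrt (var f)"
      using functional_cm_vec[OF fl, of g] covariance_le[OF _ fl, of g] measurable_linear_functional[of g]
      by (simp add: cm_functionals_iff incl_riesz[OF fl])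
    also have "\<dots> \<le> 1 * sqrt (var f)" using g by (intro mult_right_mono) (auto simp: cm_functionals_iff)
    finally show "g (\<iota> (riesz f)) \<le> sqrt (var f)" by simp
  qed
  have "var f = f (\<iota> (riesz f))"
    unfolding incl_riesz[OF fl] functional_cm_vec[OF fl f] by (simp add: power2_eq_square)
  also have "\<dots> \<le> sqrt (var f) * norm (riesz f)" using functional_incl_le[OF f, of "riesz f"] by simp
  finally have le: "sqrt (var f) * sqrt (var f) \<le> sqrt (var f) * norm (riesz f)" by simp
  show "sqrt (var f) \<le> norm (riesz f)"
  proof (cases "sqrt (var f) = 0")
    case False
    then have "sqrt (var f) > 0" by (simp add: less_le)
    with le show ?thesis by (simp only: mult_le_cancel_left_pos)
  qed simp
qed

lemma functional_eq_inner:
  assumes f: "bounded_linear f" shows "f (\<iota> k) = inner (riesz f) k"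
proof (rule extremal_functional_eq_inner[of "\<lambda>k. f (\<iota> k)"])
  note fl = measurable_linear_functional[OF f]
  show "linear (\<lambda>k. f (\<iota> k))"
    using linear_compose[OF linear_incl bounded_linear.linear[OF f]] by (simp add: o_def)
  show "\<bar>f (\<iota> k)\<bar> \<le> norm (riesz f) * norm k" for k
    using functional_incl_le[OF f] norm_riesz[OF f] by simp
  show "f (\<iota> (riesz f)) = (norm (riesz f))\<^sup>2"
    unfolding incl_riesz[OF fl] functional_cm_vec[OF fl f] norm_riesz[OF f] by (simp add: power2_eq_square[symmetric])
qed

text \<open>A measurable linear functional is determined up to null sets by its restriction to the
  Cameron--Martin space. This replaces continuity as the link between the analysis on \<open>'h\<close> and the
  probability on \<open>'a\<close>.\<close>

definition represents :: "('a \<Rightarrow> real) \<Rightarrow> 'h \<Rightarrow> bool" where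
  "represents w u \<longleftrightarrow> measurable_linear M w \<and> (\<forall>k. w (\<iota> k) = inner u k)"

lemma represents_functional: "bounded_linear f \<Longrightarrow> represents f (riesz f)"
  unfolding represents_def using functional_eq_inner measurable_linear_functional by blast

lemma represents_combine:
  "represents w u \<Longrightarrow> represents w' u' \<Longrightarrow> represents (\<lambda>x. a * w x + b * w' x) (a *\<^sub>R u + b *\<^sub>R u')"
  unfolding represents_def using measurable_linear_combine[of M w w' a b] by (simp add: inner_add_left)

lemma represents_sum:
  assumes "finite I" "\<And>i. i \<in> I \<Longrightarrow> represents (w i) (u i)"
  shows "represents (\<lambda>x. \<Sum>i\<in>I. c i * w i x) (\<Sum>i\<in>I. c i *\<^sub>R u i)"
  using assms
proof (induction I)
  case empty
  then show ?case using measurable_linear_functional[OF bounded_linear_zero] by (simp add: represents_def)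
next
  case (insert i I)
  then show ?case using represents_combine[of "w i" "u i" "\<lambda>x. \<Sum>i\<in>I. c i * w i x" "\<Sum>i\<in>I. c i *\<^sub>R u i" "c i" 1] by simp
qed

text \<open>The two vectors have the same inner product with every \<open>riesz f\<close>, because
  \<open>measurable_linear_cm_vec\<close> evaluates the covariance of \<open>w\<close> and \<open>f\<close> both as \<open>f (cm_vec w)\<close> and as
  \<open>w (cm_vec f)\<close>.\<close>

theorem represents_riesz:
  assumes w: "represents w u"
  shows "riesz w = u" "var w = (norm u)\<^sup>2"
proof -
  have ml: "measurable_linear M w" and wu: "\<And>k. w (\<iota> k) = inner u k" using w by (auto simp: represents_def)
  have "f (\<iota> (u - riesz w)) = 0" if f: "bounded_linear f" for f :: "'a \<Rightarrow> real"
  proof -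
    note fl = measurable_linear_functional[OF f]
    have "f (\<iota> (riesz w)) = (\<integral>x. f x * w x \<partial>M)"
      unfolding incl_riesz[OF ml] by (rule functional_cm_vec[OF ml f])
    also have "\<dots> = (\<integral>x. w x * f x \<partial>M)" by (simp add: mult.commute)
    also have "\<dots> = w (\<iota> (riesz f))"
      unfolding incl_riesz[OF fl] by (rule measurable_linear_cm_vec[OF ml fl, symmetric])
    also have "\<dots> = f (\<iota> u)" unfolding wu functional_eq_inner[OF f] by (rule inner_commute)
    finally show ?thesis unfolding functional_eq_inner[OF f] by (simp add: inner_diff_right)
  qed
  then have "u - riesz w = 0" by (rule functionals_separate)
  then show r: "riesz w = u" by simp
  have "var w = (\<integral>x. w x * w x \<partial>M)" by (simp add: power2_eq_square)
  also have "\<dots> = w (cm_vec w)" by (rule measurable_linear_cm_vec[OF ml ml, symmetric])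
  also have "\<dots> = inner u (riesz w)" using wu incl_riesz[OF ml] by metis
  finally show "var w = (norm u)\<^sup>2" by (simp add: r power2_norm_eq_inner)
qed

lemma represents_gaussian: "represents w u \<Longrightarrow> gaussian_with M w ((norm u)\<^sup>2)"
  using measurable_linear_gaussian represents_riesz(2) unfolding represents_def by metis

lemma riesz_functional_combine:
  assumes "bounded_linear f" "bounded_linear g"
  shows "riesz (\<lambda>x. a * f x + b * g x) = a *\<^sub>R riesz f + b *\<^sub>R riesz g"
  using represents_riesz(1)[OF represents_combine[OF represents_functional[OF assms(1)] represents_functional[OF assms(2)]]] .

lemma riesz_dense: "closure (riesz ` {f. bounded_linear f}) = UNIV"
proof (rule dense_subspace)
  have comb: "bounded_linear (\<lambda>x. a * f x + b * g x)" if "bounded_linear f" "bounded_linear g" for a b and f g :: "'a \<Rightarrow> real"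
    by (rule bounded_linear_add[OF bounded_linear_compose[OF bounded_linear_mult_right that(1)]
          bounded_linear_compose[OF bounded_linear_mult_right that(2)]])
  show "subspace (riesz ` {f. bounded_linear f})"
    unfolding subspace_def
  proof (intro conjI ballI allI)
    show "0 \<in> riesz ` {f. bounded_linear f}"
    proof (rule image_eqI)
      show "0 = riesz (\<lambda>x::'a. 0 * 0 + 0 * 0)"
        using riesz_functional_combine[OF bounded_linear_zero bounded_linear_zero, of 0 0] by simp
    qed (simp add: bounded_linear_zero)
  next
    fix x y assume "x \<in> riesz ` {f. bounded_linear f}" "y \<in> riesz ` {f. bounded_linear f}"
    then obtain f g where fg: "bounded_linear f" "bounded_linear g" "x = riesz f" "y = riesz g" by blast
    show "x + y \<in> riesz ` {f. bounded_linear f}"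
    proof (rule image_eqI)
      show "x + y = riesz (\<lambda>z. 1 * f z + 1 * g z)" using riesz_functional_combine[OF fg(1,2), of 1 1] fg by simp
      show "(\<lambda>z. 1 * f z + 1 * g z) \<in> {f. bounded_linear f}" using comb[OF fg(1,2)] by blast
    qed
  next
    fix c x assume "x \<in> riesz ` {f. bounded_linear f}"
    then obtain f where f: "bounded_linear f" "x = riesz f" by blast
    show "c *\<^sub>R x \<in> riesz ` {f. bounded_linear f}"
    proof (rule image_eqI)
      show "c *\<^sub>R x = riesz (\<lambda>z. c * f z + 0 * f z)" using riesz_functional_combine[OF f(1) f(1), of c 0] f by simp
      show "(\<lambda>z. c * f z + 0 * f z) \<in> {f. bounded_linear f}" using comb[OF f(1) f(1)] by blast
    qed
  qed
  fix p assume p: "\<And>l. l \<in> riesz ` {f. bounded_linear f} \<Longrightarrow> inner p l = 0"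
  show "p = 0"
  proof (rule functionals_separate)
    fix f :: "'a \<Rightarrow> real" assume f: "bounded_linear f"
    have "inner p (riesz f) = 0" by (rule p) (use f in blast)
    then show "f (\<iota> p) = 0" unfolding functional_eq_inner[OF f] by (simp add: inner_commute)
  qed
qed

end

section \<open>Concentration of maxima of functionals\<close>

context gaussian_space begin

text \<open>Bounds the exponential moment of the increment of a maximum \<open>F\<close> of functionals along a small
  rotation: at the index that attains \<open>F\<close> at the first point, the increment is a linear functional
  of the independent second point, up to a multiple of \<open>F\<close> itself.\<close>

lemma max_rotation_increment:
  assumes I: "finite I" "I \<noteq> {}"
    and w: "\<And>i. i \<in> I \<Longrightarrow> measurable_linear M (w i)" and v: "\<And>i. i \<in> I \<Longrightarrow> var (w i) \<le> 1"
  defines "F \<equiv> (\<lambda>x. Max ((\<lambda>i. w i x) ` I))"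
  assumes \<kappa>: "\<kappa> \<ge> 0"
  shows "(\<integral>\<^sup>+z. ennreal (exp (\<kappa> * (F (fst z) - F (c *\<^sub>R fst z + s *\<^sub>R snd z)))) \<partial>(M \<Otimes>\<^sub>M M))
      \<le> ennreal (exp ((\<kappa> * s)\<^sup>2 / 2)) * (\<integral>\<^sup>+x. ennreal (exp (\<kappa> * (1 - c) * F x)) \<partial>M)"
proof -
  interpret P: pair_prob_space M M ..
  have [measurable]: "\<And>i. i \<in> I \<Longrightarrow> w i \<in> borel_measurable borel" using w by (auto simp: measurable_linear_def)
  have [measurable]: "F \<in> borel_measurable borel" unfolding F_def using I by measurable
  have FM [measurable]: "F \<in> borel_measurable M" by (rule borel_measurable_M) simp
  have wM: "w i \<in> borel_measurable M" if "i \<in> I" for i using w[OF that] by (rule measurable_linear_measurable)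
  have "\<exists>G. \<forall>i\<in>I. full_subspace M (G i) \<and> linear_on_subspace (G i) (w i)"
    by (rule bchoice) (use w in \<open>auto simp: measurable_linear_def\<close>)
  then obtain G where G: "\<And>i. i \<in> I \<Longrightarrow> full_subspace M (G i)" "\<And>i. i \<in> I \<Longrightarrow> linear_on_subspace (G i) (w i)"
    by blast
  have AG: "AE x in M. \<forall>i\<in>I. x \<in> G i"
    using I(1) G(1) by (intro AE_finite_allI) (auto simp: full_subspace_def)
  have FmM: "(\<lambda>z. F (c *\<^sub>R fst z + s *\<^sub>R snd z)) \<in> borel_measurable (M \<Otimes>\<^sub>M M)"
    by measurable
  have "(\<integral>\<^sup>+z. ennreal (exp (\<kappa> * (F (fst z) - F (c *\<^sub>R fst z + s *\<^sub>R snd z)))) \<partial>(M \<Otimes>\<^sub>M M))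
      = (\<integral>\<^sup>+a. \<integral>\<^sup>+b. ennreal (exp (\<kappa> * (F (fst (a, b)) - F (c *\<^sub>R fst (a, b) + s *\<^sub>R snd (a, b))))) \<partial>M \<partial>M)"
    by (rule nn_integral_fst[symmetric]) (use FmM in measurable)
  also have "\<dots> \<le> (\<integral>\<^sup>+a. ennreal (exp ((\<kappa> * s)\<^sup>2 / 2)) * ennreal (exp (\<kappa> * (1 - c) * F a)) \<partial>M)"
  proof (rule nn_integral_mono_AE)
    show "AE a in M. (\<integral>\<^sup>+b. ennreal (exp (\<kappa> * (F (fst (a, b)) - F (c *\<^sub>R fst (a, b) + s *\<^sub>R snd (a, b))))) \<partial>M)
        \<le> ennreal (exp ((\<kappa> * s)\<^sup>2 / 2)) * ennreal (exp (\<kappa> * (1 - c) * F a))"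
      using AG
    proof eventually_elim
      case (elim a)
      have "F a \<in> (\<lambda>i. w i a) ` I" unfolding F_def using I by (intro Max_in) auto
      then obtain j where j: "j \<in> I" "F a = w j a" by blast
      have "(\<integral>\<^sup>+b. ennreal (exp (\<kappa> * (F a - F (c *\<^sub>R a + s *\<^sub>R b)))) \<partial>M)
          \<le> (\<integral>\<^sup>+b. ennreal (exp (\<kappa> * (1 - c) * F a)) * ennreal (exp ((- \<kappa> * s) * w j b)) \<partial>M)"
      proof (rule nn_integral_mono_AE)
        show "AE b in M. ennreal (exp (\<kappa> * (F a - F (c *\<^sub>R a + s *\<^sub>R b))))
            \<le> ennreal (exp (\<kappa> * (1 - c) * F a)) * ennreal (exp ((- \<kappa> * s) * w j b))"
          using AG
        proof eventually_elim
          case b: (elim b)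
          have "c *\<^sub>R a \<in> G j" "s *\<^sub>R b \<in> G j"
            using G(1)[OF j(1)] elim b j(1) by (auto simp: full_subspace_def subspace_scale)
          then have "w j (c *\<^sub>R a + s *\<^sub>R b) = c * w j a + s * w j b"
            using G(2)[OF j(1)] elim b j(1) by (simp add: linear_on_subspace_def)
          moreover have "w j (c *\<^sub>R a + s *\<^sub>R b) \<le> F (c *\<^sub>R a + s *\<^sub>R b)"
            unfolding F_def using I(1) j(1) by (intro Max_ge) auto
          ultimately have "F a - F (c *\<^sub>R a + s *\<^sub>R b) \<le> (1 - c) * F a - s * w j b"
            using j(2) by (simp add: algebra_simps)
          then have "\<kappa> * (F a - F (c *\<^sub>R a + s *\<^sub>R b)) \<le> \<kappa> * ((1 - c) * F a - s * w j b)"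
            using \<kappa> by (rule mult_left_mono)
          also have "\<dots> = \<kappa> * (1 - c) * F a + (- \<kappa> * s) * w j b" by (simp add: algebra_simps)
          finally show ?case by (simp add: ennreal_mult[symmetric] exp_add[symmetric] ennreal_leI)
        qed
      qed
      also have "\<dots> = ennreal (exp (\<kappa> * (1 - c) * F a)) * (\<integral>\<^sup>+b. ennreal (exp ((- \<kappa> * s) * w j b)) \<partial>M)"
        by (rule nn_integral_cmult) (use wM[OF j(1)] in measurable)
      also have "(\<integral>\<^sup>+b. ennreal (exp ((- \<kappa> * s) * w j b)) \<partial>M) = ennreal (exp (var (w j) * (- \<kappa> * s)\<^sup>2 / 2))"
        by (rule gaussian_with_mgf[OF measurable_linear_gaussian[OF w[OF j(1)]]])
      finally have le: "(\<integral>\<^sup>+b. ennreal (exp (\<kappa> * (F a - F (c *\<^sub>R a + s *\<^sub>R b)))) \<partial>M)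
          \<le> ennreal (exp (\<kappa> * (1 - c) * F a)) * ennreal (exp (var (w j) * (- \<kappa> * s)\<^sup>2 / 2))" .
      have "var (w j) * (\<kappa> * s)\<^sup>2 \<le> 1 * (\<kappa> * s)\<^sup>2" using v[OF j(1)] by (intro mult_right_mono) auto
      then have "ennreal (exp (var (w j) * (- \<kappa> * s)\<^sup>2 / 2)) \<le> ennreal (exp ((\<kappa> * s)\<^sup>2 / 2))"
        by (intro ennreal_leI) simp
      then have "ennreal (exp (\<kappa> * (1 - c) * F a)) * ennreal (exp (var (w j) * (- \<kappa> * s)\<^sup>2 / 2))
          \<le> ennreal (exp (\<kappa> * (1 - c) * F a)) * ennreal (exp ((\<kappa> * s)\<^sup>2 / 2))"
        by (rule mult_left_mono) simp
      from order_trans[OF le this] show ?case by (simp only: fst_conv snd_conv mult.commute)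
    qed
  qed
  also have "\<dots> = ennreal (exp ((\<kappa> * s)\<^sup>2 / 2)) * (\<integral>\<^sup>+x. ennreal (exp (\<kappa> * (1 - c) * F x)) \<partial>M)"
    by (rule nn_integral_cmult) measurable
  finally show ?thesis .
qed

text \<open>For small \<open>\<kappa>\<close> this is close to \<open>1\<close>, by convexity of \<open>\<lambda>\<kappa>. exp (\<kappa> * F x)\<close> between \<open>0\<close> and \<open>1\<close>.\<close>

lemma max_small_exponential_moment:
  assumes I: "finite I" "I \<noteq> {}"
    and w: "\<And>i. i \<in> I \<Longrightarrow> measurable_linear M (w i)" and v: "\<And>i. i \<in> I \<Longrightarrow> var (w i) \<le> 1"
  defines "F \<equiv> (\<lambda>x. Max ((\<lambda>i. w i x) ` I))"
  assumes \<kappa>: "0 \<le> \<kappa>" "\<kappa> \<le> 1"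
  shows "(\<integral>\<^sup>+x. ennreal (exp (\<kappa> * F x)) \<partial>M) \<le> ennreal (1 + \<kappa> * (real (card I) * exp (1/2)))"
proof -
  have wM [measurable]: "\<And>i. i \<in> I \<Longrightarrow> w i \<in> borel_measurable M" using w by (rule measurable_linear_measurable)
  have pt: "exp (\<kappa> * F x) \<le> 1 + \<kappa> * (\<Sum>i\<in>I. exp (w i x))" for x
  proof -
    have "F x \<in> (\<lambda>i. w i x) ` I" unfolding F_def using I by (intro Max_in) auto
    then obtain j where j: "j \<in> I" "F x = w j x" by blast
    have "exp (w j x) \<le> (\<Sum>i\<in>I. exp (w i x))" using I(1) j(1) by (intro member_le_sum) auto
    then have "\<kappa> * exp (F x) \<le> \<kappa> * (\<Sum>i\<in>I. exp (w i x))" using \<kappa> j by (intro mult_left_mono) auto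
    moreover have "exp ((1 - \<kappa>) *\<^sub>R 0 + \<kappa> *\<^sub>R F x) \<le> (1 - \<kappa>) * exp 0 + \<kappa> * exp (F x)"
      using \<kappa> by (intro convex_onD[OF exp_convex]) auto
    ultimately show ?thesis using \<kappa> by simp
  qed
  have "(\<integral>\<^sup>+x. ennreal (exp (\<kappa> * F x)) \<partial>M) \<le> (\<integral>\<^sup>+x. 1 + ennreal \<kappa> * (\<Sum>i\<in>I. ennreal (exp (1 * w i x))) \<partial>M)"
  proof (rule nn_integral_mono)
    fix x
    have "ennreal (exp (\<kappa> * F x)) \<le> ennreal (1 + \<kappa> * (\<Sum>i\<in>I. exp (w i x)))" by (rule ennreal_leI[OF pt])
    also have "\<dots> = 1 + ennreal \<kappa> * (\<Sum>i\<in>I. ennreal (exp (1 * w i x)))"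
      using \<kappa> by (simp add: ennreal_mult sum_nonneg sum_ennreal)
    finally show "ennreal (exp (\<kappa> * F x)) \<le> 1 + ennreal \<kappa> * (\<Sum>i\<in>I. ennreal (exp (1 * w i x)))" .
  qed
  also have "\<dots> = 1 + ennreal \<kappa> * (\<Sum>i\<in>I. \<integral>\<^sup>+x. ennreal (exp (1 * w i x)) \<partial>M)"
  proof -
    have "(\<integral>\<^sup>+x. 1 + ennreal \<kappa> * (\<Sum>i\<in>I. ennreal (exp (1 * w i x))) \<partial>M)
        = (\<integral>\<^sup>+x. 1 \<partial>M) + (\<integral>\<^sup>+x. ennreal \<kappa> * (\<Sum>i\<in>I. ennreal (exp (1 * w i x))) \<partial>M)"
      by (rule nn_integral_add) measurable
    also have "(\<integral>\<^sup>+x. ennreal \<kappa> * (\<Sum>i\<in>I. ennreal (exp (1 * w i x))) \<partial>M)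
        = ennreal \<kappa> * (\<integral>\<^sup>+x. (\<Sum>i\<in>I. ennreal (exp (1 * w i x))) \<partial>M)"
      by (rule nn_integral_cmult) measurable
    also have "(\<integral>\<^sup>+x. (\<Sum>i\<in>I. ennreal (exp (1 * w i x))) \<partial>M) = (\<Sum>i\<in>I. \<integral>\<^sup>+x. ennreal (exp (1 * w i x)) \<partial>M)"
      by (rule nn_integral_sum) measurable
    finally show ?thesis using emeasure_space_1 by simp
  qed
  also have "\<dots> \<le> 1 + ennreal \<kappa> * (\<Sum>i\<in>I. ennreal (exp (1/2)))"
  proof (intro add_left_mono mult_left_mono sum_mono)
    fix i assume i: "i \<in> I"
    have "(\<integral>\<^sup>+x. ennreal (exp (1 * w i x)) \<partial>M) = ennreal (exp (var (w i) * 1\<^sup>2 / 2))"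
      by (rule gaussian_with_mgf[OF measurable_linear_gaussian[OF w[OF i]]])
    then show "(\<integral>\<^sup>+x. ennreal (exp (1 * w i x)) \<partial>M) \<le> ennreal (exp (1/2))" using v[OF i] by (simp add: ennreal_leI)
  qed simp
  also have "\<dots> = ennreal (1 + \<kappa> * (real (card I) * exp (1/2)))"
    using \<kappa> by (simp add: ennreal_mult ennreal_of_nat_eq_real_of_nat)
  finally show ?thesis .
qed

text \<open>A discrete version of the Maurey--Pisier argument: two independent points are joined by a
  quarter rotation in \<open>n\<close> steps, and \<open>n\<close> tends to infinity.\<close>

lemma max_difference_exponential_moment:
  assumes I: "finite I" "I \<noteq> {}"
    and w: "\<And>i. i \<in> I \<Longrightarrow> measurable_linear M (w i)" and v: "\<And>i. i \<in> I \<Longrightarrow> var (w i) \<le> 1"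
  defines "F \<equiv> (\<lambda>x. Max ((\<lambda>i. w i x) ` I))"
  assumes l: "l \<ge> 0"
  shows "(\<integral>\<^sup>+z. ennreal (exp (l * (F (fst z) - F (snd z)))) \<partial>(M \<Otimes>\<^sub>M M)) \<le> ennreal (exp (l\<^sup>2 * pi\<^sup>2 / 8))"
    (is "?E \<le> _")
proof -
  have [measurable]: "\<And>i. i \<in> I \<Longrightarrow> w i \<in> borel_measurable borel" using w by (auto simp: measurable_linear_def)
  have [measurable]: "F \<in> borel_measurable borel" unfolding F_def using I by measurable
  have FM [measurable]: "F \<in> borel_measurable M" by (rule borel_measurable_M) simp
  define C where "C = l * pi\<^sup>2 / 8 * (real (card I) * exp (1/2))"
  define A where "A = exp (l\<^sup>2 * pi\<^sup>2 / 8)"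
  have step: "?E \<le> ennreal (A * (1 + C / real n))" if n: "n \<ge> 1" "l * pi\<^sup>2 / 8 \<le> real n" for n :: nat
  proof -
    define \<delta> where "\<delta> = pi / (2 * real n)"
    have n0: "real n > 0" using n by simp
    have \<delta>: "0 < \<delta>" using n0 by (simp add: \<delta>_def)
    define X where "X k z = sin (real k * \<delta>) *\<^sub>R fst z + cos (real k * \<delta>) *\<^sub>R snd z" for k and z :: "'a \<times> 'a"
    have Xm [measurable]: "X k \<in> (M \<Otimes>\<^sub>M M) \<rightarrow>\<^sub>M borel" for k unfolding X_def by measurable
    have nd: "real n * \<delta> = pi / 2" using n0 by (simp add: \<delta>_def)
    have tele: "(\<Sum>k<n. F (X (Suc k) z) - F (X k z)) = F (fst z) - F (snd z)" for z
      by (subst sum_lessThan_telescope) (simp add: X_def nd)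
    have conv: "exp (l * (F (fst z) - F (snd z)))
        \<le> (\<Sum>k<n. (1 / real n) * exp ((l * real n) * (F (X (Suc k) z) - F (X k z))))" for z
    proof -
      have "exp (\<Sum>k<n. (1 / real n) *\<^sub>R ((l * real n) * (F (X (Suc k) z) - F (X k z))))
          \<le> (\<Sum>k<n. (1 / real n) * exp ((l * real n) * (F (X (Suc k) z) - F (X k z))))"
        by (rule convex_on_sum[OF _ _ exp_convex]) (use n in \<open>auto simp: lessThan_empty_iff\<close>)
      moreover have "(\<Sum>k<n. (1 / real n) *\<^sub>R ((l * real n) * (F (X (Suc k) z) - F (X k z))))
          = l * (\<Sum>k<n. F (X (Suc k) z) - F (X k z))"
        unfolding sum_distrib_left by (rule sum.cong) (use n0 in auto)
      ultimately show ?thesis by (simp add: tele)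
    qed
    have incr: "(\<integral>\<^sup>+z. ennreal (exp ((l * real n) * (F (X (Suc k) z) - F (X k z)))) \<partial>(M \<Otimes>\<^sub>M M)) \<le> ennreal (A * (1 + C / real n))" for k
    proof -
      define c where "c = cos \<delta>"
      define s where "s = sin \<delta>"
      define \<theta> where "\<theta> = real (Suc k) * \<delta>"
      have kd: "real k * \<delta> = \<theta> - \<delta>" by (simp add: \<theta>_def algebra_simps)
      have one: "fst (rot (sin \<theta>) (cos \<theta>) z) = X (Suc k) z" for z by (simp add: rot_def X_def \<theta>_def)
      have two: "c *\<^sub>R fst (rot (sin \<theta>) (cos \<theta>) z) + s *\<^sub>R snd (rot (sin \<theta>) (cos \<theta>) z) = X k z" for z
        unfolding X_def kd sin_diff cos_diff rot_def c_def s_def by (simp add: algebra_simps)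
      have Hm [measurable]: "(\<lambda>z. F (c *\<^sub>R fst z + s *\<^sub>R snd z)) \<in> borel_measurable (M \<Otimes>\<^sub>M M)" by measurable
      define H where "H z = ennreal (exp ((l * real n) * (F (fst z) - F (c *\<^sub>R fst z + s *\<^sub>R snd z))))" for z :: "'a \<times> 'a"
      have [measurable]: "H \<in> borel_measurable (M \<Otimes>\<^sub>M M)" unfolding H_def by measurable
      have "(\<integral>\<^sup>+z. ennreal (exp ((l * real n) * (F (X (Suc k) z) - F (X k z)))) \<partial>(M \<Otimes>\<^sub>M M))
          = (\<integral>\<^sup>+z. H (rot (sin \<theta>) (cos \<theta>) z) \<partial>(M \<Otimes>\<^sub>M M))"
        by (simp only: H_def two) (simp only: one)
      also have "\<dots> = (\<integral>\<^sup>+z. H z \<partial>distr (M \<Otimes>\<^sub>M M) (M \<Otimes>\<^sub>M M) (rot (sin \<theta>) (cos \<theta>)))"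
        by (subst nn_integral_distr) simp_all
      also have "\<dots> = (\<integral>\<^sup>+z. H z \<partial>(M \<Otimes>\<^sub>M M))" by (subst rotation_invariant) simp_all
      also have "\<dots> \<le> ennreal (exp (((l * real n) * s)\<^sup>2 / 2)) * (\<integral>\<^sup>+x. ennreal (exp ((l * real n) * (1 - c) * F x)) \<partial>M)"
        unfolding H_def F_def by (rule max_rotation_increment[OF I w v]) (use l in simp_all)
      also have "\<dots> \<le> ennreal A * ennreal (1 + C / real n)"
      proof (rule mult_mono)
        have "s\<^sup>2 \<le> \<delta>\<^sup>2" unfolding s_def using abs_sin_x_le_abs_x[of \<delta>] by (simp add: abs_le_square_iff)
        then have "((l * real n) * s)\<^sup>2 \<le> (l * real n)\<^sup>2 * \<delta>\<^sup>2" unfolding power_mult_distrib by (intro mult_left_mono) auto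
        also have "\<dots> = (l * (real n * \<delta>))\<^sup>2" by (simp add: power_mult_distrib mult.assoc)
        also have "\<dots> = l\<^sup>2 * pi\<^sup>2 / 4" unfolding nd by (simp add: power_mult_distrib power_divide)
        finally show "ennreal (exp (((l * real n) * s)\<^sup>2 / 2)) \<le> ennreal A"
          unfolding A_def by (intro ennreal_leI) simp
        have "1 - c = 2 * (sin (\<delta> / 2))\<^sup>2" unfolding c_def using cos_double_sin[of "\<delta> / 2"] by simp
        moreover have "(sin (\<delta> / 2))\<^sup>2 \<le> (\<delta> / 2)\<^sup>2" using abs_sin_x_le_abs_x[of "\<delta> / 2"] by (simp only: abs_le_square_iff)
        ultimately have c: "0 \<le> 1 - c" "1 - c \<le> \<delta>\<^sup>2 / 2" by (simp_all add: power_divide)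
        define \<kappa> where "\<kappa> = (l * real n) * (1 - c)"
        have "\<kappa> \<le> (l * real n) * (\<delta>\<^sup>2 / 2)" unfolding \<kappa>_def using c l by (intro mult_left_mono) auto
        also have "\<dots> = l * pi\<^sup>2 / 8 / real n" using n0 by (simp add: \<delta>_def power2_eq_square)
        finally have \<kappa>: "\<kappa> \<le> l * pi\<^sup>2 / 8 / real n" .
        have "l * pi\<^sup>2 / 8 / real n \<le> 1" using n(2) n0 by (simp add: divide_le_eq)
        then have \<kappa>1: "0 \<le> \<kappa>" "\<kappa> \<le> 1" using \<kappa> c l by (simp_all add: \<kappa>_def)
        have "(\<integral>\<^sup>+x. ennreal (exp (\<kappa> * F x)) \<partial>M) \<le> ennreal (1 + \<kappa> * (real (card I) * exp (1/2)))"
          unfolding F_def by (rule max_small_exponential_moment[OF I w v \<kappa>1]) simp_all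
        also have "\<dots> \<le> ennreal (1 + C / real n)"
        proof (rule ennreal_leI)
          have "\<kappa> * (real (card I) * exp (1/2)) \<le> l * pi\<^sup>2 / 8 / real n * (real (card I) * exp (1/2))"
            using \<kappa> by (intro mult_right_mono) auto
          then show "1 + \<kappa> * (real (card I) * exp (1/2)) \<le> 1 + C / real n" by (simp add: C_def)
        qed
        finally show "(\<integral>\<^sup>+x. ennreal (exp ((l * real n) * (1 - c) * F x)) \<partial>M) \<le> ennreal (1 + C / real n)"
          by (simp add: \<kappa>_def)
      qed simp_all
      also have "\<dots> = ennreal (A * (1 + C / real n))"
        by (rule ennreal_mult[symmetric]) (use l in \<open>auto simp: A_def C_def intro!: add_nonneg_nonneg\<close>)
      finally show ?thesis .
    qed
    have "?E \<le> (\<integral>\<^sup>+z. (\<Sum>k<n. ennreal (1 / real n) * ennreal (exp ((l * real n) * (F (X (Suc k) z) - F (X k z))))) \<partial>(M \<Otimes>\<^sub>M M))"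
    proof (rule nn_integral_mono)
      fix z
      have "ennreal (exp (l * (F (fst z) - F (snd z))))
          \<le> ennreal (\<Sum>k<n. (1 / real n) * exp ((l * real n) * (F (X (Suc k) z) - F (X k z))))"
        by (rule ennreal_leI[OF conv])
      also have "\<dots> = (\<Sum>k<n. ennreal (1 / real n) * ennreal (exp ((l * real n) * (F (X (Suc k) z) - F (X k z)))))"
        by (simp add: sum_ennreal[symmetric] ennreal_mult[symmetric] del: sum_ennreal)
      finally show "ennreal (exp (l * (F (fst z) - F (snd z)))) \<le> \<dots>" .
    qed
    also have "\<dots> = (\<Sum>k<n. ennreal (1 / real n) * (\<integral>\<^sup>+z. ennreal (exp ((l * real n) * (F (X (Suc k) z) - F (X k z)))) \<partial>(M \<Otimes>\<^sub>M M)))"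
      by (simp add: nn_integral_sum nn_integral_cmult)
    also have "\<dots> \<le> (\<Sum>k<n. ennreal (1 / real n) * ennreal (A * (1 + C / real n)))"
      by (intro sum_mono mult_left_mono incr) simp
    also have "\<dots> = ennreal (\<Sum>k<n. 1 / real n * (A * (1 + C / real n)))"
    proof -
      have B: "0 \<le> A * (1 + C / real n)"
        using l by (simp add: A_def C_def mult_nonneg_nonneg add_nonneg_nonneg)
      have "(\<Sum>k<n. ennreal (1 / real n) * ennreal (A * (1 + C / real n))) = (\<Sum>k<n. ennreal (1 / real n * (A * (1 + C / real n))))"
        by (rule sum.cong[OF refl], rule ennreal_mult[symmetric]) (use B in simp_all)
      also have "\<dots> = ennreal (\<Sum>k<n. 1 / real n * (A * (1 + C / real n)))"
        by (rule sum_ennreal) (use B in simp)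
      finally show ?thesis .
    qed
    also have "(\<Sum>k<n. 1 / real n * (A * (1 + C / real n))) = A * (1 + C / real n)" using n0 by simp
    finally show ?thesis .
  qed
  have "(\<lambda>n. A * (1 + C * (1 / real n))) \<longlonglongrightarrow> A * (1 + C * 0)" by (intro tendsto_intros lim_1_over_n)
  then have lim: "(\<lambda>n. ennreal (A * (1 + C / real n))) \<longlonglongrightarrow> ennreal A" by (intro tendsto_ennrealI) simp
  obtain n0 :: nat where n0: "l * pi\<^sup>2 / 8 \<le> real n0" using real_arch_simple by blast
  have "?E \<le> ennreal A"
  proof (rule LIMSEQ_le_const[OF lim])
    show "\<exists>N. \<forall>n\<ge>N. ?E \<le> ennreal (A * (1 + C / real n))"
    proof (intro exI[of _ "max 1 n0"] allI impI)
      fix n assume "n \<ge> max 1 n0"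
      then have "n \<ge> 1" "real n0 \<le> real n" by auto
      then show "?E \<le> ennreal (A * (1 + C / real n))" using n0 by (intro step) auto
    qed
  qed
  then show ?thesis by (simp add: A_def)
qed

text \<open>The exponent does not depend on the number of functionals. Hence a lower bound for the
  maximum that holds with an only polynomially small probability already holds, up to a small loss,
  with probability close to \<open>1\<close>.\<close>

theorem max_concentration:
  assumes I: "finite I" "I \<noteq> {}"
    and w: "\<And>i. i \<in> I \<Longrightarrow> measurable_linear M (w i)" and v: "\<And>i. i \<in> I \<Longrightarrow> var (w i) \<le> 1"
  defines "F \<equiv> (\<lambda>x. Max ((\<lambda>i. w i x) ` I))"
  assumes u: "u \<ge> 0"
  shows "measure M {x. s \<le> F x} * measure M {x. F x \<le> s - u} \<le> exp (- 2 * u\<^sup>2 / pi\<^sup>2)"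
proof -
  interpret P: pair_prob_space M M ..
  have [measurable]: "\<And>i. i \<in> I \<Longrightarrow> w i \<in> borel_measurable borel" using w by (auto simp: measurable_linear_def)
  have [measurable]: "F \<in> borel_measurable borel" unfolding F_def using I by measurable
  have FM [measurable]: "F \<in> borel_measurable M" by (rule borel_measurable_M) simp
  define A where "A = {x. s \<le> F x}"
  define B where "B = {x. F x \<le> s - u}"
  have "{x \<in> space M. s \<le> F x} \<in> sets M" "{x \<in> space M. F x \<le> s - u} \<in> sets M" by measurable
  then have AB [measurable]: "A \<in> sets M" "B \<in> sets M" by (simp_all add: A_def B_def)
  \<comment> \<open>The optimal exponent in Chernoff's bound.\<close>
  define l where "l = 4 * u / pi\<^sup>2"
  have l: "l \<ge> 0" using u by (simp add: l_def)
  have "ennreal (exp (l * u)) * (emeasure M A * emeasure M B) = ennreal (exp (l * u)) * emeasure (M \<Otimes>\<^sub>M M) (A \<times> B)"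
    by (subst emeasure_pair_measure_Times) simp_all
  also have "\<dots> = (\<integral>\<^sup>+z. ennreal (exp (l * u)) * indicator (A \<times> B) z \<partial>(M \<Otimes>\<^sub>M M))"
    by (rule nn_integral_cmult_indicator[symmetric]) simp
  also have "\<dots> \<le> (\<integral>\<^sup>+z. ennreal (exp (l * (F (fst z) - F (snd z)))) \<partial>(M \<Otimes>\<^sub>M M))"
  proof (rule nn_integral_mono)
    fix z
    show "ennreal (exp (l * u)) * indicator (A \<times> B) z \<le> ennreal (exp (l * (F (fst z) - F (snd z))))"
    proof (cases "z \<in> A \<times> B")
      case True
      then have "u \<le> F (fst z) - F (snd z)" by (auto simp: A_def B_def)
      then have "l * u \<le> l * (F (fst z) - F (snd z))" using l by (rule mult_left_mono)
      then show ?thesis using True by (simp add: ennreal_leI)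
    qed simp
  qed
  also have "\<dots> \<le> ennreal (exp (l\<^sup>2 * pi\<^sup>2 / 8))"
    unfolding F_def by (rule max_difference_exponential_moment[OF I w v l]) simp_all
  finally have "exp (l * u) * (measure M A * measure M B) \<le> exp (l\<^sup>2 * pi\<^sup>2 / 8)"
    by (simp add: emeasure_eq_measure ennreal_mult[symmetric])
  then have "measure M A * measure M B \<le> exp (l\<^sup>2 * pi\<^sup>2 / 8) / exp (l * u)" by (simp add: field_simps)
  also have "\<dots> = exp (l\<^sup>2 * pi\<^sup>2 / 8 - l * u)" by (simp add: exp_diff)
  also have "l\<^sup>2 * pi\<^sup>2 / 8 - l * u = - 2 * u\<^sup>2 / pi\<^sup>2"
    by (simp add: l_def power2_eq_square field_simps)
  finally show ?thesis by (simp add: A_def B_def)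
qed

end

section \<open>Growth of Gaussian sequences\<close>

text \<open>The second moment method: the number \<open>Q\<close> of events that occur satisfies
  \<open>2 t Q - t\<^sup>2 Q\<^sup>2 \<le> 1\<close>, and vanishes outside the union.\<close>

lemma (in prob_space) second_moment_union:
  assumes I: "finite I" and A: "\<And>i. i \<in> I \<Longrightarrow> A i \<in> events"
  shows "prob (\<Union>i\<in>I. A i) \<ge> 2 * t * (\<Sum>i\<in>I. prob (A i)) - t\<^sup>2 * (\<Sum>i\<in>I. \<Sum>j\<in>I. prob (A i \<inter> A j))"
proof -
  have ind: "integrable M (indicator B :: 'a \<Rightarrow> real)" if "B \<in> events" for B using that by (simp add: emeasure_eq_measure)
  have U: "(\<Union>i\<in>I. A i) \<in> events" using I A by auto
  have pt: "2 * t * (\<Sum>i\<in>I. indicator (A i) x) - t\<^sup>2 * (\<Sum>i\<in>I. \<Sum>j\<in>I. indicator (A i \<inter> A j) x) \<le> (indicator (\<Union>i\<in>I. A i) x :: real)" for x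
  proof -
    define Q :: real where "Q = (\<Sum>i\<in>I. indicator (A i) x)"
    have "(\<Sum>i\<in>I. \<Sum>j\<in>I. indicator (A i \<inter> A j) x) = Q * Q"
      unfolding Q_def sum_product by (simp add: indicator_inter_arith)
    moreover have "2 * t * Q - t\<^sup>2 * (Q * Q) \<le> 1"
      using zero_le_power2[of "1 - t * Q"] by (simp add: power2_eq_square algebra_simps)
    moreover have "Q = 0" if "x \<notin> (\<Union>i\<in>I. A i)" unfolding Q_def using that by (intro sum.neutral) auto
    ultimately show ?thesis unfolding Q_def[symmetric] by (cases "x \<in> (\<Union>i\<in>I. A i)") (auto simp del: UN_iff)
  qed
  have "2 * t * (\<Sum>i\<in>I. prob (A i)) - t\<^sup>2 * (\<Sum>i\<in>I. \<Sum>j\<in>I. prob (A i \<inter> A j))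
      = (\<integral>x. 2 * t * (\<Sum>i\<in>I. indicator (A i) x) - t\<^sup>2 * (\<Sum>i\<in>I. \<Sum>j\<in>I. indicator (A i \<inter> A j) x) \<partial>M)"
  proof -
    have 1: "integrable M (\<lambda>x. \<Sum>i\<in>I. indicator (A i) x :: real)" using A ind by (intro Bochner_Integration.integrable_sum) auto
    have 2: "integrable M (\<lambda>x. \<Sum>i\<in>I. \<Sum>j\<in>I. indicator (A i \<inter> A j) x :: real)"
      using A by (intro Bochner_Integration.integrable_sum ind) auto
    have 3: "(\<integral>x. (\<Sum>i\<in>I. indicator (A i) x) \<partial>M) = (\<Sum>i\<in>I. prob (A i))"
    proof -
      have "(\<integral>x. (\<Sum>i\<in>I. indicator (A i) x :: real) \<partial>M) = (\<Sum>i\<in>I. \<integral>x. indicator (A i) x \<partial>M)"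
        using A by (intro Bochner_Integration.integral_sum ind) auto
      also have "\<dots> = (\<Sum>i\<in>I. prob (A i))" using A by (intro sum.cong refl) (simp add: sets.Int_space_eq2)
      finally show ?thesis .
    qed
    have 4: "(\<integral>x. (\<Sum>i\<in>I. \<Sum>j\<in>I. indicator (A i \<inter> A j) x) \<partial>M) = (\<Sum>i\<in>I. \<Sum>j\<in>I. prob (A i \<inter> A j))"
    proof -
      have "(\<integral>x. (\<Sum>i\<in>I. \<Sum>j\<in>I. indicator (A i \<inter> A j) x :: real) \<partial>M) = (\<Sum>i\<in>I. \<integral>x. (\<Sum>j\<in>I. indicator (A i \<inter> A j) x) \<partial>M)"
        using A by (intro Bochner_Integration.integral_sum Bochner_Integration.integrable_sum ind) auto
      also have "\<dots> = (\<Sum>i\<in>I. \<Sum>j\<in>I. \<integral>x. indicator (A i \<inter> A j) x \<partial>M)"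
        using A by (intro sum.cong refl Bochner_Integration.integral_sum ind) auto
      also have "\<dots> = (\<Sum>i\<in>I. \<Sum>j\<in>I. prob (A i \<inter> A j))"
        using A by (intro sum.cong refl) (simp add: sets.Int_space_eq2 sets.Int)
      finally show ?thesis .
    qed
    show ?thesis using 1 2 3 4 by simp
  qed
  also have "\<dots> \<le> (\<integral>x. indicator (\<Union>i\<in>I. A i) x \<partial>M)"
  proof (rule integral_mono[OF _ _ pt])
    show "integrable M (\<lambda>x. 2 * t * (\<Sum>i\<in>I. indicator (A i) x) - t\<^sup>2 * (\<Sum>i\<in>I. \<Sum>j\<in>I. indicator (A i \<inter> A j) x) :: real)"
      using A by (intro Bochner_Integration.integrable_diff integrable_mult_right Bochner_Integration.integrable_sum ind) auto
  qed (rule ind[OF U])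
  also have "\<dots> = prob (\<Union>i\<in>I. A i)" using U by (simp add: sets.Int_space_eq2)
  finally show ?thesis .
qed

text \<open>The first Borel--Cantelli lemma. The variance bound is enlarged to \<open>b\<close> strictly between
  \<open>\<sigma>\<^sup>2\<close> and \<open>c\<^sup>2\<close>, so that also \<open>\<sigma> = 0\<close> is covered by the tail estimate.\<close>

lemma (in prob_space) gaussian_sequence_upper:
  assumes g: "\<And>n. gaussian_with M (\<xi> n) (v n)" and v: "\<And>n. v n \<le> \<sigma>\<^sup>2" and c: "0 \<le> \<sigma>" "\<sigma> < c"
  shows "AE x in M. \<forall>\<^sub>F n in sequentially. \<xi> n x < c * sqrt (2 * ln (real n))"
proof -
  define b where "b = ((\<sigma> + c) / 2)\<^sup>2"
  have b: "\<sigma>\<^sup>2 \<le> b" "b < c\<^sup>2" "b > 0"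
    unfolding b_def using c by (auto intro!: power_mono power_strict_mono)
  have [measurable]: "\<xi> n \<in> borel_measurable M" for n using gaussian_withD(1)[OF g] .
  define A where "A n = {x \<in> space M. c * sqrt (2 * ln (real n)) \<le> \<xi> n x}" for n
  have [measurable]: "A n \<in> events" for n unfolding A_def by measurable
  have bound: "prob (A n) \<le> real n powr (- (c\<^sup>2 / b))" if n: "n \<ge> 1" for n
  proof -
    have L: "ln (real n) \<ge> 0" using n by simp
    have "prob (A n) \<le> exp (- (c * sqrt (2 * ln (real n)))\<^sup>2 / (2 * b))"
      unfolding A_def using c b L order_trans[OF v b(1)]
      by (intro gaussian_with_upper_tail[OF prob_space_axioms g]) auto
    also have "\<dots> = real n powr (- (c\<^sup>2 / b))"
      using n L b by (simp add: powr_def power_mult_distrib field_simps)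
    finally show ?thesis .
  qed
  have "summable (\<lambda>n. prob (A n))"
  proof (rule summable_comparison_test)
    show "\<exists>N. \<forall>n\<ge>N. norm (prob (A n)) \<le> real n powr (- (c\<^sup>2 / b))" using bound by (auto intro!: exI[of _ 1])
    show "summable (\<lambda>n. real n powr (- (c\<^sup>2 / b)))" using b by (subst summable_real_powr_iff) simp
  qed
  then have "AE x in M. eventually (\<lambda>n. x \<in> space M - A n) sequentially"
    by (intro borel_cantelli_AE1) (auto simp: emeasure_eq_measure)
  then show ?thesis
  proof (rule AE_mp, intro AE_I2 impI)
    fix x assume "x \<in> space M" "\<forall>\<^sub>F n in sequentially. x \<in> space M - A n"
    then show "\<forall>\<^sub>F n in sequentially. \<xi> n x < c * sqrt (2 * ln (real n))"
      by (auto simp: A_def elim!: eventually_mono)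
  qed
qed

context gaussian_space begin

text \<open>For correlations at most \<open>e\<close>, without any decay, the second moment method only gives that
  the maximum exceeds \<open>s\<close> with probability of order \<open>exp (- e s\<^sup>2)\<close>. Concentration at a distance \<open>u\<close>
  large compared with \<open>sqrt e * s\<close> turns this into a probability close to \<open>1\<close> of exceeding \<open>s - u\<close>.\<close>

lemma max_lower_probability:
  fixes m :: nat
  assumes w: "\<And>i. i \<in> {1..m} \<Longrightarrow> measurable_linear M (\<xi> i)"
    and v: "\<And>i. i \<in> {1..m} \<Longrightarrow> var (\<xi> i) = 1"
    and corr: "\<And>i j. i \<in> {1..m} \<Longrightarrow> j \<in> {1..m} \<Longrightarrow> i \<noteq> j \<Longrightarrow> var (\<lambda>x. \<xi> i x + \<xi> j x) \<le> 2 + 2 * e"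
    and e: "e > 0" and s: "s \<ge> 0" and m: "m \<ge> 1" "exp (s\<^sup>2 / 2) \<le> real m" and u: "u \<ge> 0"
  shows "measure M {x. Max ((\<lambda>i. \<xi> i x) ` {1..m}) \<le> s - u}
      \<le> 4 * pi * exp (e * s\<^sup>2 + 2 * s + 1 - 2 * u\<^sup>2 / pi\<^sup>2)"
proof -
  define F where "F = (\<lambda>x. Max ((\<lambda>i. \<xi> i x) ` {1..m}))"
  have g: "gaussian_with M (\<xi> i) 1" if "i \<in> {1..m}" for i
    using measurable_linear_gaussian[OF w[OF that]] v[OF that] by simp
  have [measurable]: "\<xi> i \<in> borel_measurable M" if "i \<in> {1..m}" for i using gaussian_withD(1)[OF g[OF that]] .
  define A where "A i = {x \<in> space M. s \<le> \<xi> i x}" for i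
  have Am: "A i \<in> events" if "i \<in> {1..m}" for i unfolding A_def using that by measurable
  define p where "p = exp (- (s + 1)\<^sup>2 / 2) / sqrt (2 * pi)"
  define q where "q = exp (- s\<^sup>2 / (1 + e))"
  have pq: "p > 0" "q > 0" by (simp_all add: p_def q_def)
  have m0: "real m > 0" using m by simp
  have lower: "p \<le> prob (A i)" if "i \<in> {1..m}" for i
    unfolding A_def p_def by (rule gaussian_with_lower_tail[OF prob_space_axioms g[OF that] s])
  have upper: "prob (A i) \<le> exp (- s\<^sup>2 / 2)" if "i \<in> {1..m}" for i
    unfolding A_def using gaussian_with_upper_tail[OF prob_space_axioms g[OF that], of 1 s] s by simp
  have pair: "prob (A i \<inter> A j) \<le> q" if ij: "i \<in> {1..m}" "j \<in> {1..m}" "i \<noteq> j" for i j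
  proof -
    have ml: "measurable_linear M (\<lambda>x. \<xi> i x + \<xi> j x)" by (rule measurable_linear_add[OF w[OF ij(1)] w[OF ij(2)]])
    have [measurable]: "\<xi> i \<in> borel_measurable M" "\<xi> j \<in> borel_measurable M" using ij by simp_all
    have "prob (A i \<inter> A j) \<le> prob {x \<in> space M. 2 * s \<le> \<xi> i x + \<xi> j x}"
    proof (rule finite_measure_mono)
      show "{x \<in> space M. 2 * s \<le> \<xi> i x + \<xi> j x} \<in> events" by measurable
    qed (auto simp: A_def)
    also have "\<dots> \<le> exp (- (2 * s)\<^sup>2 / (2 * (2 + 2 * e)))"
      using e s corr[OF ij] by (intro gaussian_with_upper_tail[OF prob_space_axioms measurable_linear_gaussian[OF ml]]) auto
    also have "- (2 * s)\<^sup>2 / (2 * (2 + 2 * e)) = - s\<^sup>2 / (1 + e)" using e by (simp add: power2_eq_square field_simps)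
    finally show ?thesis by (simp add: q_def)
  qed
  have dbl: "(\<Sum>i\<in>{1..m}. \<Sum>j\<in>{1..m}. prob (A i \<inter> A j)) \<le> 2 * (real m)\<^sup>2 * q"
  proof -
    have "(\<Sum>i\<in>{1..m}. \<Sum>j\<in>{1..m}. prob (A i \<inter> A j))
        \<le> (\<Sum>i\<in>{1..m}. \<Sum>j\<in>{1..m}. q + (if i = j then exp (- s\<^sup>2 / 2) else 0))"
    proof (intro sum_mono)
      fix i j assume ij: "i \<in> {1..m}" "j \<in> {1..m}"
      show "prob (A i \<inter> A j) \<le> q + (if i = j then exp (- s\<^sup>2 / 2) else 0)"
      proof (cases "i = j")
        case True then show ?thesis using upper[OF ij(1)] pq by simp
      next
        case False then show ?thesis using pair[OF ij] by simp
      qed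
    qed
    also have "\<dots> = real m * (real m * q) + real m * exp (- s\<^sup>2 / 2)"
      by (simp add: sum.distrib distrib_left)
    also have "real m * exp (- s\<^sup>2 / 2) \<le> real m * (real m * q)"
    proof -
      have "exp (- s\<^sup>2 / 2) = exp (s\<^sup>2 / 2) * exp (- s\<^sup>2)" by (simp add: exp_add[symmetric])
      also have "\<dots> \<le> real m * exp (- s\<^sup>2)" using m by (intro mult_right_mono) auto
      also have "\<dots> \<le> real m * q"
      proof -
        have "s\<^sup>2 / (1 + e) \<le> s\<^sup>2 / 1" using e by (intro divide_left_mono) auto
        then have "exp (- s\<^sup>2) \<le> q" unfolding q_def by simp
        then show ?thesis by (intro mult_left_mono) auto
      qed
      finally show ?thesis by (intro mult_left_mono) auto
    qed
    finally show ?thesis by (simp add: power2_eq_square ac_simps)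
  qed
  \<comment> \<open>The maximizer of the quadratic lower bound for the probability of the union.\<close>
  define t where "t = p / (2 * real m * q)"
  have t: "t \<ge> 0" using pq m0 by (simp add: t_def)
  have U: "p\<^sup>2 / (2 * q) \<le> prob (\<Union>i\<in>{1..m}. A i)"
  proof -
    have "real m * p \<le> (\<Sum>i\<in>{1..m}. prob (A i))"
      using sum_mono[of "{1..m}" "\<lambda>_. p" "\<lambda>i. prob (A i)"] lower by simp
    then have "2 * t * (real m * p) \<le> 2 * t * (\<Sum>i\<in>{1..m}. prob (A i))" using t by (intro mult_left_mono) auto
    moreover have "t\<^sup>2 * (\<Sum>i\<in>{1..m}. \<Sum>j\<in>{1..m}. prob (A i \<inter> A j)) \<le> t\<^sup>2 * (2 * (real m)\<^sup>2 * q)"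
      using dbl by (intro mult_left_mono) auto
    moreover have "prob (\<Union>i\<in>{1..m}. A i) \<ge> 2 * t * (\<Sum>i\<in>{1..m}. prob (A i)) - t\<^sup>2 * (\<Sum>i\<in>{1..m}. \<Sum>j\<in>{1..m}. prob (A i \<inter> A j))"
      by (rule second_moment_union) (use Am in auto)
    moreover have "2 * t * (real m * p) = p\<^sup>2 / q" using m0 pq by (simp add: t_def power2_eq_square)
    moreover have "t\<^sup>2 * (2 * (real m)\<^sup>2 * q) = p\<^sup>2 / (2 * q)"
      using m0 pq by (simp add: t_def power2_eq_square)
    moreover have "p\<^sup>2 / q = p\<^sup>2 / (2 * q) + p\<^sup>2 / (2 * q)" using pq by (simp add: field_simps)
    ultimately show ?thesis by linarith
  qed
  have Fm: "F \<in> borel_measurable M" unfolding F_def by measurable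
  have "prob (\<Union>i\<in>{1..m}. A i) \<le> prob {x. s \<le> F x}"
  proof (rule finite_measure_mono)
    show "(\<Union>i\<in>{1..m}. A i) \<subseteq> {x. s \<le> F x}"
    proof
      fix x assume "x \<in> (\<Union>i\<in>{1..m}. A i)"
      then obtain i where i: "i \<in> {1..m}" "s \<le> \<xi> i x" by (auto simp: A_def)
      have "\<xi> i x \<le> F x" unfolding F_def using i(1) by (intro Max_ge) auto
      then show "x \<in> {x. s \<le> F x}" using i(2) by simp
    qed
    have "{x \<in> space M. s \<le> F x} \<in> events" using Fm by measurable
    then show "{x. s \<le> F x} \<in> events" by simp
  qed
  with U have "p\<^sup>2 / (2 * q) * prob {x. F x \<le> s - u} \<le> prob {x. s \<le> F x} * prob {x. F x \<le> s - u}"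
    by (intro mult_right_mono) auto
  also have "\<dots> \<le> exp (- 2 * u\<^sup>2 / pi\<^sup>2)"
    unfolding F_def by (rule max_concentration) (use m w v u in auto)
  finally have le: "p\<^sup>2 / (2 * q) * prob {x. F x \<le> s - u} \<le> exp (- 2 * u\<^sup>2 / pi\<^sup>2)" .
  have p2: "p\<^sup>2 / (2 * q) = exp (- (s + 1)\<^sup>2 + s\<^sup>2 / (1 + e)) / (4 * pi)"
  proof -
    have "(exp (- (s + 1)\<^sup>2 / 2))\<^sup>2 = exp (- (s + 1)\<^sup>2)" using exp_double[of "- (s + 1)\<^sup>2 / 2"] by simp
    then have "p\<^sup>2 = exp (- (s + 1)\<^sup>2) / (2 * pi)" unfolding p_def power_divide by simp
    moreover have "exp (- (s + 1)\<^sup>2 + s\<^sup>2 / (1 + e)) = exp (- (s + 1)\<^sup>2) / exp (- s\<^sup>2 / (1 + e))"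
      unfolding exp_diff[symmetric] by simp
    ultimately show ?thesis by (simp add: q_def)
  qed
  have pos: "p\<^sup>2 / (2 * q) > 0" using pq by simp
  have "prob {x. F x \<le> s - u} * (p\<^sup>2 / (2 * q)) \<le> exp (- 2 * u\<^sup>2 / pi\<^sup>2)" using le by (simp only: mult.commute)
  then have "prob {x. F x \<le> s - u} \<le> exp (- 2 * u\<^sup>2 / pi\<^sup>2) / (p\<^sup>2 / (2 * q))"
    by (rule pos_le_divide_eq[OF pos, THEN iffD2])
  also have "\<dots> = 4 * pi * exp (- 2 * u\<^sup>2 / pi\<^sup>2 - (- (s + 1)\<^sup>2 + s\<^sup>2 / (1 + e)))"
    unfolding p2 by (simp add: exp_diff)
  also have "\<dots> \<le> 4 * pi * exp (e * s\<^sup>2 + 2 * s + 1 - 2 * u\<^sup>2 / pi\<^sup>2)"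
  proof -
    have "s\<^sup>2 - s\<^sup>2 / (1 + e) = s\<^sup>2 * (e / (1 + e))" using e by (simp add: field_simps)
    also have "\<dots> \<le> s\<^sup>2 * e" using e by (intro mult_left_mono) (auto simp: divide_le_eq)
    finally have "s\<^sup>2 - s\<^sup>2 / (1 + e) \<le> s\<^sup>2 * e" .
    moreover have "(s + 1)\<^sup>2 = s\<^sup>2 + 2 * s + 1" by (simp add: power2_eq_square algebra_simps)
    ultimately have "- 2 * u\<^sup>2 / pi\<^sup>2 - (- (s + 1)\<^sup>2 + s\<^sup>2 / (1 + e)) \<le> e * s\<^sup>2 + 2 * s + 1 - 2 * u\<^sup>2 / pi\<^sup>2"
      by (simp add: mult.commute)
    then show ?thesis by (intro mult_left_mono) auto
  qed
  finally show ?thesis by (simp add: F_def)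
qed

lemma tendsto_exp_quadratic:
  assumes "\<kappa> > 0" "filterlim a at_top sequentially"
  shows "(\<lambda>m. 4 * pi * exp (- \<kappa> * (a m)\<^sup>2 + 2 * a m + 1)) \<longlonglongrightarrow> 0"
proof (rule tendsto_sandwich[of "\<lambda>_. 0" _ _ "\<lambda>m. 4 * pi * exp (1 - 2 * a m)"])
  have "\<forall>\<^sub>F m in sequentially. 4 / \<kappa> \<le> a m" using assms(2) unfolding filterlim_at_top by blast
  then show "\<forall>\<^sub>F m in sequentially. 4 * pi * exp (- \<kappa> * (a m)\<^sup>2 + 2 * a m + 1) \<le> 4 * pi * exp (1 - 2 * a m)"
  proof eventually_elim
    case (elim m)
    then have "4 \<le> \<kappa> * a m" using assms(1) by (simp add: field_simps)
    moreover have "a m \<ge> 0" using elim assms(1) by (smt (verit) divide_pos_pos)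
    ultimately have "4 * a m \<le> \<kappa> * a m * a m" by (rule mult_right_mono)
    then have "- \<kappa> * (a m)\<^sup>2 + 2 * a m + 1 \<le> 1 - 2 * a m" by (simp add: power2_eq_square mult.assoc)
    then show ?case by (intro mult_left_mono) auto
  qed
  have "filterlim (\<lambda>m. 1 - 2 * a m) at_bot sequentially"
    unfolding filterlim_at_bot
  proof
    fix Z :: real
    have "\<forall>\<^sub>F m in sequentially. (1 - Z) / 2 \<le> a m" using assms(2) unfolding filterlim_at_top by blast
    then show "\<forall>\<^sub>F m in sequentially. 1 - 2 * a m \<le> Z" by eventually_elim simp
  qed
  then have "(\<lambda>m. exp (1 - 2 * a m)) \<longlonglongrightarrow> 0" by (rule filterlim_compose[OF exp_at_bot])
  then show "(\<lambda>m. 4 * pi * exp (1 - 2 * a m)) \<longlonglongrightarrow> 0" by (rule tendsto_mult_right_zero)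
qed auto

text \<open>Only the terms with index divisible by \<open>d\<close> are used. Their correlations are small, at the
  cost of a factor \<open>d\<close> in the index, which the logarithm does not see.\<close>

theorem growth_lower:
  assumes w: "\<And>i. measurable_linear M (\<xi> i)" and v: "\<And>i. var (\<xi> i) = 1"
    and corr: "\<And>e. e > 0 \<Longrightarrow> \<exists>d\<ge>1. \<forall>i j. i + d \<le> j \<longrightarrow> var (\<lambda>x. \<xi> i x + \<xi> j x) \<le> 2 + 2 * e"
    and \<delta>: "0 < \<delta>" "\<delta> < 1"
  shows "AE x in M. \<forall>K. \<exists>N\<ge>K. (1 - \<delta>) * sqrt (2 * ln (real N)) \<le> \<xi> N x"
proof -
  define \<kappa> where "\<kappa> = (\<delta> / 2)\<^sup>2 / pi\<^sup>2"
  have \<kappa>: "\<kappa> > 0" using \<delta> by (simp add: \<kappa>_def)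
  obtain d where d: "d \<ge> 1" "\<And>i j. i + d \<le> j \<Longrightarrow> var (\<lambda>x. \<xi> i x + \<xi> j x) \<le> 2 + 2 * \<kappa>"
    using corr[OF \<kappa>] by blast
  define \<zeta> where "\<zeta> j = \<xi> (j * d)" for j
  define a where "a m = sqrt (2 * ln (real m))" for m :: nat
  define F where "F m x = Max ((\<lambda>j. \<zeta> j x) ` {1..m})" for m x
  have lnlim: "filterlim (\<lambda>m. ln (real m)) at_top sequentially"
    by (rule filterlim_compose[OF ln_at_top filterlim_real_sequentially])
  have alim: "filterlim a at_top sequentially"
    unfolding a_def
    by (intro filterlim_compose[OF sqrt_at_top] filterlim_tendsto_pos_mult_at_top[OF tendsto_const _ lnlim]) simp
  have wb [measurable]: "\<zeta> j \<in> borel_measurable M" for j unfolding \<zeta>_def using w by (rule measurable_linear_measurable)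
  have Fm [measurable]: "F m \<in> borel_measurable M" for m unfolding F_def by measurable
  have prob: "prob {x \<in> space M. F m x \<le> (1 - \<delta> / 2) * a m} \<le> 4 * pi * exp (- \<kappa> * (a m)\<^sup>2 + 2 * a m + 1)" if m: "m \<ge> 1" for m
  proof -
    have L: "ln (real m) \<ge> 0" using m by simp
    have a0: "a m \<ge> 0" by (simp add: a_def L)
    have "exp ((a m)\<^sup>2 / 2) \<le> real m" using m L by (simp add: a_def)
    then have "measure M {x. Max ((\<lambda>j. \<zeta> j x) ` {1..m}) \<le> a m - \<delta> / 2 * a m}
        \<le> 4 * pi * exp (\<kappa> * (a m)\<^sup>2 + 2 * a m + 1 - 2 * (\<delta> / 2 * a m)\<^sup>2 / pi\<^sup>2)"
    proof (intro max_lower_probability)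
      fix i j :: nat assume "i \<in> {1..m}" "j \<in> {1..m}" "i \<noteq> j"
      show "var (\<lambda>x. \<zeta> i x + \<zeta> j x) \<le> 2 + 2 * \<kappa>"
      proof (cases "i < j")
        case True
        then have "Suc i * d \<le> j * d" by (intro mult_le_mono1) simp
        then have "i * d + d \<le> j * d" by simp
        from d(2)[OF this] show ?thesis by (simp add: \<zeta>_def)
      next
        case False
        then have "Suc j * d \<le> i * d" using \<open>i \<noteq> j\<close> by (intro mult_le_mono1) simp
        then have "j * d + d \<le> i * d" by simp
        from d(2)[OF this] show ?thesis by (simp add: \<zeta>_def add.commute)
      qed
    qed (use w v \<kappa> a0 m \<delta> in \<open>auto simp: \<zeta>_def\<close>)
    moreover have "2 * (\<delta> / 2 * a m)\<^sup>2 / pi\<^sup>2 = 2 * \<kappa> * (a m)\<^sup>2" by (simp add: \<kappa>_def power2_eq_square)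
    ultimately show ?thesis by (simp add: F_def algebra_simps)
  qed
  have "AE x in M. \<forall>K. \<exists>m\<ge>K. (1 - \<delta> / 2) * a m < F m x"
    unfolding AE_all_countable
  proof
    fix K
    define B where "B = {x \<in> space M. \<forall>m\<ge>K. F m x \<le> (1 - \<delta> / 2) * a m}"
    have Bm [measurable]: "B \<in> events" unfolding B_def by measurable
    have "prob B \<le> 4 * pi * exp (- \<kappa> * (a m)\<^sup>2 + 2 * a m + 1)" if "m \<ge> max 1 K" for m
    proof -
      have "prob B \<le> prob {x \<in> space M. F m x \<le> (1 - \<delta> / 2) * a m}"
        using that by (intro finite_measure_mono) (auto simp: B_def)
      also have "\<dots> \<le> 4 * pi * exp (- \<kappa> * (a m)\<^sup>2 + 2 * a m + 1)" using that by (intro prob) simp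
      finally show ?thesis .
    qed
    then have "prob B \<le> 0" by (intro LIMSEQ_le_const[OF tendsto_exp_quadratic[OF \<kappa> alim]]) blast
    then have "emeasure M B = 0" by (simp add: emeasure_eq_measure measure_le_0_iff)
    then have "AE x in M. x \<notin> B" by (rule AE_not_in[OF null_setsI[OF _ Bm]])
    then show "AE x in M. \<exists>m\<ge>K. (1 - \<delta> / 2) * a m < F m x"
      by eventually_elim (auto simp: B_def not_le)
  qed
  then show ?thesis
  proof (rule AE_mp, intro AE_I2 impI allI)
    fix x K assume x: "\<forall>K. \<exists>m\<ge>K. (1 - \<delta> / 2) * a m < F m x"
    define R where "R = Max (insert 0 ((\<lambda>N. \<xi> N x) ` {..<K}))"
    have R: "\<xi> N x \<le> R" if "N < K" for N unfolding R_def using that by (intro Max_ge) auto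
    have "\<forall>\<^sub>F m in sequentially. R / (1 - \<delta> / 2) \<le> a m" using alim unfolding filterlim_at_top by blast
    moreover have "\<forall>\<^sub>F m in sequentially. ((1 - \<delta>)\<^sup>2 * ln (real d)) / ((1 - \<delta> / 2)\<^sup>2 - (1 - \<delta>)\<^sup>2) \<le> ln (real m)"
      using lnlim unfolding filterlim_at_top by blast
    ultimately have "\<forall>\<^sub>F m in sequentially. R / (1 - \<delta> / 2) \<le> a m \<and>
        ((1 - \<delta>)\<^sup>2 * ln (real d)) / ((1 - \<delta> / 2)\<^sup>2 - (1 - \<delta>)\<^sup>2) \<le> ln (real m)" by (rule eventually_conj)
    then obtain m0 where m0: "\<And>m. m \<ge> m0 \<Longrightarrow> R / (1 - \<delta> / 2) \<le> a m"
        "\<And>m. m \<ge> m0 \<Longrightarrow> ((1 - \<delta>)\<^sup>2 * ln (real d)) / ((1 - \<delta> / 2)\<^sup>2 - (1 - \<delta>)\<^sup>2) \<le> ln (real m)"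
      unfolding eventually_sequentially by blast
    obtain m where m: "m \<ge> max 1 m0" "(1 - \<delta> / 2) * a m < F m x" using x by blast
    then have m1: "m \<ge> 1" "m \<ge> m0" by auto
    have "F m x \<in> (\<lambda>j. \<zeta> j x) ` {1..m}" unfolding F_def using m1 by (intro Max_in) auto
    then obtain j where j: "j \<in> {1..m}" "F m x = \<zeta> j x" by blast
    define N where "N = j * d"
    have \<xi>N: "(1 - \<delta> / 2) * a m < \<xi> N x" using m(2) j(2) by (simp add: \<zeta>_def N_def)
    have "R \<le> (1 - \<delta> / 2) * a m" using m0(1)[OF m1(2)] \<delta> by (simp add: pos_divide_le_eq mult.commute)
    then have "N \<ge> K" using R[of N] \<xi>N by (meson not_le_imp_less not_less order.trans leD order_le_less_trans)
    moreover have "(1 - \<delta>) * sqrt (2 * ln (real N)) \<le> \<xi> N x"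
    proof -
      have N: "1 \<le> N" "N \<le> m * d" using j d(1) by (auto simp: N_def)
      have "0 < real N" "0 < real (m * d)" "real N \<le> real (m * d)"
        using N by (simp_all only: of_nat_0_less_iff of_nat_le_iff)
      then have "ln (real N) \<le> ln (real (m * d))" by (simp only: ln_le_cancel_iff)
      also have "\<dots> = ln (real m) + ln (real d)" using m1 d(1) by (simp add: ln_mult)
      finally have ln: "ln (real N) \<le> ln (real m) + ln (real d)" .
      have pos: "(1 - \<delta> / 2)\<^sup>2 - (1 - \<delta>)\<^sup>2 > 0" using \<delta> by (simp add: power_strict_mono)
      have "(1 - \<delta>)\<^sup>2 * ln (real d) \<le> ln (real m) * ((1 - \<delta> / 2)\<^sup>2 - (1 - \<delta>)\<^sup>2)"
        using m0(2)[OF m1(2)] pos by (simp add: pos_divide_le_eq)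
      moreover have "(1 - \<delta>)\<^sup>2 * ln (real N) \<le> (1 - \<delta>)\<^sup>2 * (ln (real m) + ln (real d))" using ln by (intro mult_left_mono) auto
      ultimately have "(1 - \<delta>)\<^sup>2 * ln (real N) \<le> (1 - \<delta> / 2)\<^sup>2 * ln (real m)" by (simp add: algebra_simps)
      then have "(1 - \<delta>)\<^sup>2 * (2 * ln (real N)) \<le> (1 - \<delta> / 2)\<^sup>2 * (2 * ln (real m))" by simp
      then have "sqrt ((1 - \<delta>)\<^sup>2 * (2 * ln (real N))) \<le> sqrt ((1 - \<delta> / 2)\<^sup>2 * (2 * ln (real m)))" by (rule real_sqrt_le_mono)
      then have "(1 - \<delta>) * sqrt (2 * ln (real N)) \<le> (1 - \<delta> / 2) * a m"
        using \<delta> by (simp add: real_sqrt_mult a_def)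
      then show ?thesis using \<xi>N by simp
    qed
    ultimately show "\<exists>N\<ge>K. (1 - \<delta>) * sqrt (2 * ln (real N)) \<le> \<xi> N x" by blast
  qed
qed

end

section \<open>The measurable linear extension and its iterates\<close>

locale extended_coisometry = abstract_wiener_space M \<iota>
  for M :: "'a::{banach, second_countable_topology} measure"
    and \<iota> :: "'h::{real_inner, complete_space} \<Rightarrow> 'a" +
  fixes S :: "'h \<Rightarrow> 'h" and E :: "'a set" and T :: "'a \<Rightarrow> 'a"
  assumes bounded_linear_S: "bounded_linear S"
    and S_adjoint_S: "S \<circ> adjoint S = id"
    and extension: "measurable_linear_extension M \<iota> S E T"
begin

abbreviation U :: "'h \<Rightarrow> 'h" where "U \<equiv> adjoint S"

lemma inner_S: "inner (S x) y = inner x (U y)"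
  by (rule adjoint_exists[OF bounded_linear_S])

lemma S_U [simp]: "S (U x) = x"
  using S_adjoint_S by (metis comp_apply id_apply)

lemma norm_U [simp]: "norm (U x) = norm x"
proof -
  have "inner (U x) (U x) = inner x x" using inner_S[of "U x" x] by simp
  then show ?thesis by (simp add: norm_eq_sqrt_inner)
qed

lemma linear_U: "linear U"
proof (rule linearI)
  fix x y
  have "inner z (U (x + y)) = inner z (U x + U y)" for z
    unfolding inner_add_right inner_S[symmetric] ..
  then show "U (x + y) = U x + U y" using vector_eq_ldot by blast
next
  fix c x
  have "inner z (U (c *\<^sub>R x)) = inner z (c *\<^sub>R U x)" for z
    unfolding inner_scaleR_right inner_S[symmetric] ..
  then show "U (c *\<^sub>R x) = c *\<^sub>R U x" using vector_eq_ldot by blast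
qed

lemma norm_U_pow [simp]: "norm ((U ^^ n) x) = norm x"
  by (induction n) simp_all

lemma linear_U_pow: "linear (U ^^ n)"
proof (induction n)
  case 0 then show ?case by (simp add: id_def linear_ident)
next
  case (Suc n)
  show ?case unfolding funpow.simps by (rule linear_compose[OF Suc linear_U])
qed

lemma inner_S_pow: "inner ((S ^^ n) x) y = inner x ((U ^^ n) y)"
proof (induction n arbitrary: y)
  case (Suc n)
  have "inner ((S ^^ Suc n) x) y = inner ((S ^^ n) x) (U y)" by (simp add: inner_S)
  also have "\<dots> = inner x ((U ^^ n) (U y))" by (rule Suc)
  finally show ?case by (simp add: funpow_swap1)
qed simp

lemma inner_U_pow_U_pow: "inner ((U ^^ i) x) ((U ^^ (i + n)) y) = inner x ((U ^^ n) y)"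
proof (induction i)
  case (Suc i)
  have "inner ((U ^^ Suc i) x) ((U ^^ (Suc i + n)) y) = inner (U ((U ^^ i) x)) (U ((U ^^ (i + n)) y))" by simp
  also have "\<dots> = inner ((U ^^ i) x) ((U ^^ (i + n)) y)" unfolding inner_S[symmetric] by simp
  finally show ?case using Suc by simp
qed simp

lemma E: "subspace E" "E \<in> sets borel" "AE x in M. x \<in> E" "\<iota> h \<in> E" "T (\<iota> h) = \<iota> (S h)"
  "linear_on_subspace E T" "T \<in> restrict_space borel E \<rightarrow>\<^sub>M borel"
proof -
  note e = extension[unfolded measurable_linear_extension_def]
  show "subspace E" "E \<in> sets borel" "\<iota> h \<in> E" "T (\<iota> h) = \<iota> (S h)" "T \<in> restrict_space borel E \<rightarrow>\<^sub>M borel" using e by blast+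
  show "linear_on_subspace E T" using e unfolding linear_on_subspace_def by blast
  have "E \<in> events" using e sets_M by blast
  moreover have "prob E = 1" using e by (simp add: emeasure_eq_measure)
  ultimately show "AE x in M. x \<in> E" by (simp add: AE_in_set_eq_1)
qed

text \<open>The values of \<open>T\<close> outside \<open>E\<close> are replaced by \<open>0\<close> to obtain a Borel map.\<close>

definition T\<^sub>0 :: "'a \<Rightarrow> 'a" where "T\<^sub>0 x = (if x \<in> E then T x else 0)"

lemma T0_measurable [measurable]: "T\<^sub>0 \<in> borel \<rightarrow>\<^sub>M borel"
  unfolding T\<^sub>0_def using E(2,7) by (subst measurable_restrict_space_iff[symmetric]) simp_all

lemma T0_pow_measurable [measurable]: "T\<^sub>0 ^^ n \<in> borel \<rightarrow>\<^sub>M borel"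
  by (induction n) (auto intro: measurable_comp T0_measurable simp: id_def)

lemma linear_T0: "linear_on_subspace E T\<^sub>0"
  using E(6) E(1) unfolding linear_on_subspace_def T\<^sub>0_def by (simp add: subspace_add subspace_scale)

lemma represents_T0:
  assumes f: "bounded_linear f" shows "represents (\<lambda>x. f (T\<^sub>0 x)) (U (riesz f))"
  unfolding represents_def
proof (intro conjI allI)
  have [measurable]: "f \<in> borel_measurable borel" by (rule bounded_linear_borel[OF f])
  have "linear_on_subspace E (\<lambda>x. f (T\<^sub>0 x))"
    using linear_T0 f unfolding linear_on_subspace_def by (simp add: linear_add linear_cmul bounded_linear.linear)
  moreover have "full_subspace M E" using E by (simp add: full_subspace_def)
  ultimately show "measurable_linear M (\<lambda>x. f (T\<^sub>0 x))" unfolding measurable_linear_def by (intro conjI exI[of _ E]) simp_all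
  show "f (T\<^sub>0 (\<iota> k)) = inner (U (riesz f)) k" for k
    using E(4,5) functional_eq_inner[OF f, of "S k"] inner_S[of k "riesz f"] by (simp add: T\<^sub>0_def inner_commute)
qed

text \<open>The functional \<open>f \<circ> T\<^sub>0\<close> represents \<open>U (riesz f)\<close>, which has the norm of \<open>riesz f\<close> since \<open>U\<close> is an
  isometry; so \<open>f\<close> and \<open>f \<circ> T\<^sub>0\<close> have the same Gaussian law.\<close>

theorem T0_preserves: "distr M borel T\<^sub>0 = M"
proof (rule measure_eqI_functionals)
  have Tm: "T\<^sub>0 \<in> M \<rightarrow>\<^sub>M borel" by (rule borel_measurable_M) simp
  show "prob_space (distr M borel T\<^sub>0)" by (rule prob_space_distr[OF Tm])
  show "prob_space M" by (rule prob_space_axioms)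
  show "sets M = sets borel" by (rule sets_M)
  fix f :: "'a \<Rightarrow> real" assume f: "bounded_linear f"
  have "distr (distr M borel T\<^sub>0) borel f = distr M borel (f \<circ> T\<^sub>0)"
    by (rule distr_distr[OF _ Tm]) (use bounded_linear_borel[OF f] in simp)
  also have "\<dots> = normal_law ((norm (U (riesz f)))\<^sup>2)"
    using gaussian_withD(3)[OF represents_gaussian[OF represents_T0[OF f]]] by (simp add: o_def)
  also have "\<dots> = distr M borel f"
    using gaussian_withD(3)[OF represents_gaussian[OF represents_functional[OF f]]] by simp
  finally show "distr (distr M borel T\<^sub>0) borel f = distr M borel f" .
qed simp

lemma T0_pow_preserves: "distr M borel (T\<^sub>0 ^^ n) = M"
proof (induction n)
  case 0
  then show ?case by (simp add: id_def distr_id2 sets_M)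
next
  case (Suc n)
  have "distr M borel (T\<^sub>0 ^^ Suc n) = distr M borel (T\<^sub>0 \<circ> T\<^sub>0 ^^ n)" by simp
  also have "\<dots> = distr (distr M borel (T\<^sub>0 ^^ n)) borel T\<^sub>0"
    by (rule distr_distr[symmetric]) (simp_all add: borel_measurable_M)
  finally show ?case unfolding Suc T0_preserves .
qed

text \<open>The subspace on which all iterates of \<open>T\<close> are defined.\<close>

definition E\<^sub>\<omega> :: "'a set" where "E\<^sub>\<omega> = {x. \<forall>k. (T\<^sub>0 ^^ k) x \<in> E}"

lemma T0_pow_add: "x \<in> E\<^sub>\<omega> \<Longrightarrow> y \<in> E\<^sub>\<omega> \<Longrightarrow> (T\<^sub>0 ^^ k) (x + y) = (T\<^sub>0 ^^ k) x + (T\<^sub>0 ^^ k) y"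
proof (induction k)
  case (Suc k)
  then have "(T\<^sub>0 ^^ k) x \<in> E" "(T\<^sub>0 ^^ k) y \<in> E" by (auto simp: E\<^sub>\<omega>_def)
  then show ?case using linear_T0 Suc by (simp add: linear_on_subspace_def)
qed simp

lemma T0_pow_scale: "x \<in> E\<^sub>\<omega> \<Longrightarrow> (T\<^sub>0 ^^ k) (c *\<^sub>R x) = c *\<^sub>R (T\<^sub>0 ^^ k) x"
proof (induction k)
  case (Suc k)
  then have "(T\<^sub>0 ^^ k) x \<in> E" by (auto simp: E\<^sub>\<omega>_def)
  then show ?case using linear_T0 Suc by (simp add: linear_on_subspace_def)
qed simp

lemma T0_pow_incl: "(T\<^sub>0 ^^ k) (\<iota> h) = \<iota> ((S ^^ k) h)"
  by (induction k) (simp_all add: T\<^sub>0_def E(4,5))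

lemma full_subspace_E_omega: "full_subspace M E\<^sub>\<omega>"
  unfolding full_subspace_def
proof (intro conjI)
  show "subspace E\<^sub>\<omega>"
    unfolding subspace_def
  proof (intro conjI ballI allI)
    show "0 \<in> E\<^sub>\<omega>" using T0_pow_incl[of _ 0] E(4) linear_0[OF linear_incl] by (simp add: E\<^sub>\<omega>_def)
    show "x + y \<in> E\<^sub>\<omega>" if "x \<in> E\<^sub>\<omega>" "y \<in> E\<^sub>\<omega>" for x y
      using that E(1) T0_pow_add[OF that] by (simp add: E\<^sub>\<omega>_def subspace_add)
    show "c *\<^sub>R x \<in> E\<^sub>\<omega>" if "x \<in> E\<^sub>\<omega>" for c x
      using that E(1) T0_pow_scale[OF that] by (simp add: E\<^sub>\<omega>_def subspace_scale)
  qed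
  have [measurable]: "E \<in> sets borel" by (rule E(2))
  have "{x \<in> space borel. \<forall>k. (T\<^sub>0 ^^ k) x \<in> E} \<in> sets borel" by measurable
  then show "E\<^sub>\<omega> \<in> sets borel" by (simp add: E\<^sub>\<omega>_def)
  have "AE x in M. (T\<^sub>0 ^^ k) x \<in> E" for k
  proof (rule AE_distrD[of "T\<^sub>0 ^^ k" M borel "\<lambda>x. x \<in> E"])
    show "T\<^sub>0 ^^ k \<in> M \<rightarrow>\<^sub>M borel" by (rule borel_measurable_M) simp
    show "AE x in distr M borel (T\<^sub>0 ^^ k). x \<in> E" unfolding T0_pow_preserves by (rule E(3))
  qed
  then show "AE x in M. x \<in> E\<^sub>\<omega>" by (simp add: E\<^sub>\<omega>_def AE_all_countable)
qed

lemma T_pow_eq: "x \<in> E\<^sub>\<omega> \<Longrightarrow> (T ^^ k) x = (T\<^sub>0 ^^ k) x"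
proof (induction k)
  case (Suc k)
  then have "(T\<^sub>0 ^^ k) x \<in> E" by (auto simp: E\<^sub>\<omega>_def)
  then have "T\<^sub>0 ((T\<^sub>0 ^^ k) x) = T ((T\<^sub>0 ^^ k) x)" by (simp only: T\<^sub>0_def if_True)
  then show ?case using Suc by simp
qed simp

theorem represents_orbit:
  assumes f: "bounded_linear f" shows "represents (\<lambda>x. f ((T\<^sub>0 ^^ n) x)) ((U ^^ n) (riesz f))"
  unfolding represents_def
proof (intro conjI allI)
  have [measurable]: "f \<in> borel_measurable borel" by (rule bounded_linear_borel[OF f])
  have "linear_on_subspace E\<^sub>\<omega> (\<lambda>x. f ((T\<^sub>0 ^^ n) x))"
    using T0_pow_add T0_pow_scale f unfolding linear_on_subspace_def
    by (simp add: linear_add linear_cmul bounded_linear.linear)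
  then show "measurable_linear M (\<lambda>x. f ((T\<^sub>0 ^^ n) x))"
    unfolding measurable_linear_def using full_subspace_E_omega by (intro conjI exI[of _ "E\<^sub>\<omega>"]) simp_all
  show "f ((T\<^sub>0 ^^ n) (\<iota> k)) = inner ((U ^^ n) (riesz f)) k" for k
    using functional_eq_inner[OF f, of "(S ^^ n) k"] inner_S_pow[of n k "riesz f"]
    by (simp add: T0_pow_incl inner_commute)
qed

end

section \<open>Compactness and limit points\<close>

text \<open>Mazur's theorem: within \<open>e / 4\<close>, the hull is contained in the compact convex hull of a finite
  net, which has a finite net itself.\<close>

lemma compact_closure_convex_hull:
  fixes K :: "'a::banach set"
  assumes "compact K" shows "compact (closure (convex hull K))"
  unfolding compact_eq_totally_bounded
proof (intro conjI allI impI)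
  show "Topological_Spaces.complete (closure (convex hull K))" by (simp add: complete_eq_closed)
  fix e :: real assume e: "e > 0"
  have tb: "\<exists>k. finite k \<and> S \<subseteq> (\<Union>x\<in>k. ball x (e / 4))" if "compact S" for S :: "'a set"
    using that e unfolding compact_eq_totally_bounded by simp
  obtain k where k: "finite k" "K \<subseteq> (\<Union>x\<in>k. ball x (e / 4))" using tb[OF assms] by blast
  define C where "C = convex hull k"
  have "compact C" unfolding C_def by (rule finite_imp_compact_convex_hull[OF k(1)])
  then obtain k' where k': "finite k'" "C \<subseteq> (\<Union>x\<in>k'. ball x (e / 4))" using tb by blast
  define D where "D = (\<Union>x\<in>C. \<Union>y\<in>cball 0 (e / 4). {x + y})"
  have "convex D" unfolding D_def C_def by (intro convex_sums convex_convex_hull convex_cball)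
  have "K \<subseteq> D"
  proof
    fix x assume "x \<in> K"
    then obtain c where c: "c \<in> k" "dist c x < e / 4" using k(2) by auto
    have "c \<in> C" unfolding C_def using c(1) by (rule hull_inc)
    moreover have "x - c \<in> cball 0 (e / 4)" using c(2) by (simp add: dist_norm norm_minus_commute)
    moreover have "x = c + (x - c)" by simp
    ultimately show "x \<in> D" unfolding D_def by blast
  qed
  then have hull: "convex hull K \<subseteq> D" using \<open>convex D\<close> by (rule hull_minimal)
  have "closure (convex hull K) \<subseteq> (\<Union>x\<in>k'. ball x e)"
  proof
    fix y assume "y \<in> closure (convex hull K)"
    then obtain z where z: "z \<in> convex hull K" "dist z y < e / 4"
      using e unfolding closure_approachable by (meson divide_pos_pos zero_less_numeral)
    then obtain c b where c: "c \<in> C" "norm b \<le> e / 4" "z = c + b" using hull by (auto simp: D_def)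
    then obtain x where x: "x \<in> k'" "dist x c < e / 4" using k'(2) by auto
    have "dist c z \<le> e / 4" using c by (simp add: dist_norm)
    then have "dist x y < e"
      using dist_triangle[of x y c] dist_triangle[of c y z] x(2) z(2) e by linarith
    then show "y \<in> (\<Union>x\<in>k'. ball x e)" using x(1) by auto
  qed
  then show "\<exists>k. finite k \<and> closure (convex hull K) \<subseteq> (\<Union>x\<in>k. ball x e)" using k'(1) by blast
qed

lemma seq_limit_points_iff:
  fixes u :: "nat \<Rightarrow> 'a::metric_space"
  shows "l \<in> seq_limit_points u \<longleftrightarrow> (\<forall>e>0. \<forall>K. \<exists>n\<ge>K. dist (u n) l < e)"
proof
  assume "l \<in> seq_limit_points u"
  then obtain r where r: "strict_mono r" "(u \<circ> r) \<longlonglongrightarrow> l" by (auto simp: seq_limit_points_def)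
  show "\<forall>e>0. \<forall>K. \<exists>n\<ge>K. dist (u n) l < e"
  proof (intro allI impI)
    fix e :: real and K :: nat assume "e > 0"
    then obtain N where N: "\<And>n. n \<ge> N \<Longrightarrow> dist ((u \<circ> r) n) l < e" using r(2) unfolding lim_sequentially by blast
    have "r (max N K) \<ge> K" using seq_suble[OF r(1), of "max N K"] by simp
    moreover have "dist (u (r (max N K))) l < e" using N[of "max N K"] by simp
    ultimately show "\<exists>n\<ge>K. dist (u n) l < e" by blast
  qed
next
  assume *: "\<forall>e>0. \<forall>K. \<exists>n\<ge>K. dist (u n) l < e"
  have "\<exists>r. \<forall>n. dist (u (r n)) l < 1 / real (Suc n) \<and> r n < r (Suc n)"
  proof (rule dependent_nat_choice)
    show "\<exists>x. dist (u x) l < 1 / real (Suc 0)" using *[rule_format, of 1 0] by auto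
    show "\<exists>y. dist (u y) l < 1 / real (Suc (Suc n)) \<and> x < y" for x n
      using *[rule_format, of "1 / real (Suc (Suc n))" "Suc x"] by (auto simp: Suc_le_eq)
  qed
  then obtain r where r: "\<And>n. dist (u (r n)) l < 1 / real (Suc n)" "\<And>n. r n < r (Suc n)" by blast
  have "strict_mono r" using r(2) by (simp add: strict_mono_Suc_iff)
  moreover have "(\<lambda>n. dist ((u \<circ> r) n) l) \<longlonglongrightarrow> 0"
  proof (rule tendsto_sandwich[of "\<lambda>_. 0" _ _ "\<lambda>n. 1 / real (Suc n)"])
    show "(\<lambda>n. 1 / real (Suc n)) \<longlonglongrightarrow> 0" by (rule LIMSEQ_Suc[OF lim_1_over_n])
    show "\<forall>\<^sub>F n in sequentially. dist ((u \<circ> r) n) l \<le> 1 / real (Suc n)" using r(1) by (auto intro!: always_eventually less_imp_le)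
  qed auto
  then have "(u \<circ> r) \<longlonglongrightarrow> l" using tendsto_dist_iff by blast
  ultimately show "l \<in> seq_limit_points u" by (auto simp: seq_limit_points_def)
qed

lemma closed_seq_limit_points:
  fixes u :: "nat \<Rightarrow> 'a::metric_space"
  shows "closed (seq_limit_points u)"
  unfolding closed_sequential_limits
proof (intro allI impI, elim conjE)
  fix x l assume x: "\<forall>n. x n \<in> seq_limit_points u" "x \<longlonglongrightarrow> l"
  show "l \<in> seq_limit_points u"
    unfolding seq_limit_points_iff
  proof (intro allI impI)
    fix e :: real and K :: nat assume e: "e > 0"
    then obtain n where n: "dist (x n) l < e / 2" using x(2) unfolding lim_sequentially by (meson half_gt_zero order_refl)
    have "e / 2 > 0" using e by simp
    then obtain m where "m \<ge> K" "dist (u m) (x n) < e / 2"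
      using x(1) unfolding seq_limit_points_iff by blast
    then show "\<exists>m\<ge>K. dist (u m) l < e" using dist_triangle_half_r[of "x n" "u m" e l] n
      by (meson dist_commute_lessI dist_triangle_half_l)
  qed
qed

text \<open>Limit points along indices with a prescribed property; the indices \<open>r k\<close> need not increase.\<close>

lemma compact_infinitely_often:
  fixes u :: "nat \<Rightarrow> 'a::metric_space"
  assumes C: "compact C" and io: "\<And>k. \<exists>n\<ge>k. u n \<in> C \<and> P k n"
  obtains l r where "l \<in> seq_limit_points u" "l \<in> C" "\<And>k. u (r k) \<in> C" "\<And>k. P k (r k)" "\<And>k. r k \<ge> k"
    "\<exists>s. strict_mono s \<and> (\<lambda>k. u (r (s k))) \<longlonglongrightarrow> l"
proof -
  have "\<exists>r. \<forall>k. r k \<ge> k \<and> u (r k) \<in> C \<and> P k (r k)" using io by (intro choice) blast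
  then obtain r where r: "\<And>k. r k \<ge> k" "\<And>k. u (r k) \<in> C" "\<And>k. P k (r k)" by blast
  obtain l s where ls: "l \<in> C" "strict_mono s" "((\<lambda>k. u (r k)) \<circ> s) \<longlonglongrightarrow> l"
    using C r(2) unfolding compact_def by meson
  have "l \<in> seq_limit_points u"
    unfolding seq_limit_points_iff
  proof (intro allI impI)
    fix e :: real and K :: nat assume "e > 0"
    then obtain N where N: "\<And>n. n \<ge> N \<Longrightarrow> dist (((\<lambda>k. u (r k)) \<circ> s) n) l < e" using ls(3) unfolding lim_sequentially by blast
    have "r (s (max N K)) \<ge> K" using r(1)[of "s (max N K)"] seq_suble[OF ls(2), of "max N K"] by simp
    moreover have "dist (u (r (s (max N K)))) l < e" using N[of "max N K"] by simp
    ultimately show "\<exists>n\<ge>K. dist (u n) l < e" by blast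
  qed
  moreover have "\<exists>s. strict_mono s \<and> (\<lambda>k. u (r (s k))) \<longlonglongrightarrow> l" using ls(2,3) by (auto simp: o_def)
  ultimately show ?thesis using that ls(1) r by blast
qed

lemma (in gaussian_space) compact_symmetric_convex_set:
  obtains K where "compact K" "convex K" "symmetric_set K" "measure M K \<ge> 9/10"
proof -
  obtain K where K: "compact K" "measure M K > 1 - 1/10"
    using tight_compact[OF prob_space_axioms sets_M, of "1/10"] by auto
  define C where "C = closure (convex hull (K \<union> uminus ` K))"
  have "compact (K \<union> uminus ` K)" using K(1) by (intro compact_Un compact_negations)
  then have C: "compact C" unfolding C_def by (rule compact_closure_convex_hull)
  have "convex C" unfolding C_def by (intro convex_closure convex_convex_hull)
  moreover have "symmetric_set C"
  proof -
    have "C \<subseteq> uminus -` C"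
      unfolding C_def
    proof (intro closure_minimal hull_minimal)
      show "K \<union> uminus ` K \<subseteq> uminus -` closure (convex hull (K \<union> uminus ` K))"
      proof
        fix x assume "x \<in> K \<union> uminus ` K"
        then have "- x \<in> K \<union> uminus ` K" by auto
        then show "x \<in> uminus -` closure (convex hull (K \<union> uminus ` K))"
          using closure_subset hull_inc by (metis subsetD vimageI2)
      qed
      show "convex (uminus -` closure (convex hull (K \<union> uminus ` K)))"
        by (intro convex_linear_vimage convex_closure convex_convex_hull) (simp add: linear_uminus)
      show "closed (uminus -` closure (convex hull (K \<union> uminus ` K)))"
        by (intro closed_vimage closed_closure continuous_intros)
    qed
    then show ?thesis unfolding symmetric_set_def by blast
  qed
  moreover have "measure M C \<ge> 9/10"
  proof -
    have "K \<subseteq> C" unfolding C_def using closure_subset hull_subset by (metis Un_subset_iff order_trans)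
    then have "measure M K \<le> measure M C"
      using borel_compact[OF C] sets_M by (intro finite_measure_mono) auto
    then show ?thesis using K(2) by simp
  qed
  ultimately show ?thesis using that C by blast
qed

section \<open>Weak convergence to zero gives the whole ball\<close>

context extended_coisometry begin

abbreviation Y :: "'a \<Rightarrow> nat \<Rightarrow> 'a" where "Y \<equiv> normalized_orbit T"

lemma Y_eq: "x \<in> E\<^sub>\<omega> \<Longrightarrow> Y x n = (T\<^sub>0 ^^ n) x /\<^sub>R sqrt (2 * ln (real n))"
  by (simp add: normalized_orbit_def T_pow_eq)

lemma AE_E_omega: "AE x in M. x \<in> E\<^sub>\<omega>"
  using full_subspace_E_omega by (simp add: full_subspace_def)

lemma functional_Y:
  "bounded_linear f \<Longrightarrow> x \<in> E\<^sub>\<omega> \<Longrightarrow> f (Y x n) = f ((T\<^sub>0 ^^ n) x) / sqrt (2 * ln (real n))"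
  by (simp add: Y_eq linear_cmul bounded_linear.linear divide_inverse mult.commute)

lemma sqrt_ln_pos: "n \<ge> 2 \<Longrightarrow> sqrt (2 * ln (real n)) > 0"
  by simp

text \<open>Fernique's theorem for the Minkowski functional of a compact set makes the normalized orbit
  relatively compact.\<close>

lemma orbit_in_compact:
  assumes K: "compact K" "convex K" "symmetric_set K" and big: "measure M K \<ge> 9/10"
  shows "AE x in M. \<forall>\<^sub>F n in sequentially. Y x n \<in> (*\<^sub>R) 4 ` K"
proof -
  have cl: "closed K" using K(1) by (rule compact_imp_closed)
  define A where "A n = {x \<in> space M. (T\<^sub>0 ^^ n) x /\<^sub>R (4 * sqrt (2 * ln (real n))) \<notin> K}" for n
  have [measurable]: "K \<in> sets borel" by (rule borel_compact[OF K(1)])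
  have Am: "A n \<in> events" for n
  proof -
    have [measurable]: "T\<^sub>0 ^^ n \<in> M \<rightarrow>\<^sub>M borel" by (rule borel_measurable_M) simp
    show ?thesis unfolding A_def by measurable
  qed
  have bound: "prob (A n) \<le> real n powr (- 2)" if n: "n \<ge> 3" for n
  proof -
    have "exp 1 \<le> (3::real)" by (rule exp_le)
    also have "\<dots> \<le> real n" using n by simp
    finally have ln1: "ln (real n) \<ge> 1" using n by (simp add: ln_ge_iff)
    have "A n = (T\<^sub>0 ^^ n) -` {x. x /\<^sub>R (4 * sqrt (2 * ln (real n))) \<notin> K} \<inter> space M" by (auto simp: A_def)
    then have "prob (A n) = measure (distr M borel (T\<^sub>0 ^^ n)) {x. x /\<^sub>R (4 * sqrt (2 * ln (real n))) \<notin> K}"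
      using outside_sets[OF cl] by (subst measure_distr) (auto intro!: borel_measurable_M simp: sets_M)
    also have "\<dots> = outside K (4 * sqrt (2 * ln (real n)))" unfolding T0_pow_preserves outside_def ..
    also have "\<dots> \<le> exp (- 2 * ln (real n))" by (rule fernique[OF cl K(2,3) big ln1])
    also have "\<dots> = real n powr (- 2)" using n by (simp add: powr_def)
    finally show ?thesis .
  qed
  have "summable (\<lambda>n. prob (A n))"
  proof (rule summable_comparison_test)
    show "\<exists>N. \<forall>n\<ge>N. norm (prob (A n)) \<le> real n powr (- 2)" using bound by (auto intro!: exI[of _ 3])
    show "summable (\<lambda>n. real n powr (- 2))" by (subst summable_real_powr_iff) simp
  qed
  then have "AE x in M. eventually (\<lambda>n. x \<in> space M - A n) sequentially"
    using Am by (intro borel_cantelli_AE1) (auto simp: emeasure_eq_measure)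
  then show ?thesis using AE_E_omega
  proof eventually_elim
    case (elim x)
    from elim(1) show ?case
    proof eventually_elim
      case (elim n)
      then have "(T\<^sub>0 ^^ n) x /\<^sub>R (4 * sqrt (2 * ln (real n))) \<in> K" by (simp add: A_def)
      moreover have "Y x n = 4 *\<^sub>R ((T\<^sub>0 ^^ n) x /\<^sub>R (4 * sqrt (2 * ln (real n))))" using \<open>x \<in> E\<^sub>\<omega>\<close> by (simp add: Y_eq)
      ultimately show ?case by blast
    qed
  qed
qed

lemma orbit_functional_upper:
  assumes f: "bounded_linear f" and v: "norm (riesz f) \<le> \<sigma>"
  shows "AE x in M. \<forall>l\<in>seq_limit_points (Y x). f l \<le> \<sigma>"
proof -
  have s0: "0 \<le> \<sigma>" using v norm_ge_zero order_trans by blast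
  have "AE x in M. \<forall>\<^sub>F n in sequentially. f ((T\<^sub>0 ^^ n) x) < (\<sigma> + 1 / real (Suc k)) * sqrt (2 * ln (real n))" for k
  proof (rule gaussian_sequence_upper[OF represents_gaussian[OF represents_orbit[OF f]]])
    show "(norm ((U ^^ n) (riesz f)))\<^sup>2 \<le> \<sigma>\<^sup>2" for n using v by (simp add: power_mono)
  qed (use s0 in auto)
  then have "AE x in M. \<forall>k. \<forall>\<^sub>F n in sequentially. f ((T\<^sub>0 ^^ n) x) < (\<sigma> + 1 / real (Suc k)) * sqrt (2 * ln (real n))"
    unfolding AE_all_countable by blast
  then show ?thesis using AE_E_omega
  proof eventually_elim
    case (elim x)
    show ?case
    proof
      fix l assume l: "l \<in> seq_limit_points (Y x)"
      then obtain r where r: "strict_mono r" "(Y x \<circ> r) \<longlonglongrightarrow> l" by (auto simp: seq_limit_points_def)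
      have fl: "(\<lambda>n. f (Y x (r n))) \<longlonglongrightarrow> f l"
        using bounded_linear.tendsto[OF f r(2)] by (simp add: o_def)
      have le: "f l \<le> \<sigma> + 1 / real (Suc k)" for k
      proof (rule tendsto_upperbound[OF fl])
        have "\<forall>\<^sub>F n in sequentially. f ((T\<^sub>0 ^^ n) x) < (\<sigma> + 1 / real (Suc k)) * sqrt (2 * ln (real n))" using elim(1) by blast
        moreover have "\<forall>\<^sub>F n in sequentially. n \<ge> (2::nat)" by (rule eventually_ge_at_top)
        ultimately have "\<forall>\<^sub>F n in sequentially. f (Y x n) \<le> \<sigma> + 1 / real (Suc k)"
        proof eventually_elim
          case e: (elim n)
          then show ?case unfolding functional_Y[OF f elim(2)] using sqrt_ln_pos[of n] by (simp add: pos_divide_le_eq)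
        qed
        then show "\<forall>\<^sub>F n in sequentially. f (Y x (r n)) \<le> \<sigma> + 1 / real (Suc k)"
          by (rule eventually_compose_filterlim[OF _ filterlim_subseq[OF r(1)]])
      qed simp
      have "(\<lambda>k. \<sigma> + 1 / real (Suc k)) \<longlonglongrightarrow> \<sigma> + 0" by (intro tendsto_intros LIMSEQ_Suc[OF lim_1_over_n])
      then have "f l \<le> \<sigma> + 0" by (rule LIMSEQ_le_const) (use le in blast)
      then show "f l \<le> \<sigma>" by simp
    qed
  qed
qed

text \<open>The complement of the unit ball is a union of open half-spaces. By Lindelof's theorem countably
  many of them suffice, so the countably many null sets can be discarded.\<close>

lemma limit_points_subset_ball:
  "AE x in M. seq_limit_points (Y x) \<subseteq> \<iota> ` cball 0 1"
proof -
  define H where "H f = {l. 1 < f l}" for f :: "'a \<Rightarrow> real"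
  have "open S" if S: "S \<in> H ` cm_functionals M" for S
  proof -
    obtain f where f: "f \<in> cm_functionals M" "S = H f" using S by blast
    then have "continuous_on UNIV f" by (simp add: cm_functionals_iff linear_continuous_on)
    then show ?thesis unfolding f(2) H_def by (intro open_Collect_less continuous_on_const)
  qed
  then obtain F' where F': "F' \<subseteq> H ` cm_functionals M" "countable F'" "\<Union>F' = \<Union>(H ` cm_functionals M)"
    by (rule Lindelof)
  then obtain D where D: "countable D" "D \<subseteq> cm_functionals M" "F' = H ` D" unfolding countable_subset_image[symmetric] by (metis countable_subset_image)
  have "AE x in M. \<forall>f\<in>D. \<forall>l\<in>seq_limit_points (Y x). f l \<le> 1"
  proof (subst AE_ball_countable[OF D(1)], rule ballI)
    fix f assume "f \<in> D"
    then have f: "bounded_linear f" "var f \<le> 1" using D(2) by (auto simp: cm_functionals_iff)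
    show "AE x in M. \<forall>l\<in>seq_limit_points (Y x). f l \<le> 1"
      by (rule orbit_functional_upper[OF f(1)]) (simp add: norm_riesz[OF f(1)] f(2))
  qed
  then show ?thesis
  proof eventually_elim
    case (elim x)
    show ?case
    proof
      fix l assume l: "l \<in> seq_limit_points (Y x)"
      then have "l \<notin> \<Union>F'" unfolding D(3) H_def using elim by force
      then have le: "f l \<le> 1" if "f \<in> cm_functionals M" for f
        unfolding F'(3) H_def using that by (auto simp: not_less)
      then have "l \<in> cm_space M" unfolding cm_space_def by (auto intro!: bdd_aboveI2[where M = 1])
      then obtain h where h: "l = \<iota> h" using bij_incl by (auto simp: bij_betw_def)
      have "norm h \<le> 1" by (rule norm_le_functionals) (use le h in blast)
      then show "l \<in> \<iota> ` cball 0 1" using h by simp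
    qed
  qed
qed

lemma scale_functional: "bounded_linear f \<Longrightarrow> bounded_linear (\<lambda>x. c * f x)" for f :: "'a \<Rightarrow> real"
  by (rule bounded_linear_compose[OF bounded_linear_mult_right])

lemma riesz_scale: "bounded_linear f \<Longrightarrow> riesz (\<lambda>x. c * f x) = c *\<^sub>R riesz f"
  using riesz_functional_combine[of f f c 0] by simp

lemma orbit_functional_lower:
  assumes mix: "\<And>x y. (\<lambda>N. inner ((S ^^ N) x) y) \<longlonglongrightarrow> 0"
    and f: "bounded_linear f" and v: "norm (riesz f) = 1" and \<delta>: "0 < \<delta>" "\<delta> < 1"
  shows "AE x in M. \<forall>K. \<exists>N\<ge>K. (1 - \<delta>) * sqrt (2 * ln (real N)) \<le> f ((T\<^sub>0 ^^ N) x)"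
proof (rule growth_lower[OF _ _ _ \<delta>])
  note rep = represents_orbit[OF f]
  show "measurable_linear M (\<lambda>x. f ((T\<^sub>0 ^^ i) x))" for i using rep[of i] by (simp add: represents_def)
  show "var (\<lambda>x. f ((T\<^sub>0 ^^ i) x)) = 1" for i using represents_riesz(2)[OF rep[of i]] v by simp
  fix e :: real assume e: "e > 0"
  have "\<forall>\<^sub>F N in sequentially. \<bar>inner ((S ^^ N) (riesz f)) (riesz f)\<bar> < e"
    using tendstoD[OF mix[of "riesz f" "riesz f"] e] by simp
  then obtain d where d: "\<And>N. N \<ge> d \<Longrightarrow> \<bar>inner ((S ^^ N) (riesz f)) (riesz f)\<bar> < e"
    unfolding eventually_sequentially by blast
  have "var (\<lambda>x. f ((T\<^sub>0 ^^ i) x) + f ((T\<^sub>0 ^^ j) x)) \<le> 2 + 2 * e" if ij: "i + max 1 d \<le> j" for i j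
  proof -
    define n where "n = j - i"
    have n: "j = i + n" "n \<ge> d" using ij by (auto simp: n_def)
    have "represents (\<lambda>x. 1 * f ((T\<^sub>0 ^^ i) x) + 1 * f ((T\<^sub>0 ^^ j) x)) (1 *\<^sub>R (U ^^ i) (riesz f) + 1 *\<^sub>R (U ^^ j) (riesz f))"
      by (rule represents_combine[OF rep rep])
    from represents_riesz(2)[OF this]
    have "var (\<lambda>x. f ((T\<^sub>0 ^^ i) x) + f ((T\<^sub>0 ^^ j) x)) = (norm ((U ^^ i) (riesz f) + 1 *\<^sub>R (U ^^ j) (riesz f)))\<^sup>2" by simp
    also have "\<dots> = 2 + 2 * inner ((U ^^ i) (riesz f)) ((U ^^ j) (riesz f))"
      unfolding norm_add_scaleR_square by (simp add: v)
    also have "inner ((U ^^ i) (riesz f)) ((U ^^ j) (riesz f)) = inner ((S ^^ n) (riesz f)) (riesz f)"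
      unfolding n(1) inner_U_pow_U_pow inner_S_pow ..
    also have "2 + 2 * \<dots> \<le> 2 + 2 * e" using d[OF n(2)] by simp
    finally show ?thesis .
  qed
  then show "\<exists>d\<ge>1. \<forall>i j. i + d \<le> j \<longrightarrow> var (\<lambda>x. f ((T\<^sub>0 ^^ i) x) + f ((T\<^sub>0 ^^ j) x)) \<le> 2 + 2 * e"
    by (intro exI[of _ "max 1 d"]) simp
qed

text \<open>In the unit ball of a Hilbert space, \<open>riesz f / norm (riesz f)\<close> is the only point at which \<open>f\<close>
  attains its maximum. Hence it is a limit point as soon as \<open>f\<close> asymptotically attains that maximum
  along the orbit.\<close>

lemma exposed_point_is_limit_point:
  assumes mix: "\<And>x y. (\<lambda>N. inner ((S ^^ N) x) y) \<longlonglongrightarrow> 0"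
    and f: "bounded_linear f" and v: "norm (riesz f) = 1"
  shows "AE x in M. \<iota> (riesz f) \<in> seq_limit_points (Y x)"
proof -
  obtain K where K: "compact K" "convex K" "symmetric_set K" "measure M K \<ge> 9/10"
    by (rule compact_symmetric_convex_set)
  have "AE x in M. \<forall>k. \<forall>m. \<exists>N\<ge>m. (1 - 1 / real (Suc (Suc k))) * sqrt (2 * ln (real N)) \<le> f ((T\<^sub>0 ^^ N) x)"
    unfolding AE_all_countable[where P = "\<lambda>k x. \<forall>m. \<exists>N\<ge>m. (1 - 1 / real (Suc (Suc k))) * sqrt (2 * ln (real N)) \<le> f ((T\<^sub>0 ^^ N) x)"]
    by (intro allI orbit_functional_lower[OF mix f v]) auto
  then show ?thesis using AE_E_omega orbit_in_compact[OF K] limit_points_subset_ball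
  proof eventually_elim
    case (elim x)
    define C where "C = (*\<^sub>R) 4 ` K"
    have C: "compact C" unfolding C_def by (rule compact_scaling[OF K(1)])
    obtain N0 where N0: "\<And>n. n \<ge> N0 \<Longrightarrow> Y x n \<in> C" using elim(3) unfolding eventually_sequentially C_def by blast
    have "\<exists>n\<ge>k. Y x n \<in> C \<and> 1 - 1 / real (Suc (Suc k)) \<le> f (Y x n)" for k
    proof -
      obtain N where N: "N \<ge> max (max k 2) N0" "(1 - 1 / real (Suc (Suc k))) * sqrt (2 * ln (real N)) \<le> f ((T\<^sub>0 ^^ N) x)"
        using elim(1) by blast
      then have "1 - 1 / real (Suc (Suc k)) \<le> f (Y x N)"
        unfolding functional_Y[OF f elim(2)] using sqrt_ln_pos[of N] by (simp add: pos_le_divide_eq)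
      then show ?thesis using N N0[of N] by (intro exI[of _ N]) auto
    qed
    then obtain l r where l: "l \<in> seq_limit_points (Y x)" "\<And>k. 1 - 1 / real (Suc (Suc k)) \<le> f (Y x (r k))"
        "\<exists>s. strict_mono s \<and> (\<lambda>k. Y x (r (s k))) \<longlonglongrightarrow> l"
      by (rule compact_infinitely_often[OF C, of "Y x" "\<lambda>k n. 1 - 1 / real (Suc (Suc k)) \<le> f (Y x n)"]) blast
    obtain s where s: "strict_mono s" "(\<lambda>k. Y x (r (s k))) \<longlonglongrightarrow> l" using l(3) by blast
    have "1 - 0 \<le> f l"
    proof (rule LIMSEQ_le[OF _ bounded_linear.tendsto[OF f s(2)]])
      have "(\<lambda>k. 1 / real (Suc (Suc k))) \<longlonglongrightarrow> 0" by (intro LIMSEQ_Suc lim_1_over_n)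
      then have "(\<lambda>k. 1 - 1 / real (Suc (Suc k))) \<longlonglongrightarrow> 1 - 0" by (intro tendsto_intros)
      from LIMSEQ_subseq_LIMSEQ[OF this s(1)]
      show "(\<lambda>k. 1 - 1 / real (Suc (Suc (s k)))) \<longlonglongrightarrow> 1 - 0" by (simp add: o_def)
    qed (use l(2) in blast)
    moreover obtain h where h: "l = \<iota> h" "norm h \<le> 1" using elim(4) l(1) by auto
    ultimately have ip: "1 \<le> inner (riesz f) h" using functional_eq_inner[OF f] by simp
    have "(norm (riesz f - h))\<^sup>2 = (norm (riesz f))\<^sup>2 - 2 * inner (riesz f) h + (norm h)\<^sup>2"
      unfolding power2_norm_eq_inner by (simp add: inner_diff_left inner_diff_right inner_commute)
    also have "\<dots> \<le> 1 - 2 + 1"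
      using ip h(2) v power_mono[OF h(2), of 2] by simp
    finally have "norm (riesz f - h) = 0" by simp
    then show ?case using l(1) h(1) by simp
  qed
qed

text \<open>Weakly null orbits become norm null in \<open>'a\<close>: the images stay in a compact set, and every limit
  is annihilated by all functionals.\<close>

lemma weakly_null_incl:
  assumes mix: "\<And>x y. (\<lambda>N. inner ((S ^^ N) x) y) \<longlonglongrightarrow> 0"
    and f: "bounded_linear f" and v: "norm (riesz f) = 1"
  shows "(\<lambda>N. \<iota> ((U ^^ N) (riesz f))) \<longlonglongrightarrow> 0"
proof (rule ccontr)
  define u where "u N = \<iota> ((U ^^ N) (riesz f))" for N
  assume "\<not> ?thesis"
  then have "\<not> u \<longlonglongrightarrow> 0" by (simp add: u_def[abs_def])
  then obtain e where e: "e > 0" "\<And>k. \<exists>n\<ge>k. \<not> dist (u n) 0 < e" unfolding lim_sequentially by blast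
  obtain K where K: "compact K" "convex K" "symmetric_set K" "measure M K \<ge> 9/10"
    by (rule compact_symmetric_convex_set)
  define C where "C = (*\<^sub>R) 2 ` K"
  have C: "compact C" unfolding C_def by (rule compact_scaling[OF K(1)])
  have uC: "u n \<in> C" for n
  proof -
    have rep: "represents (\<lambda>x. f ((T\<^sub>0 ^^ n) x)) ((U ^^ n) (riesz f))" by (rule represents_orbit[OF f])
    then have ml: "measurable_linear M (\<lambda>x. f ((T\<^sub>0 ^^ n) x))" by (simp add: represents_def)
    have "u n = cm_vec (\<lambda>x. f ((T\<^sub>0 ^^ n) x))"
      unfolding u_def incl_riesz[OF ml, symmetric] represents_riesz(1)[OF rep] ..
    moreover have "cm_vec (\<lambda>x. f ((T\<^sub>0 ^^ n) x)) /\<^sub>R 2 \<in> K"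
      by (rule cm_vec_in_double[OF compact_imp_closed[OF K(1)] K(2,3,4) ml])
         (use represents_riesz(2)[OF rep] v in simp)
    ultimately have "u n /\<^sub>R 2 \<in> K" by simp
    moreover have "u n = 2 *\<^sub>R (u n /\<^sub>R 2)" by simp
    ultimately show ?thesis unfolding C_def by blast
  qed
  then have "\<exists>n\<ge>k. u n \<in> C \<and> e \<le> norm (u n)" for k using e(2)[of k] by (auto simp: not_less)
  then obtain l r where l: "\<And>k. e \<le> norm (u (r k))" "\<And>k. r k \<ge> k"
      "\<exists>s. strict_mono s \<and> (\<lambda>k. u (r (s k))) \<longlonglongrightarrow> l"
    by (rule compact_infinitely_often[OF C, of u "\<lambda>k n. e \<le> norm (u n)"]) blast
  obtain s where s: "strict_mono s" "(\<lambda>k. u (r (s k))) \<longlonglongrightarrow> l" using l(3) by blast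
  have "e \<le> norm l" by (rule LIMSEQ_le_const[OF tendsto_norm[OF s(2)]]) (use l(1) in blast)
  then have "l \<noteq> 0" using e(1) by auto
  then obtain g :: "'a \<Rightarrow> real" where g: "bounded_linear g" "g l \<noteq> 0" by (rule separating_functional)
  have "(\<lambda>k. g (u (r (s k)))) \<longlonglongrightarrow> g l" by (rule bounded_linear.tendsto[OF g(1) s(2)])
  moreover have "(\<lambda>k. g (u (r (s k)))) \<longlonglongrightarrow> 0"
  proof -
    have gu: "g (u n) = inner ((S ^^ n) (riesz g)) (riesz f)" for n
      unfolding u_def functional_eq_inner[OF g(1)] inner_S_pow ..
    have "filterlim (\<lambda>k. r (s k)) at_top sequentially"
    proof (rule filterlim_at_top_mono[OF filterlim_subseq[OF s(1)]])
      show "\<forall>\<^sub>F k in sequentially. s k \<le> r (s k)" using l(2) by simp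
    qed
    then show ?thesis unfolding gu by (rule filterlim_compose[OF mix])
  qed
  ultimately show False using g(2) LIMSEQ_unique by blast
qed

text \<open>The limit set is closed and contains \<open>\<iota> (riesz f)\<close> for a countable, hence for every, choice of
  unit vectors \<open>riesz f\<close>; by density it contains the image of the unit sphere. A point \<open>h\<close> of the
  ball is reached from the sphere through \<open>h + t\<^sub>N U\<^sup>N u\<close>, whose image converges to \<open>\<iota> h\<close>.\<close>

theorem limit_set_of_weakly_null:
  assumes mix: "\<And>x y. (\<lambda>N. inner ((S ^^ N) x) y) \<longlonglongrightarrow> 0"
  shows "AE x in M. seq_limit_points (Y x) = \<iota> ` cball 0 1"
proof -
  define Q where "Q = (\<lambda>f. \<iota> (riesz f)) ` {f. bounded_linear f \<and> norm (riesz f) = 1}"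
  obtain Q0 where Q0: "countable Q0" "Q0 \<subseteq> Q" "Q \<subseteq> closure Q0" by (rule separable)
  obtain K where K: "compact K" "convex K" "symmetric_set K" "measure M K \<ge> 9/10"
    by (rule compact_symmetric_convex_set)
  have "AE x in M. \<forall>q\<in>Q0. q \<in> seq_limit_points (Y x)"
  proof (subst AE_ball_countable[OF Q0(1)], rule ballI)
    fix q assume "q \<in> Q0"
    then obtain f where f: "bounded_linear f" "norm (riesz f) = 1" "q = \<iota> (riesz f)" using Q0(2) by (auto simp: Q_def)
    show "AE x in M. q \<in> seq_limit_points (Y x)"
      unfolding f(3) by (rule exposed_point_is_limit_point[OF mix f(1,2)])
  qed
  then show ?thesis using orbit_in_compact[OF K] limit_points_subset_ball
  proof eventually_elim
    case (elim x)
    let ?L = "seq_limit_points (Y x)"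
    have "closure Q0 \<subseteq> ?L" using elim(1) by (intro closure_minimal closed_seq_limit_points) blast
    then have QL: "Q \<subseteq> ?L" using Q0(3) by blast
    have sphere: "\<iota> h \<in> ?L" if h: "norm h = 1" for h
    proof -
      have "h \<in> closure (riesz ` {f. bounded_linear f})" using riesz_dense by simp
      then obtain v where v: "\<And>n. v n \<in> riesz ` {f. bounded_linear f}" "v \<longlonglongrightarrow> h" unfolding closure_sequential by blast
      have h0: "h \<noteq> 0" using h by auto
      have "(\<lambda>n. v n /\<^sub>R norm (v n)) \<longlonglongrightarrow> h /\<^sub>R norm h"
        using v(2) h0 by (intro tendsto_intros) simp_all
      then have "(\<lambda>n. \<iota> (v n /\<^sub>R norm (v n))) \<longlonglongrightarrow> \<iota> (h /\<^sub>R norm h)" by (rule bounded_linear.tendsto[OF bounded_linear_incl])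
      moreover have "\<forall>\<^sub>F n in sequentially. v n \<noteq> 0" by (rule tendsto_imp_eventually_ne[OF v(2) h0])
      then have "\<forall>\<^sub>F n in sequentially. \<iota> (v n /\<^sub>R norm (v n)) \<in> ?L"
      proof eventually_elim
        case (elim n)
        obtain f where f: "bounded_linear f" "v n = riesz f" using v(1)[of n] by blast
        define g where "g = (\<lambda>x. inverse (norm (v n)) * f x)"
        have g: "bounded_linear g" "riesz g = v n /\<^sub>R norm (v n)"
          unfolding g_def using scale_functional[OF f(1)] riesz_scale[OF f(1)] f(2) by auto
        then have "norm (riesz g) = 1" using elim by simp
        then have "\<iota> (riesz g) \<in> Q" unfolding Q_def using g(1) by blast
        then show ?case using QL g(2) by auto
      qed
      ultimately have "\<iota> (h /\<^sub>R norm h) \<in> ?L"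
        by (intro Lim_in_closed_set[OF closed_seq_limit_points]) auto
      then show ?thesis using h by simp
    qed
    have "\<iota> h \<in> ?L" if h: "norm h \<le> 1" for h
    proof (cases "\<exists>f. bounded_linear f \<and> riesz f \<noteq> 0")
      case True
      then obtain f0 where f0: "bounded_linear f0" "riesz f0 \<noteq> 0" by blast
      define f where "f = (\<lambda>x. inverse (norm (riesz f0)) * f0 x)"
      have f: "bounded_linear f" "norm (riesz f) = 1"
        unfolding f_def using scale_functional[OF f0(1)] riesz_scale[OF f0(1)] f0(2) by auto
      define u where "u N = (U ^^ N) (riesz f)" for N
      have u1: "norm (u N) = 1" for N by (simp add: u_def f(2))
      have u0: "(\<lambda>N. \<iota> (u N)) \<longlonglongrightarrow> 0" unfolding u_def by (rule weakly_null_incl[OF mix f])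
      \<comment> \<open>The positive root of \<open>norm (h + t u\<^sub>N) = 1\<close> in \<open>t\<close>.\<close>
      define b where "b N = inner h (u N)" for N
      define t where "t N = - b N + sqrt ((b N)\<^sup>2 + (1 - (norm h)\<^sup>2))" for N
      have h2: "(norm h)\<^sup>2 \<le> 1" using h by (simp add: power_le_one)
      have b1: "\<bar>b N\<bar> \<le> 1" for N
      proof -
        have "\<bar>b N\<bar> \<le> norm h * norm (u N)" unfolding b_def by (rule Cauchy_Schwarz_ineq2)
        then show ?thesis using h u1[of N] by simp
      qed
      have t3: "\<bar>t N\<bar> \<le> 3" for N
      proof -
        have "(b N)\<^sup>2 \<le> 1" using b1[of N] by (simp add: abs_square_le_1)
        then have "(b N)\<^sup>2 + (1 - (norm h)\<^sup>2) \<le> 4" using zero_le_power2[of "norm h"] by linarith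
        then have "(b N)\<^sup>2 + (1 - (norm h)\<^sup>2) \<le> 2\<^sup>2" by simp
        then have "sqrt ((b N)\<^sup>2 + (1 - (norm h)\<^sup>2)) \<le> 2" by (rule real_le_lsqrt[rotated]) simp
        moreover have "0 \<le> sqrt ((b N)\<^sup>2 + (1 - (norm h)\<^sup>2))" using h2 by simp
        ultimately show ?thesis unfolding t_def using b1[of N] by linarith
      qed
      have on: "norm (h + t N *\<^sub>R u N) = 1" for N
      proof -
        have "(t N + b N)\<^sup>2 = (b N)\<^sup>2 + (1 - (norm h)\<^sup>2)" unfolding t_def using h2 by simp
        then have "(t N)\<^sup>2 + 2 * t N * b N + (norm h)\<^sup>2 = 1" by (simp add: power2_sum)
        then have "(norm (h + t N *\<^sub>R u N))\<^sup>2 = 1"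
          unfolding norm_add_scaleR_square u1 b_def[symmetric] by simp
        then show ?thesis using power2_eq_1_iff norm_ge_zero by (metis not_one_le_zero neg_0_le_iff_le)
      qed
      have "(\<lambda>N. t N *\<^sub>R \<iota> (u N)) \<longlonglongrightarrow> 0"
      proof (rule tendsto_norm_zero_cancel, rule tendsto_sandwich[of "\<lambda>_. 0" _ _ "\<lambda>N. 3 * norm (\<iota> (u N))"])
        show "(\<lambda>N. 3 * norm (\<iota> (u N))) \<longlonglongrightarrow> 0" using tendsto_mult_right_zero[OF tendsto_norm_zero[OF u0]] .
        show "\<forall>\<^sub>F N in sequentially. norm (t N *\<^sub>R \<iota> (u N)) \<le> 3 * norm (\<iota> (u N))"
          using t3 by (auto intro!: always_eventually mult_right_mono)
      qed auto
      then have "(\<lambda>N. \<iota> h + t N *\<^sub>R \<iota> (u N)) \<longlonglongrightarrow> \<iota> h + 0" by (intro tendsto_intros)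
      then have lim: "(\<lambda>N. \<iota> (h + t N *\<^sub>R u N)) \<longlonglongrightarrow> \<iota> h"
        using linear_incl by (simp add: linear_add linear_cmul)
      show ?thesis
        by (rule Lim_in_closed_set[OF closed_seq_limit_points _ _ lim]) (use sphere[OF on] in auto)
    next
      case False
      \<comment> \<open>Then the Cameron--Martin space is trivial, and only the existence of a limit point matters.\<close>
      have zero: "k = 0" for k :: 'h
      proof (rule functionals_separate)
        fix g :: "'a \<Rightarrow> real" assume g: "bounded_linear g"
        then have "riesz g = 0" using False by blast
        then show "g (\<iota> k) = 0" unfolding functional_eq_inner[OF g] by simp
      qed
      have C: "compact ((*\<^sub>R) 4 ` K)" by (rule compact_scaling[OF K(1)])
      obtain N0 where "\<And>n. n \<ge> N0 \<Longrightarrow> Y x n \<in> (*\<^sub>R) 4 ` K" using elim(2) unfolding eventually_sequentially by blast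
      then have "\<exists>n\<ge>k. Y x n \<in> (*\<^sub>R) 4 ` K \<and> True" for k by (intro exI[of _ "max k N0"]) simp
      then obtain l where "l \<in> ?L" by (rule compact_infinitely_often[OF C, of "Y x" "\<lambda>_ _. True"]) blast
      then obtain k where "l = \<iota> k" using elim(3) by auto
      then show ?thesis using \<open>l \<in> ?L\<close> zero[of k] zero[of h] by simp
    qed
    then show ?case using elim(3) by auto
  qed
qed

end

section \<open>Banach limits of Cesaro means\<close>

definition cesaro :: "(nat \<Rightarrow> real) \<Rightarrow> nat \<Rightarrow> real" where
  "cesaro c N = 1 / real N * (\<Sum>k=1..N. c k)"

lemma cesaro_combine: "cesaro (\<lambda>k. a * c k + b * d k) N = a * cesaro c N + b * cesaro d N"
  unfolding cesaro_def by (simp add: sum.distrib sum_distrib_left[symmetric] algebra_simps)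

lemma cesaro_mono: "(\<And>k. c k \<le> d k) \<Longrightarrow> cesaro c N \<le> cesaro d N"
  unfolding cesaro_def by (intro mult_left_mono sum_mono) auto

lemma cesaro_const: "N \<ge> 1 \<Longrightarrow> cesaro (\<lambda>_. a) N = a"
  unfolding cesaro_def by simp

lemma cesaro_shift_limit:
  assumes "bounded (range c)"
  shows "(\<lambda>N. cesaro (\<lambda>k. c (Suc k) - c k) N) \<longlonglongrightarrow> 0"
proof -
  obtain C where C: "\<And>k. \<bar>c k\<bar> \<le> C" using assms unfolding bounded_iff by auto
  have eq: "cesaro (\<lambda>k. c (Suc k) - c k) N = 1 / real N * (c (Suc N) - c 1)" for N
  proof -
    have "(\<Sum>k=1..N. c (Suc k) - c k) = c (Suc N) - c 1" by (induction N) auto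
    then show ?thesis by (simp add: cesaro_def)
  qed
  show ?thesis
  proof (rule Lim_null_comparison)
    show "\<forall>\<^sub>F N in sequentially. norm (cesaro (\<lambda>k. c (Suc k) - c k) N) \<le> 2 * C * (1 / real N)"
    proof (rule always_eventually, rule allI)
      fix N
      have "\<bar>c (Suc N) - c 1\<bar> \<le> 2 * C" using C[of "Suc N"] C[of 1] by linarith
      then have "1 / real N * \<bar>c (Suc N) - c 1\<bar> \<le> 1 / real N * (2 * C)" by (intro mult_left_mono) auto
      then show "norm (cesaro (\<lambda>k. c (Suc k) - c k) N) \<le> 2 * C * (1 / real N)"
        unfolding eq by (simp add: abs_mult)
    qed
    show "(\<lambda>N. 2 * C * (1 / real N)) \<longlonglongrightarrow> 0" by (intro tendsto_mult_right_zero lim_1_over_n)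
  qed
qed

text \<open>Generalized limits that are dominated by the upper Cesaro mean. They are defined on bounded
  sequences; on the other ones nothing is required.\<close>

definition cesaro_limit :: "((nat \<Rightarrow> real) \<Rightarrow> real) \<Rightarrow> bool" where
  "cesaro_limit L \<longleftrightarrow>
     (\<forall>c d a b. bounded (range c) \<longrightarrow> bounded (range d) \<longrightarrow> L (\<lambda>k. a * c k + b * d k) = a * L c + b * L d) \<and>
     (\<forall>c r. bounded (range c) \<longrightarrow> (\<forall>\<^sub>F N in sequentially. cesaro c N \<le> r) \<longrightarrow> L c \<le> r)"

lemma bounded_range_combine:
  fixes c d :: "nat \<Rightarrow> real"
  assumes "bounded (range c)" "bounded (range d)"
  shows "bounded (range (\<lambda>k. a * c k + b * d k))"
proof -
  obtain C D where C: "\<And>k. \<bar>c k\<bar> \<le> C" and D: "\<And>k. \<bar>d k\<bar> \<le> D" using assms unfolding bounded_iff by auto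
  have "\<bar>a * c k + b * d k\<bar> \<le> \<bar>a\<bar> * C + \<bar>b\<bar> * D" for k
  proof -
    have "\<bar>a * c k\<bar> \<le> \<bar>a\<bar> * C" "\<bar>b * d k\<bar> \<le> \<bar>b\<bar> * D" unfolding abs_mult using C D by (auto intro: mult_left_mono)
    then show ?thesis by linarith
  qed
  then show ?thesis unfolding bounded_iff by auto
qed

context
  fixes L :: "(nat \<Rightarrow> real) \<Rightarrow> real"
  assumes L: "cesaro_limit L"
begin

lemma cesaro_limit_combine:
  "bounded (range c) \<Longrightarrow> bounded (range d) \<Longrightarrow> L (\<lambda>k. a * c k + b * d k) = a * L c + b * L d"
  using L unfolding cesaro_limit_def by blast

lemma cesaro_limit_le_eventually:
  "bounded (range c) \<Longrightarrow> \<forall>\<^sub>F N in sequentially. cesaro c N \<le> r \<Longrightarrow> L c \<le> r"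
  using L unfolding cesaro_limit_def by blast

lemma cesaro_limit_le:
  assumes "bounded (range c)" "\<And>k. c k \<le> r" shows "L c \<le> r"
proof (rule cesaro_limit_le_eventually[OF assms(1)])
  show "\<forall>\<^sub>F N in sequentially. cesaro c N \<le> r"
    unfolding eventually_sequentially
  proof (intro exI[of _ 1] allI impI)
    fix N :: nat assume N: "1 \<le> N"
    show "cesaro c N \<le> r" using cesaro_mono[of c "\<lambda>_. r" N] assms(2) cesaro_const[OF N] by simp
  qed
qed

lemma cesaro_limit_mono:
  assumes b: "bounded (range c)" "bounded (range d)" and le: "\<And>k. c k \<le> d k" shows "L c \<le> L d"
proof -
  have "L (\<lambda>k. 1 * c k + (- 1) * d k) \<le> 0" using le by (intro cesaro_limit_le bounded_range_combine b) simp
  then show ?thesis unfolding cesaro_limit_combine[OF b] by simp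
qed

lemma cesaro_limit_sum:
  assumes "finite F" "\<And>e. e \<in> F \<Longrightarrow> bounded (range (c e))"
  shows "L (\<lambda>k. \<Sum>e\<in>F. c e k) = (\<Sum>e\<in>F. L (c e)) \<and> bounded (range (\<lambda>k. \<Sum>e\<in>F. c e k))"
  using assms
proof (induction F)
  case empty
  have b: "bounded (range (\<lambda>k::nat. 0::real))" unfolding bounded_iff by (intro exI[of _ 0]) auto
  then show ?case using cesaro_limit_combine[OF b b, of 0 0] by simp
next
  case (insert e F)
  have 1: "(\<lambda>k. \<Sum>e\<in>insert e F. c e k) = (\<lambda>k. 1 * c e k + 1 * (\<Sum>e\<in>F. c e k))" using insert(1,2) by auto
  have b: "bounded (range (c e))" "bounded (range (\<lambda>k. \<Sum>e\<in>F. c e k))" using insert by auto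
  show ?case unfolding 1 using cesaro_limit_combine[OF b, of 1 1] bounded_range_combine[OF b, of 1 1] insert by simp
qed

lemma cesaro_limit_shift:
  assumes b: "bounded (range c)" shows "L (\<lambda>k. c (Suc k)) = L c"
proof -
  have bs: "bounded (range (\<lambda>k. c (Suc k)))" using b by (rule bounded_subset) auto
  have lim: "(\<lambda>N. cesaro (\<lambda>k. c (Suc k) - c k) N) \<longlonglongrightarrow> 0" by (rule cesaro_shift_limit[OF b])
  have le: "L (\<lambda>k. t * c (Suc k) + (- t) * c k) \<le> 0" if t: "t = 1 \<or> t = - 1" for t
  proof (rule field_le_epsilon)
    fix e :: real assume e: "e > 0"
    have "\<forall>\<^sub>F N in sequentially. \<bar>cesaro (\<lambda>k. c (Suc k) - c k) N\<bar> < e" using tendstoD[OF lim e] by simp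
    then have "\<forall>\<^sub>F N in sequentially. cesaro (\<lambda>k. t * c (Suc k) + (- t) * c k) N \<le> e"
    proof eventually_elim
      case (elim N)
      have "(\<lambda>k. t * c (Suc k) + (- t) * c k) = (\<lambda>k. t * (c (Suc k) - c k) + 0 * 0)"
        by (auto simp: algebra_simps)
      then have "cesaro (\<lambda>k. t * c (Suc k) + (- t) * c k) N = t * cesaro (\<lambda>k. c (Suc k) - c k) N"
        using cesaro_combine[of t "\<lambda>k. c (Suc k) - c k" 0 "\<lambda>_. 0" N] by simp
      then show ?case using elim t by auto
    qed
    then have "L (\<lambda>k. t * c (Suc k) + (- t) * c k) \<le> e"
      by (rule cesaro_limit_le_eventually[OF bounded_range_combine[OF bs b]])
    then show "L (\<lambda>k. t * c (Suc k) + (- t) * c k) \<le> 0 + e" by (simp only: add_0_left)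
  qed
  show ?thesis using le[of 1] le[of "- 1"] unfolding cesaro_limit_combine[OF bs b] by simp
qed

end

text \<open>The upper Cesaro mean is sublinear, so by Hahn--Banach some linear functional below it agrees
  with it at \<open>c\<^sub>0\<close>.\<close>

lemma banach_limit_positive:
  fixes c\<^sub>0 :: "nat \<Rightarrow> real"
  assumes b0: "bounded (range c\<^sub>0)" and nn: "\<And>k. c\<^sub>0 k \<ge> 0" and nz: "\<not> cesaro c\<^sub>0 \<longlonglongrightarrow> 0"
  obtains L where "cesaro_limit L" "L c\<^sub>0 > 0"
proof -
  define p where "p c = Inf {r. \<forall>\<^sub>F N in sequentially. cesaro (apply_bcontfun c) N \<le> r}" for c :: "nat \<Rightarrow>\<^sub>C real"
  have bnd: "\<exists>C. \<forall>N\<ge>1. \<bar>cesaro (apply_bcontfun c) N\<bar> \<le> C" for c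
  proof -
    have "\<bar>cesaro (apply_bcontfun c) N\<bar> \<le> norm c" if N: "N \<ge> 1" for N
    proof -
      have "\<bar>apply_bcontfun c k\<bar> \<le> norm c" for k using norm_bounded[of c k] by simp
      then have "apply_bcontfun c k \<le> norm c" "- norm c \<le> apply_bcontfun c k" for k
        by (meson abs_le_iff minus_le_iff)+
      then have "cesaro (apply_bcontfun c) N \<le> cesaro (\<lambda>_. norm c) N" "cesaro (\<lambda>_. - norm c) N \<le> cesaro (apply_bcontfun c) N"
        by (intro cesaro_mono; simp)+
      then show ?thesis using cesaro_const[OF N] by (simp add: abs_le_iff)
    qed
    then show ?thesis by blast
  qed
  have bdd: "bdd_below {r. \<forall>\<^sub>F N in sequentially. cesaro (apply_bcontfun c) N \<le> r}" for c
  proof -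
    obtain C where C: "\<And>N. N \<ge> 1 \<Longrightarrow> \<bar>cesaro (apply_bcontfun c) N\<bar> \<le> C" using bnd by blast
    show ?thesis
    proof (rule bdd_belowI[of _ "- C"])
      fix r assume "r \<in> {r. \<forall>\<^sub>F N in sequentially. cesaro (apply_bcontfun c) N \<le> r}"
      then obtain N0 where "\<And>N. N \<ge> N0 \<Longrightarrow> cesaro (apply_bcontfun c) N \<le> r" unfolding eventually_sequentially by blast
      from this[of "max 1 N0"] C[of "max 1 N0"] show "- C \<le> r" by simp
    qed
  qed
  have ne: "{r. \<forall>\<^sub>F N in sequentially. cesaro (apply_bcontfun c) N \<le> r} \<noteq> {}" for c
  proof -
    obtain C where C: "\<And>N. N \<ge> 1 \<Longrightarrow> \<bar>cesaro (apply_bcontfun c) N\<bar> \<le> C" using bnd by blast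
    have "\<forall>\<^sub>F N in sequentially. cesaro (apply_bcontfun c) N \<le> C"
      unfolding eventually_sequentially using C by (intro exI[of _ 1]) (auto simp: abs_le_iff)
    then show ?thesis by blast
  qed
  have p1: "p c \<le> r" if "\<forall>\<^sub>F N in sequentially. cesaro (apply_bcontfun c) N \<le> r" for c r
    unfolding p_def using that by (intro cInf_lower bdd) simp
  have p2: "\<forall>\<^sub>F N in sequentially. cesaro (apply_bcontfun c) N \<le> r" if lt: "p c < r" for c r
  proof -
    obtain s where s: "\<forall>\<^sub>F N in sequentially. cesaro (apply_bcontfun c) N \<le> s" "s < r"
      using cInf_lessD[OF ne, of c r] lt unfolding p_def by blast
    from s(1) show ?thesis by eventually_elim (use s(2) in simp)
  qed
  have "sublinear p"
    unfolding sublinear_def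
  proof (intro conjI allI impI)
    fix c d
    show "p (c + d) \<le> p c + p d"
    proof (rule field_le_epsilon)
      fix e :: real assume e: "e > 0"
      have "\<forall>\<^sub>F N in sequentially. cesaro (apply_bcontfun c) N \<le> p c + e / 2"
        "\<forall>\<^sub>F N in sequentially. cesaro (apply_bcontfun d) N \<le> p d + e / 2" using e by (auto intro: p2)
      then have "\<forall>\<^sub>F N in sequentially. cesaro (apply_bcontfun (c + d)) N \<le> p c + p d + e"
      proof eventually_elim
        case (elim N)
        have "apply_bcontfun (c + d) = (\<lambda>k. 1 * apply_bcontfun c k + 1 * apply_bcontfun d k)"
          by (auto simp: plus_bcontfun.rep_eq)
        then show ?case using cesaro_combine[of 1 "apply_bcontfun c" 1 "apply_bcontfun d" N] elim by simp
      qed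
      then show "p (c + d) \<le> p c + p d + e" by (rule p1)
    qed
  next
    fix t :: real and c assume t: "t \<ge> 0"
    show "p (t *\<^sub>R c) \<le> t * p c"
    proof (rule field_le_epsilon)
      fix e :: real assume e: "e > 0"
      define \<eta> where "\<eta> = e / (t + 1)"
      have \<eta>: "\<eta> > 0" "t * \<eta> \<le> e" using e t by (auto simp: \<eta>_def field_simps)
      have "\<forall>\<^sub>F N in sequentially. cesaro (apply_bcontfun c) N \<le> p c + \<eta>" using \<eta> by (intro p2) simp
      then have "\<forall>\<^sub>F N in sequentially. cesaro (apply_bcontfun (t *\<^sub>R c)) N \<le> t * p c + e"
      proof eventually_elim
        case (elim N)
        have "apply_bcontfun (t *\<^sub>R c) = (\<lambda>k. t * apply_bcontfun c k + 0 * apply_bcontfun c k)"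
          by (auto simp: scaleR_bcontfun.rep_eq)
        then have "cesaro (apply_bcontfun (t *\<^sub>R c)) N = t * cesaro (apply_bcontfun c) N"
          using cesaro_combine[of t "apply_bcontfun c" 0 "apply_bcontfun c" N] by simp
        also have "\<dots> \<le> t * (p c + \<eta>)" using elim t by (rule mult_left_mono)
        also have "\<dots> \<le> t * p c + e" using \<eta> by (simp add: distrib_left)
        finally show ?case .
      qed
      then show "p (t *\<^sub>R c) \<le> t * p c + e" by (rule p1)
    qed
  qed
  then obtain L where L: "linear L" "\<And>c. L c \<le> p c" "L (Bcontfun c\<^sub>0) = p (Bcontfun c\<^sub>0)"
    by (rule hahn_banach_sublinear[where z = "Bcontfun c\<^sub>0"]) blast
  have rep: "apply_bcontfun (Bcontfun c) = c" if "bounded (range c)" for c :: "nat \<Rightarrow> real"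
    using that by (intro Bcontfun_inverse) (simp add: bcontfun_def)
  have pos: "p (Bcontfun c\<^sub>0) > 0"
  proof (rule ccontr)
    assume "\<not> p (Bcontfun c\<^sub>0) > 0"
    then have ev: "\<forall>\<^sub>F N in sequentially. cesaro c\<^sub>0 N \<le> e" if "e > 0" for e
      using p2[of "Bcontfun c\<^sub>0" e] that rep[OF b0] by simp
    have cn: "cesaro c\<^sub>0 N \<ge> 0" for N unfolding cesaro_def using nn by (intro mult_nonneg_nonneg sum_nonneg) auto
    have "cesaro c\<^sub>0 \<longlonglongrightarrow> 0"
    proof (rule tendstoI)
      fix e :: real assume e: "e > 0"
      then have "\<forall>\<^sub>F N in sequentially. cesaro c\<^sub>0 N \<le> e / 2" by (intro ev) simp
      then show "\<forall>\<^sub>F N in sequentially. dist (cesaro c\<^sub>0 N) 0 < e"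
        by eventually_elim (use cn e in \<open>auto simp: dist_real_def\<close>)
    qed
    then show False using nz by blast
  qed
  have "cesaro_limit (\<lambda>c. L (Bcontfun c))"
    unfolding cesaro_limit_def
  proof (intro conjI allI impI)
    fix c d :: "nat \<Rightarrow> real" and a b :: real
    assume cd: "bounded (range c)" "bounded (range d)"
    have "apply_bcontfun (a *\<^sub>R Bcontfun c + b *\<^sub>R Bcontfun d) = (\<lambda>k. a * c k + b * d k)"
      using rep[OF cd(1)] rep[OF cd(2)] by (auto simp: plus_bcontfun.rep_eq scaleR_bcontfun.rep_eq)
    then have "Bcontfun (apply_bcontfun (a *\<^sub>R Bcontfun c + b *\<^sub>R Bcontfun d)) = Bcontfun (\<lambda>k. a * c k + b * d k)"
      by (rule arg_cong)
    then have eq: "a *\<^sub>R Bcontfun c + b *\<^sub>R Bcontfun d = Bcontfun (\<lambda>k. a * c k + b * d k)"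
      unfolding apply_bcontfun_inverse .
    show "L (Bcontfun (\<lambda>k. a * c k + b * d k)) = a * L (Bcontfun c) + b * L (Bcontfun d)"
      unfolding eq[symmetric] by (simp add: linear_add[OF L(1)] linear_cmul[OF L(1)])
  next
    fix c :: "nat \<Rightarrow> real" and r assume "bounded (range c)" "\<forall>\<^sub>F N in sequentially. cesaro c N \<le> r"
    then have "p (Bcontfun c) \<le> r" by (intro p1) (simp add: rep)
    then show "L (Bcontfun c) \<le> r" using L(2) order_trans by blast
  qed
  then show ?thesis using that[of "\<lambda>c. L (Bcontfun c)"] L(3) pos by simp
qed

text \<open>Used in contrapositive form, to pass from a failure of weak mixing to the squares,
  which are quadratic forms of rank-one operators.\<close>

lemma cesaro_abs_of_square:
  assumes "cesaro (\<lambda>k. (c k)\<^sup>2) \<longlonglongrightarrow> 0"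
  shows "cesaro (\<lambda>k. \<bar>c k\<bar>) \<longlonglongrightarrow> 0"
proof (rule tendstoI)
  fix e :: real assume e: "e > 0"
  have "\<forall>\<^sub>F N in sequentially. \<bar>cesaro (\<lambda>k. (c k)\<^sup>2) N\<bar> < e * e / 2"
    using tendstoD[OF assms, of "e * e / 2"] e by simp
  moreover have "\<forall>\<^sub>F N in sequentially. N \<ge> (1::nat)" by (rule eventually_ge_at_top)
  ultimately show "\<forall>\<^sub>F N in sequentially. dist (cesaro (\<lambda>k. \<bar>c k\<bar>) N) 0 < e"
  proof eventually_elim
    case (elim N)
    \<comment> \<open>\<open>\<bar>c\<bar> \<le> e/2 + c\<^sup>2/(2 e)\<close>, the inequality of arithmetic and geometric means.\<close>
    have "cesaro (\<lambda>k. \<bar>c k\<bar>) N \<le> cesaro (\<lambda>k. (1 / (2 * e)) * (c k)\<^sup>2 + (e / 2) * 1) N"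
    proof (rule cesaro_mono)
      fix k
      have "2 * \<bar>c k\<bar> * e \<le> \<bar>c k\<bar>\<^sup>2 + e\<^sup>2" by (rule sum_squares_bound)
      then show "\<bar>c k\<bar> \<le> (1 / (2 * e)) * (c k)\<^sup>2 + (e / 2) * 1" using e by (simp add: field_simps power2_eq_square)
    qed
    also have "\<dots> = (1 / (2 * e)) * cesaro (\<lambda>k. (c k)\<^sup>2) N + (e / 2) * cesaro (\<lambda>_. 1) N" by (rule cesaro_combine)
    also have "\<dots> < (1 / (2 * e)) * (e * e / 2) + e / 2 * 1"
    proof -
      have "(1 / (2 * e)) * cesaro (\<lambda>k. (c k)\<^sup>2) N < (1 / (2 * e)) * (e * e / 2)"
        using elim(1) e by (intro mult_strict_left_mono) auto
      then show ?thesis using cesaro_const[OF elim(2), of 1] by simp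
    qed
    also have "\<dots> < e" using e by simp
    finally have "cesaro (\<lambda>k. \<bar>c k\<bar>) N < e" .
    moreover have "cesaro (\<lambda>k. \<bar>c k\<bar>) N \<ge> 0" unfolding cesaro_def by (intro mult_nonneg_nonneg sum_nonneg) auto
    ultimately show ?case by (simp add: dist_real_def)
  qed
qed

section \<open>Vectors with almost finite-dimensional orbits\<close>

definition orthonormal :: "'h::real_inner set \<Rightarrow> bool" where
  "orthonormal F \<longleftrightarrow> (\<forall>a\<in>F. \<forall>b\<in>F. inner a b = (if a = b then 1 else 0))"

definition proj :: "'h::real_inner set \<Rightarrow> 'h \<Rightarrow> 'h" where
  "proj F u = (\<Sum>e\<in>F. inner u e *\<^sub>R e)"

lemma inner_proj:
  assumes "finite F" "orthonormal F" "a \<in> F" shows "inner (proj F u) a = inner u a"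
proof -
  have "inner (proj F u) a = (\<Sum>e\<in>F. inner u e * inner e a)" by (simp add: proj_def inner_sum_left)
  also have "\<dots> = (\<Sum>e\<in>F. if e = a then inner u e else 0)"
    using assms(2,3) by (intro sum.cong) (auto simp: orthonormal_def)
  also have "\<dots> = inner u a" using assms(1,3) by simp
  finally show ?thesis .
qed

lemma bessel:
  assumes F: "finite F" "orthonormal F"
  shows "(norm (u - proj F u))\<^sup>2 = (norm u)\<^sup>2 - (\<Sum>e\<in>F. (inner u e)\<^sup>2)"
proof -
  have 1: "inner u (proj F u) = (\<Sum>e\<in>F. (inner u e)\<^sup>2)" by (simp add: proj_def inner_sum_right power2_eq_square)
  have "inner (proj F u) (proj F u) = (\<Sum>e\<in>F. inner u e * inner (proj F u) e)"
    by (subst (2) proj_def) (simp add: inner_sum_right)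
  also have "\<dots> = (\<Sum>e\<in>F. (inner u e)\<^sup>2)" using inner_proj[OF F] by (simp add: power2_eq_square)
  finally have 2: "inner (proj F u) (proj F u) = (\<Sum>e\<in>F. (inner u e)\<^sup>2)" .
  show ?thesis unfolding power2_norm_eq_inner by (simp add: inner_diff_left inner_diff_right inner_commute 1 2)
qed

lemma bessel_le:
  assumes "finite F" "orthonormal F" shows "(\<Sum>e\<in>F. (inner u e)\<^sup>2) \<le> (norm u)\<^sup>2"
  using bessel[OF assms, of u] zero_le_power2[of "norm (u - proj F u)"] by linarith

lemma norm_diff_proj_le:
  assumes "finite F" "orthonormal F" shows "norm (u - proj F u) \<le> norm u"
proof (rule power2_le_imp_le)
  have "(\<Sum>e\<in>F. (inner u e)\<^sup>2) \<ge> 0" by (intro sum_nonneg) simp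
  then show "(norm (u - proj F u))\<^sup>2 \<le> (norm u)\<^sup>2" using bessel[OF assms, of u] by linarith
qed simp

text \<open>A bound \<open>C\<close> on all finite traces leaves, beyond some finite orthonormal set that almost exhausts
  the supremum, only directions in which the quadratic form is small.\<close>

lemma trace_bound_imp_almost_finite_rank:
  fixes A :: "'h::real_inner \<Rightarrow> 'h"
  assumes A: "linear A" and sq: "\<And>z. (norm (A z))\<^sup>2 \<le> C * inner (A z) z"
    and trace: "\<And>F. finite F \<Longrightarrow> orthonormal F \<Longrightarrow> (\<Sum>e\<in>F. inner (A e) e) \<le> C"
    and C: "C \<ge> 0" and \<eta>: "\<eta> > 0"
  obtains F where "finite F" "orthonormal F" "\<And>u. (norm (A (u - proj F u)))\<^sup>2 \<le> C * (\<eta> * (norm u)\<^sup>2)"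
proof -
  define tr where "tr F = (\<Sum>e\<in>F. inner (A e) e)" for F
  define V where "V = tr ` {F. finite F \<and> orthonormal F}"
  have Vne: "V \<noteq> {}" unfolding V_def by (auto intro!: exI[of _ "{}"] simp: orthonormal_def)
  have Vbdd: "bdd_above V" unfolding V_def tr_def using trace by (auto intro!: bdd_aboveI2[where M = C])
  obtain F where F: "finite F" "orthonormal F" "Sup V - \<eta> < tr F"
    using less_cSupD[OF Vne, of "Sup V - \<eta>"] \<eta> by (auto simp: V_def)
  have small: "inner (A z) z \<le> \<eta> * (norm z)\<^sup>2" if z: "\<And>e. e \<in> F \<Longrightarrow> inner z e = 0" for z
  proof (cases "z = 0")
    case True then show ?thesis by simp
  next
    case False
    define e where "e = z /\<^sub>R norm z"
    have ne: "inner e e = 1" using False by (simp add: e_def power2_norm_eq_inner[symmetric] power2_eq_square)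
    have eF: "inner e a = 0" if "a \<in> F" for a using z[OF that] by (simp add: e_def)
    then have "e \<notin> F" using ne by force
    have "orthonormal (insert e F)"
      unfolding orthonormal_def
    proof (intro ballI)
      fix a b assume ab: "a \<in> insert e F" "b \<in> insert e F"
      show "inner a b = (if a = b then 1 else 0)"
        using ab eF ne \<open>e \<notin> F\<close> F(2) unfolding orthonormal_def by (auto simp: inner_commute)
    qed
    then have "tr (insert e F) \<in> V" unfolding V_def using F(1) by blast
    then have "tr (insert e F) \<le> Sup V" using Vbdd by (rule cSup_upper)
    then have "inner (A e) e \<le> \<eta>" using F \<open>e \<notin> F\<close> by (simp add: tr_def)
    moreover have "inner (A z) z = (norm z)\<^sup>2 * inner (A e) e"
    proof -
      have "norm z *\<^sub>R e = z" using False by (simp add: e_def)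
      then have "inner (A z) z = inner (A (norm z *\<^sub>R e)) (norm z *\<^sub>R e)" by simp
      then show ?thesis by (simp add: linear_cmul[OF A] power2_eq_square)
    qed
    ultimately show ?thesis by (simp add: mult.commute mult_right_mono)
  qed
  have "(norm (A (u - proj F u)))\<^sup>2 \<le> C * (\<eta> * (norm u)\<^sup>2)" for u
  proof -
    define z where "z = u - proj F u"
    have "inner z e = 0" if "e \<in> F" for e using inner_proj[OF F(1,2) that, of u] by (simp add: z_def inner_diff_left)
    then have "inner (A z) z \<le> \<eta> * (norm z)\<^sup>2" by (rule small)
    also have "\<dots> \<le> \<eta> * (norm u)\<^sup>2"
      unfolding z_def using \<eta> norm_diff_proj_le[OF F(1,2)] by (intro mult_left_mono power_mono) auto
    finally have "C * inner (A z) z \<le> C * (\<eta> * (norm u)\<^sup>2)" using C by (rule mult_left_mono)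
    then show ?thesis using sq[of z] by (simp add: z_def)
  qed
  then show ?thesis using that F(1,2) by blast
qed

context extended_coisometry begin

text \<open>The operator \<open>A\<close> is a generalized limit of the Cesaro means of the rank-one operators
  \<open>a \<mapsto> (inner u\<^sub>k a) u\<^sub>k\<close> with \<open>u\<^sub>k = U\<^sup>k x\<close>. It commutes with \<open>U\<close> because the limit is shift
  invariant, and its traces are bounded because those of the rank-one operators are (Bessel).\<close>

lemma averaged_operator:
  assumes nz: "\<not> cesaro (\<lambda>k. (inner ((U ^^ k) x) y)\<^sup>2) \<longlonglongrightarrow> 0"
  obtains A where "linear A" "A y \<noteq> 0" "\<And>N a. A ((U ^^ N) a) = (U ^^ N) (A a)"
    "\<And>z. (norm (A z))\<^sup>2 \<le> (norm x)\<^sup>2 * inner (A z) z"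
    "\<And>F. finite F \<Longrightarrow> orthonormal F \<Longrightarrow> (\<Sum>e\<in>F. inner (A e) e) \<le> (norm x)\<^sup>2"
proof -
  define c where "c a b k = inner ((U ^^ k) x) a * inner ((U ^^ k) x) b" for a b k
  have cb: "\<bar>c a b k\<bar> \<le> (norm x)\<^sup>2 * norm a * norm b" for a b k
  proof -
    have "\<bar>inner ((U ^^ k) x) a\<bar> \<le> norm x * norm a" "\<bar>inner ((U ^^ k) x) b\<bar> \<le> norm x * norm b"
      using Cauchy_Schwarz_ineq2[of "(U ^^ k) x" a] Cauchy_Schwarz_ineq2[of "(U ^^ k) x" b] by simp_all
    then have "\<bar>c a b k\<bar> \<le> (norm x * norm a) * (norm x * norm b)"
      unfolding c_def abs_mult by (intro mult_mono) auto
    then show ?thesis by (simp add: power2_eq_square ac_simps)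
  qed
  have bc: "bounded (range (c a b))" for a b using cb[of a b] unfolding bounded_iff by auto
  have "c y y = (\<lambda>k. (inner ((U ^^ k) x) y)\<^sup>2)" by (auto simp: c_def power2_eq_square)
  then have "\<not> cesaro (c y y) \<longlonglongrightarrow> 0" using nz by simp
  moreover have "c y y k \<ge> 0" for k by (simp add: c_def)
  ultimately obtain L where L: "cesaro_limit L" and Lpos: "L (c y y) > 0"
    using banach_limit_positive[OF bc[of y y]] by blast
  define B where "B a b = L (c a b)" for a b
  have Blin: "B a (s *\<^sub>R b + t *\<^sub>R d) = s * B a b + t * B a d" for a b d s t
  proof -
    have "c a (s *\<^sub>R b + t *\<^sub>R d) = (\<lambda>k. s * c a b k + t * c a d k)"
      by (auto simp: c_def inner_add_right algebra_simps)
    then show ?thesis unfolding B_def using cesaro_limit_combine[OF L bc bc] by simp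
  qed
  have Bsym: "B a b = B b a" for a b unfolding B_def c_def by (simp add: mult.commute)
  have Bbound: "B a b \<le> (norm x)\<^sup>2 * norm a * norm b" for a b
    unfolding B_def using cb[of a b] by (intro cesaro_limit_le[OF L bc]) (simp add: abs_le_iff)
  have "\<exists>A. \<forall>b. B a b = inner A b" for a
  proof -
    have add: "B a (b + d) = B a b + B a d" for b d using Blin[of a 1 b 1 d] by simp
    have scl: "B a (s *\<^sub>R b) = s * B a b" for s b using Blin[of a s b 0 b] by simp
    have "\<bar>B a b\<bar> \<le> (norm x)\<^sup>2 * norm a * norm b" for b
      using Bbound[of a b] Bbound[of a "- b"] scl[of "- 1" b] by (simp add: abs_le_iff)
    then have "bounded_linear (\<lambda>b. B a b)"
      by (intro bounded_linear_intro[where K = "(norm x)\<^sup>2 * norm a"]) (simp_all add: add scl mult.commute)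
    then obtain k where "\<And>b. B a b = inner k b" by (rule riesz_representation) blast
    then show ?thesis by blast
  qed
  then obtain A where A: "\<And>a b. B a b = inner (A a) b" by metis
  have Alin: "A (s *\<^sub>R a + t *\<^sub>R b) = s *\<^sub>R A a + t *\<^sub>R A b" for s a t b
  proof -
    have "inner (A (s *\<^sub>R a + t *\<^sub>R b)) z = inner (s *\<^sub>R A a + t *\<^sub>R A b) z" for z
      unfolding A[symmetric] Bsym[of _ z] Blin by (simp add: inner_add_left A[symmetric] Bsym[of z])
    then show ?thesis using vector_eq_rdot by blast
  qed
  then have "linear A"
    by (intro linearI) (metis scaleR_one, metis add.right_neutral scaleR_zero_left)
  moreover have "inner (A y) y > 0" unfolding A[symmetric] B_def by (rule Lpos)
  then have "A y \<noteq> 0" by auto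
  moreover have "A (U a) = U (A a)" for a
  proof -
    have "inner (A (U a)) z = inner (U (A a)) z" for z
    proof -
      have "inner (A (U a)) z = L (\<lambda>k. c (U a) z (Suc k))"
        unfolding A[symmetric] B_def by (rule cesaro_limit_shift[OF L bc, symmetric])
      also have "(\<lambda>k. c (U a) z (Suc k)) = c a (S z)"
      proof
        fix k
        have "inner (U ((U ^^ k) x)) (U a) = inner ((U ^^ k) x) a" unfolding inner_S[symmetric] by simp
        moreover have "inner (U ((U ^^ k) x)) z = inner ((U ^^ k) x) (S z)" using inner_S[of z "(U ^^ k) x"] by (simp add: inner_commute)
        ultimately show "c (U a) z (Suc k) = c a (S z) k" by (simp add: c_def)
      qed
      also have "L (c a (S z)) = inner (A a) (S z)" unfolding A[symmetric] B_def ..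
      also have "\<dots> = inner (U (A a)) z" using inner_S[of z "A a"] by (simp add: inner_commute)
      finally show ?thesis .
    qed
    then show ?thesis using vector_eq_rdot by blast
  qed
  then have "A ((U ^^ N) a) = (U ^^ N) (A a)" for N a by (induction N) simp_all
  moreover have "(norm (A z))\<^sup>2 \<le> (norm x)\<^sup>2 * inner (A z) z" for z
  proof -
    define s where "s = (norm x)\<^sup>2"
    have s: "s \<ge> 0" by (simp add: s_def)
    have "L (\<lambda>k. (2 * s) * c z (A z) k + 0 * c z z k) \<le> L (\<lambda>k. s\<^sup>2 * c z z k + 1 * c (A z) (A z) k)"
    proof (rule cesaro_limit_mono[OF L bounded_range_combine[OF bc bc] bounded_range_combine[OF bc bc]])
      fix k
      show "(2 * s) * c z (A z) k + 0 * c z z k \<le> s\<^sup>2 * c z z k + 1 * c (A z) (A z) k"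
        using sum_squares_bound[of "s * inner ((U ^^ k) x) z" "inner ((U ^^ k) x) (A z)"]
        by (simp add: c_def power2_eq_square algebra_simps)
    qed
    then have "s * (2 * B z (A z)) \<le> s\<^sup>2 * B z z + B (A z) (A z)"
      unfolding cesaro_limit_combine[OF L bc bc] B_def by (simp add: algebra_simps)
    moreover have Bz: "B z (A z) = (norm (A z))\<^sup>2" unfolding A by (simp add: power2_norm_eq_inner)
    moreover have "B (A z) (A z) \<le> s * (norm (A z))\<^sup>2" using Bbound[of "A z" "A z"] by (simp add: s_def power2_eq_square mult.assoc)
    ultimately have le: "s * (norm (A z))\<^sup>2 \<le> s * (s * B z z)" by (simp add: power2_eq_square algebra_simps)
    show ?thesis
    proof (cases "s = 0")
      case True
      then show ?thesis using Bbound[of z "A z"] Bz by (simp add: s_def)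
    next
      case False
      then have "s > 0" using s by simp
      then show ?thesis using le unfolding s_def[symmetric] A[symmetric] by (simp only: mult_le_cancel_left_pos)
    qed
  qed
  moreover have "(\<Sum>e\<in>F. inner (A e) e) \<le> (norm x)\<^sup>2" if F: "finite F" "orthonormal F" for F
  proof -
    note sum = cesaro_limit_sum[OF L F(1), of "\<lambda>e. c e e", OF bc]
    have "(\<Sum>e\<in>F. c e e k) \<le> (norm x)\<^sup>2" for k
      using bessel_le[OF F, of "(U ^^ k) x"] by (simp add: c_def power2_eq_square)
    then have "L (\<lambda>k. \<Sum>e\<in>F. c e e k) \<le> (norm x)\<^sup>2" by (rule cesaro_limit_le[OF L conjunct2[OF sum]])
    then show ?thesis unfolding conjunct1[OF sum] A[symmetric] B_def .
  qed
  ultimately show ?thesis by (rule that)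
qed

text \<open>Since \<open>A\<close> commutes with \<open>U\<close> and is almost of finite rank, the whole orbit of \<open>v = A y\<close> stays close
  to a finite-dimensional subspace. Such a \<open>v\<close> plays the role of the eigenvectors in the spectral
  characterization of weak mixing.\<close>

lemma almost_finite_orbit:
  assumes nz: "\<not> cesaro (\<lambda>k. (inner ((U ^^ k) x) y)\<^sup>2) \<longlonglongrightarrow> 0"
  obtains v where "v \<noteq> 0"
    "\<And>\<delta>. \<delta> > 0 \<Longrightarrow> \<exists>F g. finite F \<and> (\<forall>N. norm ((U ^^ N) v - (\<Sum>e\<in>F. inner ((U ^^ N) y) e *\<^sub>R g e)) \<le> \<delta>) \<and> (\<forall>e\<in>F. norm e = 1)"
proof -
  obtain A where A: "linear A" "A y \<noteq> 0" "\<And>N a. A ((U ^^ N) a) = (U ^^ N) (A a)"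
    and sq: "\<And>z. (norm (A z))\<^sup>2 \<le> (norm x)\<^sup>2 * inner (A z) z"
    and tr: "\<And>F. finite F \<Longrightarrow> orthonormal F \<Longrightarrow> (\<Sum>e\<in>F. inner (A e) e) \<le> (norm x)\<^sup>2"
    by (rule averaged_operator[OF nz]) blast
  show ?thesis
  proof (rule that[OF A(2)])
    fix \<delta> :: real assume \<delta>: "\<delta> > 0"
    define D where "D = norm x * norm y + 1"
    have D: "D > 0" by (simp add: D_def add_nonneg_pos)
    have pos: "(\<delta> / D)\<^sup>2 > 0" using \<delta> D by simp
    obtain F where F: "finite F" "orthonormal F"
      and FA: "\<And>u. (norm (A (u - proj F u)))\<^sup>2 \<le> (norm x)\<^sup>2 * ((\<delta> / D)\<^sup>2 * (norm u)\<^sup>2)"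
    proof (rule trace_bound_imp_almost_finite_rank[OF A(1) sq tr zero_le_power2 pos])
      fix F assume "finite F" "orthonormal F"
        "\<And>u. (norm (A (u - proj F u)))\<^sup>2 \<le> (norm x)\<^sup>2 * ((\<delta> / D)\<^sup>2 * (norm u)\<^sup>2)"
      then show thesis by (rule that)
    qed
    have "norm ((U ^^ N) (A y) - (\<Sum>e\<in>F. inner ((U ^^ N) y) e *\<^sub>R A e)) \<le> \<delta>" for N
    proof (rule power2_le_imp_le)
      have "(U ^^ N) (A y) - (\<Sum>e\<in>F. inner ((U ^^ N) y) e *\<^sub>R A e) = A ((U ^^ N) y - proj F ((U ^^ N) y))"
        unfolding A(3)[symmetric] by (simp add: linear_diff[OF A(1)] proj_def linear_sum[OF A(1)] linear_cmul[OF A(1)])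
      then have "(norm ((U ^^ N) (A y) - (\<Sum>e\<in>F. inner ((U ^^ N) y) e *\<^sub>R A e)))\<^sup>2 \<le> (norm x)\<^sup>2 * ((\<delta> / D)\<^sup>2 * (norm y)\<^sup>2)"
        using FA[of "(U ^^ N) y"] by simp
      also have "\<dots> = (\<delta> / D * (norm x * norm y))\<^sup>2" by (simp add: power_mult_distrib power_divide)
      also have "\<dots> \<le> \<delta>\<^sup>2"
      proof (rule power_mono)
        have "\<delta> / D * (norm x * norm y) \<le> \<delta> / D * D" using \<delta> D by (intro mult_left_mono) (auto simp: D_def)
        then show "\<delta> / D * (norm x * norm y) \<le> \<delta>" using D by simp
        show "0 \<le> \<delta> / D * (norm x * norm y)" using \<delta> D by simp
      qed
      finally show "(norm ((U ^^ N) (A y) - (\<Sum>e\<in>F. inner ((U ^^ N) y) e *\<^sub>R A e)))\<^sup>2 \<le> \<delta>\<^sup>2" .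
    qed (use \<delta> in simp)
    moreover have "norm e = 1" if "e \<in> F" for e using F(2) that by (simp add: orthonormal_def norm_eq_1)
    ultimately show "\<exists>F g. finite F \<and> (\<forall>N. norm ((U ^^ N) (A y) - (\<Sum>e\<in>F. inner ((U ^^ N) y) e *\<^sub>R g e)) \<le> \<delta>) \<and> (\<forall>e\<in>F. norm e = 1)"
      using F(1) by blast
  qed
qed

lemma riesz_approx:
  assumes "e > 0" shows "\<exists>f. bounded_linear f \<and> norm (riesz f - v) < e"
proof -
  have "v \<in> closure (riesz ` {f. bounded_linear f})" using riesz_dense by simp
  then show ?thesis using assms unfolding closure_approachable by (auto simp: dist_norm)
qed

text \<open>Along an almost finite-dimensional orbit, \<open>f \<circ> T\<^sub>0\<^sup>N\<close> with \<open>riesz f\<close> close to \<open>v\<close> is a bounded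
  combination of finitely many fixed random variables, up to an error of small variance. Hence it
  grows too slowly for \<open>\<iota> (v /\<^sub>R norm v)\<close> to be a limit point.\<close>

theorem weakly_mixing_of_limit_set:
  assumes lim: "AE x in M. seq_limit_points (Y x) = \<iota> ` cball 0 1"
  shows "cesaro (\<lambda>k. \<bar>inner ((S ^^ k) a) b\<bar>) \<longlonglongrightarrow> 0"
proof (rule ccontr)
  assume "\<not> ?thesis"
  then have "\<not> cesaro (\<lambda>k. (inner ((S ^^ k) a) b)\<^sup>2) \<longlonglongrightarrow> 0" using cesaro_abs_of_square[of "\<lambda>k. inner ((S ^^ k) a) b"] by blast
  moreover have "inner ((S ^^ k) a) b = inner ((U ^^ k) b) a" for k unfolding inner_S_pow by (rule inner_commute)
  ultimately have "\<not> cesaro (\<lambda>k. (inner ((U ^^ k) b) a)\<^sup>2) \<longlonglongrightarrow> 0" by simp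
  then obtain v where v: "v \<noteq> 0"
    "\<And>\<delta>. \<delta> > 0 \<Longrightarrow> \<exists>F g. finite F \<and> (\<forall>N. norm ((U ^^ N) v - (\<Sum>e\<in>F. inner ((U ^^ N) a) e *\<^sub>R g e)) \<le> \<delta>) \<and> (\<forall>e\<in>F. norm e = 1)"
    by (rule almost_finite_orbit) blast
  define \<delta> where "\<delta> = norm v / 6"
  have \<delta>: "\<delta> > 0" using v(1) by (simp add: \<delta>_def)
  obtain F g where F: "finite F" "\<And>e. e \<in> F \<Longrightarrow> norm e = 1"
      and Fg: "\<And>N. norm ((U ^^ N) v - (\<Sum>e\<in>F. inner ((U ^^ N) a) e *\<^sub>R g e)) \<le> \<delta>"
    using v(2)[OF \<delta>] by blast
  obtain f where f: "bounded_linear f" "norm (riesz f - v) < \<delta>" using riesz_approx[OF \<delta>] by blast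
  define D where "D = real (card F) * norm a + 1"
  have D: "D > 0" by (simp add: D_def add_nonneg_pos)
  have "\<exists>\<phi>. \<forall>e. bounded_linear (\<phi> e) \<and> norm (riesz (\<phi> e) - g e) < \<delta> / D"
    using riesz_approx[of "\<delta> / D"] \<delta> D by (intro choice) auto
  then obtain \<phi> where \<phi>: "\<And>e. bounded_linear (\<phi> e)" "\<And>e. norm (riesz (\<phi> e) - g e) < \<delta> / D" by blast
  define q where "q N e = inner ((U ^^ N) a) e" for N e
  have q: "\<bar>q N e\<bar> \<le> norm a" if "e \<in> F" for N e
    unfolding q_def using Cauchy_Schwarz_ineq2[of "(U ^^ N) a" e] F(2)[OF that] by simp
  define \<xi> where "\<xi> N x = 1 * f ((T\<^sub>0 ^^ N) x) + (- 1) * (\<Sum>e\<in>F. q N e * \<phi> e x)" for N x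
  define r where "r N = 1 *\<^sub>R (U ^^ N) (riesz f) + (- 1) *\<^sub>R (\<Sum>e\<in>F. q N e *\<^sub>R riesz (\<phi> e))" for N
  have rep: "represents (\<xi> N) (r N)" for N
    unfolding \<xi>_def r_def
    by (intro represents_combine represents_orbit f represents_sum F(1) represents_functional \<phi>(1))
  have rle: "norm (r N) \<le> 3 * \<delta>" for N
  proof -
    have "r N = (U ^^ N) (riesz f - v) + ((U ^^ N) v - (\<Sum>e\<in>F. q N e *\<^sub>R g e)) + (\<Sum>e\<in>F. q N e *\<^sub>R (g e - riesz (\<phi> e)))"
      by (simp add: r_def linear_diff[OF linear_U_pow] scaleR_diff_right sum_subtractf)
    moreover have "norm (p + p' + p'') \<le> norm p + norm p' + norm p''" for p p' p'' :: 'h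
      using norm_triangle_ineq[of "p + p'" p''] norm_triangle_ineq[of p p'] by linarith
    ultimately have "norm (r N) \<le> norm ((U ^^ N) (riesz f - v)) + norm ((U ^^ N) v - (\<Sum>e\<in>F. q N e *\<^sub>R g e))
        + norm (\<Sum>e\<in>F. q N e *\<^sub>R (g e - riesz (\<phi> e)))"
      by (simp only:)
    moreover have "norm ((U ^^ N) (riesz f - v)) \<le> \<delta>" using f(2) by simp
    moreover have "norm ((U ^^ N) v - (\<Sum>e\<in>F. q N e *\<^sub>R g e)) \<le> \<delta>" using Fg[of N] by (simp add: q_def)
    moreover have "norm (\<Sum>e\<in>F. q N e *\<^sub>R (g e - riesz (\<phi> e))) \<le> \<delta>"
    proof -
      have "norm (\<Sum>e\<in>F. q N e *\<^sub>R (g e - riesz (\<phi> e))) \<le> (\<Sum>e\<in>F. norm a * (\<delta> / D))"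
      proof (rule sum_norm_le)
        fix e assume e: "e \<in> F"
        have le: "norm (g e - riesz (\<phi> e)) \<le> \<delta> / D" using \<phi>(2)[of e] by (simp add: norm_minus_commute)
        show "norm (q N e *\<^sub>R (g e - riesz (\<phi> e))) \<le> norm a * (\<delta> / D)"
          unfolding norm_scaleR by (rule mult_mono[OF q[OF e] le]) simp_all
      qed
      also have "\<dots> = (real (card F) * norm a) * (\<delta> / D)" by simp
      also have "\<dots> \<le> D * (\<delta> / D)" using \<delta> D by (intro mult_right_mono) (auto simp: D_def)
      also have "\<dots> = \<delta>" using D by simp
      finally show ?thesis .
    qed
    ultimately show ?thesis by linarith
  qed
  have "AE x in M. \<forall>\<^sub>F N in sequentially. \<xi> N x < (4 * \<delta>) * sqrt (2 * ln (real N))"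
  proof (rule gaussian_sequence_upper[OF represents_gaussian[OF rep]])
    show "(norm (r N))\<^sup>2 \<le> (3 * \<delta>)\<^sup>2" for N using rle[of N] by (intro power_mono) auto
  qed (use \<delta> in auto)
  then have "AE x in M. False"
    using AE_E_omega lim
  proof eventually_elim
    case (elim x)
    define R where "R = (\<Sum>e\<in>F. norm a * \<bar>\<phi> e x\<bar>)"
    have "norm v > 0" using v(1) by simp
    have "\<iota> (v /\<^sub>R norm v) \<in> seq_limit_points (Y x)" using elim(3) v(1) by simp
    then obtain s where s: "strict_mono s" "(Y x \<circ> s) \<longlonglongrightarrow> \<iota> (v /\<^sub>R norm v)" by (auto simp: seq_limit_points_def)
    have fl: "(\<lambda>n. f (Y x (s n))) \<longlonglongrightarrow> f (\<iota> (v /\<^sub>R norm v))" using bounded_linear.tendsto[OF f(1) s(2)] by (simp add: o_def)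
    have "filterlim (\<lambda>N. sqrt (2 * ln (real N))) at_top sequentially"
      by (intro filterlim_compose[OF sqrt_at_top] filterlim_tendsto_pos_mult_at_top[OF tendsto_const _ filterlim_compose[OF ln_at_top filterlim_real_sequentially]]) simp
    then have "\<forall>\<^sub>F N in sequentially. R / (\<delta> / 2) \<le> sqrt (2 * ln (real N))" unfolding filterlim_at_top by blast
    moreover have "\<forall>\<^sub>F N in sequentially. N \<ge> (2::nat)" by (rule eventually_ge_at_top)
    ultimately have "\<forall>\<^sub>F N in sequentially. f (Y x N) \<le> 4 * \<delta> + \<delta> / 2"
      using elim(1)
    proof eventually_elim
      case e: (elim N)
      have pos: "sqrt (2 * ln (real N)) > 0" by (rule sqrt_ln_pos[OF e(2)])
      have "(\<Sum>e\<in>F. q N e * \<phi> e x) \<le> R" unfolding R_def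
      proof (rule sum_mono)
        fix i assume i: "i \<in> F"
        have "q N i * \<phi> i x \<le> \<bar>q N i\<bar> * \<bar>\<phi> i x\<bar>" by (metis abs_ge_self abs_mult)
        also have "\<dots> \<le> norm a * \<bar>\<phi> i x\<bar>" using q[OF i] by (intro mult_right_mono) auto
        finally show "q N i * \<phi> i x \<le> norm a * \<bar>\<phi> i x\<bar>" .
      qed
      then have "f ((T\<^sub>0 ^^ N) x) \<le> (4 * \<delta>) * sqrt (2 * ln (real N)) + R" using e(3) by (simp add: \<xi>_def)
      moreover have "R \<le> (\<delta> / 2) * sqrt (2 * ln (real N))" using e(1) \<delta> by (simp add: pos_divide_le_eq mult.commute)
      ultimately have "f ((T\<^sub>0 ^^ N) x) \<le> (4 * \<delta> + \<delta> / 2) * sqrt (2 * ln (real N))" by (simp add: distrib_right)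
      then show ?case unfolding functional_Y[OF f(1) elim(2)] using pos by (simp add: pos_divide_le_eq)
    qed
    then have "\<forall>\<^sub>F n in sequentially. f (Y x (s n)) \<le> 4 * \<delta> + \<delta> / 2"
      by (rule eventually_compose_filterlim[OF _ filterlim_subseq[OF s(1)]])
    then have "f (\<iota> (v /\<^sub>R norm v)) \<le> 4 * \<delta> + \<delta> / 2" by (intro tendsto_upperbound[OF fl]) simp_all
    moreover have "norm v - \<delta> \<le> f (\<iota> (v /\<^sub>R norm v))"
    proof -
      have "f (\<iota> (v /\<^sub>R norm v)) = inner v (v /\<^sub>R norm v) + inner (riesz f - v) (v /\<^sub>R norm v)"
        unfolding functional_eq_inner[OF f(1)] inner_diff_left by linarith
      moreover have "inner v (v /\<^sub>R norm v) = norm v" using v(1) by (simp add: power2_norm_eq_inner[symmetric] power2_eq_square)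
      moreover have "\<bar>inner (riesz f - v) (v /\<^sub>R norm v)\<bar> \<le> \<delta>"
        using Cauchy_Schwarz_ineq2[of "riesz f - v" "v /\<^sub>R norm v"] f(2) v(1) by simp
      ultimately show ?thesis by linarith
    qed
    ultimately show ?case using \<open>norm v > 0\<close> by (simp add: \<delta>_def)
  qed
  then show False by simp
qed

end

theorem proposition1p1:
  fixes M :: "'a::{banach, second_countable_topology} measure"
    and \<iota> :: "'h::{real_inner, complete_space} \<Rightarrow> 'a"
    and S :: "'h \<Rightarrow> 'h"
    and E :: "'a set"
    and T :: "'a \<Rightarrow> 'a"
  assumes "abstract_wiener_space M \<iota>"
    and "bounded_linear S"
    and "S \<circ> adjoint S = id"
    and "measurable_linear_extension M \<iota> S E T"
  shows "((\<forall>x y. (\<lambda>N. inner ((S ^^ N) x) y) \<longlonglongrightarrow> 0) \<longrightarrow>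
            (AE x in M. seq_limit_points (normalized_orbit T x) = \<iota> ` cball 0 1)) \<and>
         ((AE x in M. seq_limit_points (normalized_orbit T x) = \<iota> ` cball 0 1) \<longrightarrow>
            (\<forall>x y. (\<lambda>N. 1 / real N * (\<Sum>k=1..N. \<bar>inner ((S ^^ k) x) y\<bar>)) \<longlonglongrightarrow> 0))"
proof -
  interpret extended_coisometry M \<iota> S E T
    using assms by (intro extended_coisometry.intro extended_coisometry_axioms.intro)
  show ?thesis
    using limit_set_of_weakly_null weakly_mixing_of_limit_set unfolding cesaro_def by blast
qed

end
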